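(* Let $\Omega_1\subset\mathbb{C}^k$ and $\Omega_2\subset\mathbb{C}^{n-k}$ be bounded hyperconvex domains ($1\le k<n$) and let $u\in\mathcal{E}(\Omega_1\times\Omega_2)$. Then for every $w_2\in\Omega_2$ the set $\bigcup_{t>0}E(u,t,w_2)$ is pluripolar in $\Omega_1$.
   Context: For $u$ plurisubharmonic on $\Omega_1\times\Omega_2$, $w_2\in\Omega_2$ and $t>0$, $E(u,t,w_2)=\{z_1\in\Omega_1:\ \nu_{u(z_1,\cdot)}(w_2)\ge t\}$, where $\nu_{u(z_1,\cdot)}(w_2)$ is the Lelong number at $w_2$ of $z_2\mapsto u(z_1,z_2)$; equivalently, the set of $z_1$ with $u(z_1,z_2)\le t\log\|z_2-w_2\|+O(1)$ for $z_2\in\Omega_2$. For a bounded hyperconvex domain $\Omega\subset\mathbb{C}^n$: $\mathcal{E}_0(\Omega)$ is the set of bounded plurisubharmonic $\varphi$ on $\Omega$ with $\lim_{z\to\partial\Omega}\varphi(z)=0$ and $\int_\Omega(dd^c\varphi)^n<\infty$; $\mathcal{F}(\Omega)$ is the set of plurisubharmonic $\varphi$ for which some sequence $\varphi_j\in\mathcal{E}_0(\Omega)$ decreases to $\varphi$ with $\sup_j\int_\Omega(dd^c\varphi_j)^n<\infty$; $\mathcal{E}(\Omega)$ is the set of plurisubharmonic $\varphi$ such that for every open $\omega\Subset\Omega$ there is $\varphi_\omega\in\mathcal{F}(\Omega)$ with $\varphi_\omega=\varphi$ on $\omega$. *)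

theory Defs
  imports "HOL-Analysis.Analysis"
begin

definition usc_on :: "'a::topological_space set \<Rightarrow> ('a \<Rightarrow> ereal) \<Rightarrow> bool" where
  "usc_on \<Omega> u \<longleftrightarrow> (\<forall>x\<in>\<Omega>. \<forall>c. u x < c \<longrightarrow> (\<forall>\<^sub>F y in at x within \<Omega>. u y < c))"

(* Mean value (1/2pi) int_0^{2pi} g over the circle, for g bounded above
   (value in [-infinity, infinity)) *)
definition circle_mean :: "(real \<Rightarrow> ereal) \<Rightarrow> ereal" where
  "circle_mean g =
     (enn2ereal (nn_integral lborel (\<lambda>\<theta>. e2ennreal (g \<theta>) * indicator {0..2*pi} \<theta>))
      - enn2ereal (nn_integral lborel (\<lambda>\<theta>. e2ennreal (- g \<theta>) * indicator {0..2*pi} \<theta>)))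
     / ereal (2*pi)"

definition psh_on :: "(complex^'n) set \<Rightarrow> (complex^'n \<Rightarrow> ereal) \<Rightarrow> bool" where
  "psh_on \<Omega> u \<longleftrightarrow> open \<Omega> \<and> (\<forall>x\<in>\<Omega>. u x \<noteq> \<infinity>) \<and> usc_on \<Omega> u \<and>
     (\<forall>a b. (\<forall>\<zeta>. cmod \<zeta> \<le> 1 \<longrightarrow> a + \<zeta> *s b \<in> \<Omega>) \<longrightarrow>
            u a \<le> circle_mean (\<lambda>\<theta>. u (a + cis \<theta> *s b))) \<and>
     (\<forall>C\<in>components \<Omega>. \<exists>x\<in>C. u x \<noteq> -\<infinity>)"

definition hyperconvex :: "(complex^'n) set \<Rightarrow> bool" where
  "hyperconvex \<Omega> \<longleftrightarrow> open \<Omega> \<and> connected \<Omega> \<and> \<Omega> \<noteq> {} \<and> bounded \<Omega> \<and>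
     (\<exists>\<rho>::complex^'n \<Rightarrow> real. continuous_on \<Omega> \<rho> \<and> psh_on \<Omega> (\<lambda>z. ereal (\<rho> z)) \<and>
        (\<forall>z\<in>\<Omega>. \<rho> z < 0) \<and>
        (\<forall>c<0. compact (closure {z\<in>\<Omega>. \<rho> z < c}) \<and> closure {z\<in>\<Omega>. \<rho> z < c} \<subseteq> \<Omega>))"

(* complex Hessian (d^2 f / dz_j d\bar z_k) from the real second derivative B *)
definition cplx_hess :: "(complex^'n) \<Rightarrow>\<^sub>L (complex^'n) \<Rightarrow>\<^sub>L real \<Rightarrow> complex^'n^'n" where
  "cplx_hess B = (\<chi> j. \<chi> k. complex_of_real (1/4) *
      (complex_of_real (B (axis j 1) (axis k 1)) + complex_of_real (B (axis j \<i>) (axis k \<i>))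
       + \<i> * (complex_of_real (B (axis j 1) (axis k \<i>)) - complex_of_real (B (axis j \<i>) (axis k 1)))))"

(* density of (dd^c f)^n w.r.t. Lebesgue measure, up to a dimensional constant *)
definition ma_density :: "(complex^'n) \<Rightarrow>\<^sub>L (complex^'n) \<Rightarrow>\<^sub>L real \<Rightarrow> real" where
  "ma_density B = Re (det (cplx_hess B))"

(* total Monge-Ampere mass int_Omega (dd^c phi)^n of a bounded psh function (Bedford-Taylor):
   supremum of int chi (dd^c phi)^n over continuous compactly supported 0<=chi<=1, the
   latter computed as limit of int chi (dd^c psi_j)^n for C^2 psh psi_j decreasing to phi *)
definition ma_mass :: "(complex^'n) set \<Rightarrow> (complex^'n \<Rightarrow> ereal) \<Rightarrow> ereal" where
  "ma_mass \<Omega> \<phi> = Sup {ereal L | L. \<exists>(h::complex^'n \<Rightarrow> real) U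
        (\<psi>::nat \<Rightarrow> complex^'n \<Rightarrow> real) \<psi>' \<psi>''.
      open U \<and> compact (closure U) \<and> closure U \<subseteq> \<Omega> \<and>
      continuous_on UNIV h \<and> (\<forall>z. 0 \<le> h z \<and> h z \<le> 1) \<and>
      compact (closure {z. h z \<noteq> 0}) \<and> closure {z. h z \<noteq> 0} \<subseteq> U \<and>
      (\<forall>j. psh_on U (\<lambda>z. ereal (\<psi> j z))) \<and>
      (\<forall>j. \<forall>z\<in>U. (\<psi> j has_derivative blinfun_apply (\<psi>' j z)) (at z) \<and>
                  (\<psi>' j has_derivative blinfun_apply (\<psi>'' j z)) (at z)) \<and>
      (\<forall>j. continuous_on U (\<psi>'' j)) \<and>
      (\<forall>j. \<forall>z\<in>U. \<psi> (Suc j) z \<le> \<psi> j z) \<and>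
      (\<forall>z\<in>U. (\<lambda>j. ereal (\<psi> j z)) \<longlonglongrightarrow> \<phi> z) \<and>
      (\<lambda>j. set_lebesgue_integral lborel U (\<lambda>z. h z * ma_density (\<psi>'' j z))) \<longlonglongrightarrow> L}"

definition cE0 :: "(complex^'n) set \<Rightarrow> (complex^'n \<Rightarrow> ereal) \<Rightarrow> bool" where
  "cE0 \<Omega> \<phi> \<longleftrightarrow> psh_on \<Omega> \<phi> \<and> (\<exists>M::real. \<forall>z\<in>\<Omega>. \<bar>\<phi> z\<bar> \<le> ereal M) \<and>
     (\<forall>e>0. \<exists>K. compact K \<and> K \<subseteq> \<Omega> \<and> (\<forall>z\<in>\<Omega> - K. \<bar>\<phi> z\<bar> < ereal e)) \<and>
     ma_mass \<Omega> \<phi> < \<infinity>"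

definition cF :: "(complex^'n) set \<Rightarrow> (complex^'n \<Rightarrow> ereal) \<Rightarrow> bool" where
  "cF \<Omega> \<phi> \<longleftrightarrow> psh_on \<Omega> \<phi> \<and>
     (\<exists>f. (\<forall>j. cE0 \<Omega> (f j)) \<and> (\<forall>j. \<forall>z\<in>\<Omega>. f (Suc j) z \<le> f j z) \<and>
          (\<forall>z\<in>\<Omega>. (\<lambda>j. f j z) \<longlonglongrightarrow> \<phi> z) \<and> (SUP j. ma_mass \<Omega> (f j)) < \<infinity>)"

definition cE :: "(complex^'n) set \<Rightarrow> (complex^'n \<Rightarrow> ereal) \<Rightarrow> bool" where
  "cE \<Omega> \<phi> \<longleftrightarrow> psh_on \<Omega> \<phi> \<and>
     (\<forall>\<omega>. open \<omega> \<and> compact (closure \<omega>) \<and> closure \<omega> \<subseteq> \<Omega> \<longrightarrow>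
        (\<exists>g. cF \<Omega> g \<and> (\<forall>z\<in>\<omega>. g z = \<phi> z)))"

definition vjoin :: "'a^'k \<Rightarrow> 'a^'m \<Rightarrow> 'a^('k + 'm)" where
  "vjoin x y = (\<chi> i. case i of Inl a \<Rightarrow> x $ a | Inr b \<Rightarrow> y $ b)"

definition prod_dom :: "('a^'k) set \<Rightarrow> ('a^'m) set \<Rightarrow> ('a^('k + 'm)) set" where
  "prod_dom A B = (\<lambda>(x, y). vjoin x y) ` (A \<times> B)"

definition lelong_set :: "(complex^('k + 'm) \<Rightarrow> ereal) \<Rightarrow> (complex^'k) set \<Rightarrow> (complex^'m) set
     \<Rightarrow> real \<Rightarrow> complex^'m \<Rightarrow> (complex^'k) set" where
  "lelong_set u \<Omega>1 \<Omega>2 t w2 = {z1\<in>\<Omega>1. \<exists>C::real. \<forall>z2\<in>\<Omega>2 - {w2}.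
        u (vjoin z1 z2) \<le> ereal (t * ln (norm (z2 - w2)) + C)}"

definition pluripolar_in :: "(complex^'n) set \<Rightarrow> (complex^'n) set \<Rightarrow> bool" where
  "pluripolar_in \<Omega> E \<longleftrightarrow> E \<subseteq> \<Omega> \<and>
     (\<forall>a\<in>E. \<exists>V v. open V \<and> a \<in> V \<and> psh_on V v \<and> (\<forall>z\<in>E \<inter> V. v z = -\<infinity>))"

end

theory Submission
  imports Defs
begin

text \<open>Let \<open>h\<^sub>i(z\<^sub>1)\<close> be the minimum of \<open>M - u(z\<^sub>1, z\<^sub>2)\<close> over the ball of radius \<open>exp(-i)\<close>
  around \<open>w\<^sub>2\<close>, divided by \<open>i\<close>. The functions \<open>- h\<^sub>i\<close> are plurisubharmonic, and \<open>h\<^sub>i(z\<^sub>1)\<close> stays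
  bounded away from 0 where the slice has a positive Lelong number. If a subsequence of
  \<open>h\<^sub>i\<close> is summable at a single point of a ball, then minus its sum is plurisubharmonic there and equals
  \<open>-\<infinity>\<close> on the exceptional set. Otherwise Fatou's lemma and the mean value inequality give
  \<open>u(z\<^sub>1, z\<^sub>2) \<le> M - c i\<close> for \<open>z\<^sub>1\<close> in a fixed ball and \<open>|z\<^sub>2 - w\<^sub>2| \<le> exp(-i)\<close>, for all large \<open>i\<close>.

  This is impossible for \<open>u\<close> in the class \<open>\<E>\<close>: the function
  \<open>\<theta> N |z\<^sub>1|\<^sup>2 + \<kappa> \<Sum> log (|z\<^sub>2\<^sub>,\<^sub>b - w\<^sub>2\<^sub>,\<^sub>b|\<^sup>2 + exp(-2N))\<close>, suitably normalised, lies above \<open>u\<close> on a small box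
  but below the approximants of \<open>u\<close> near the boundary, and its Monge--Ampere mass on the box is of order
  \<open>N\<^sup>k\<close>; by the comparison principle these masses would be bounded by those of the approximants.
  The comparison principle for smooth functions follows from the fact that the complex Hessian determinant
  is a null Lagrangian, and it passes to bounded functions through the definition of the mass by
  decreasing smooth approximation.\<close>

section \<open>Directional derivatives\<close>

text \<open>An isolated logarithmic pole carries finite Monge-Ampere mass; a pole of uniform
  strength along an open piece of a fibre does not. Capped at a depth of order N, it leaves each of
  the first k variables room for a quadratic term with coefficient of order N, while the logarithms
  contribute a mass that does not depend on N; hence the growth N^k. The constants split the depth c
  N of \<open>u\<close>: c N / 2 goes to the logarithms, c N / 4 to the normalisation that pushes
  the quadratic term below zero, and the last quarter is the room by which the comparison function
  exceeds \<open>u\<close>. \<open>ma_mass\<close> is a supremum over the limits obtained from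
  admissible smooth approximations. A lower bound therefore needs one such sequence and never the
  uniqueness of the limit measure; but the integrals along that sequence must converge, which is why
  local upper mass bounds appear beside the comparison principle. Three derivatives suffice for the
  smooth theory: the determinant contains second derivatives and its divergence form third
  ones.\<close>

definition dder :: "'a::euclidean_space \<Rightarrow> ('a \<Rightarrow> 'b::real_normed_vector) \<Rightarrow> 'a \<Rightarrow> 'b" where
  "dder v f z = frechet_derivative f (at z) v"

text \<open>Iterated directional derivatives keep every derivative a function into the same space
  \<open>'b\<close>, so inductions on the order need no nested spaces of linear maps. Derivatives
  are two-sided at points of \<open>U\<close>, so \<open>U\<close> is meant to be open.\<close>

primrec Ck :: "nat \<Rightarrow> 'a::euclidean_space set \<Rightarrow> ('a \<Rightarrow> 'b::real_normed_vector) \<Rightarrow> bool" where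
  "Ck 0 U f = continuous_on U f"
| "Ck (Suc n) U f = ((\<forall>z\<in>U. f differentiable (at z)) \<and> (\<forall>v. Ck n U (dder v f)))"

lemma dder_eqI: "(f has_derivative f') (at z) \<Longrightarrow> dder v f z = f' v"
  unfolding dder_def by (metis frechet_derivative_at)

lemma has_derivative_dder: "f differentiable (at z) \<Longrightarrow> (f has_derivative (\<lambda>v. dder v f z)) (at z)"
  unfolding dder_def by (simp add: frechet_derivative_works[symmetric])

lemma dder_cong:
  assumes "open U" "z \<in> U" "\<And>x. x \<in> U \<Longrightarrow> f x = g x"
  shows "dder v f z = dder v g z"
proof -
  have "(f has_derivative D) (at z) \<longleftrightarrow> (g has_derivative D) (at z)" for D
    using assms by (metis has_derivative_transform_within_open)
  then show ?thesis unfolding dder_def frechet_derivative_def by simp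
qed

lemma differentiable_cong_open:
  assumes "open U" "z \<in> U" "\<And>x. x \<in> U \<Longrightarrow> f x = g x" "f differentiable (at z)"
  shows "g differentiable (at z)"
  using assms unfolding differentiable_def by (metis has_derivative_transform_within_open)

lemma Ck_cong:
  assumes "open U" "\<And>x. x \<in> U \<Longrightarrow> f x = g x" "Ck n U f"
  shows "Ck n U g"
  using assms(2,3)
proof (induction n arbitrary: f g)
  case 0
  then show ?case by (simp cong: continuous_on_cong)
next
  case (Suc n)
  have "g differentiable (at z)" if "z \<in> U" for z
    using differentiable_cong_open[OF assms(1) that Suc.prems(1)] Suc.prems(2) that by simp
  moreover have "Ck n U (dder v g)" for v
    using Suc.IH[of "dder v f" "dder v g"] dder_cong[OF assms(1) _ Suc.prems(1)] Suc.prems(2) by simp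
  ultimately show ?case by simp
qed

lemma Ck_SucD: "Ck (Suc n) U f \<Longrightarrow> Ck n U f"
proof (induction n arbitrary: f)
  case 0
  then show ?case
    by (auto intro!: continuous_at_imp_continuous_on differentiable_imp_continuous_within)
next
  case (Suc n)
  then show ?case by simp
qed

lemma Ck_mono: "Ck n U f \<Longrightarrow> m \<le> n \<Longrightarrow> Ck m U f"
  by (induction n) (auto simp: le_Suc_eq dest: Ck_SucD simp del: Ck.simps(2))

lemma Ck_subset: "Ck n U f \<Longrightarrow> V \<subseteq> U \<Longrightarrow> Ck n V f"
  by (induction n arbitrary: f) (auto intro: continuous_on_subset)

lemma Ck_imp_continuous: "Ck n U f \<Longrightarrow> continuous_on U f"
  using Ck_mono[of n U f 0] by simp

lemma Ck_dder: "Ck (Suc n) U f \<Longrightarrow> Ck n U (dder v f)"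
  by simp

lemma dder_const [simp]: "dder v (\<lambda>_. c) = (\<lambda>_. 0)"
  by (rule ext, rule dder_eqI) simp

lemma Ck_const [simp]: "Ck n U (\<lambda>_. c)"
  by (induction n arbitrary: c) (auto intro!: continuous_intros)

lemma dder_bounded_linear:
  assumes "bounded_linear T" "f differentiable (at z)"
  shows "dder v (\<lambda>x. T (f x)) z = T (dder v f z)"
  by (rule dder_eqI)
    (rule bounded_linear.has_derivative[OF assms(1) has_derivative_dder[OF assms(2)]])

lemma Ck_bounded_linear:
  assumes "open U" "bounded_linear T" "Ck n U f"
  shows "Ck n U (\<lambda>x. T (f x))"
  using assms(3)
proof (induction n arbitrary: f)
  case 0
  then show ?case by (simp add: bounded_linear.continuous_on[OF assms(2)])
next
  case (Suc n)
  have "Ck n U (dder v (\<lambda>x. T (f x)))" for v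
    by (rule Ck_cong[OF assms(1), of "\<lambda>x. T (dder v f x)"])
      (use Suc in \<open>auto simp: dder_bounded_linear[OF assms(2)]\<close>)
  moreover have "(\<lambda>x. T (f x)) differentiable (at z)" if "z \<in> U" for z
    using that Suc.prems bounded_linear.has_derivative[OF assms(2)]
    unfolding differentiable_def Ck.simps by blast
  ultimately show ?case by simp
qed

lemma dder_add:
  assumes "f differentiable (at z)" "g differentiable (at z)"
  shows "dder v (\<lambda>x. f x + g x) z = dder v f z + dder v g z"
  by (rule dder_eqI) (intro has_derivative_add has_derivative_dder assms)

lemma dder_diff:
  assumes "f differentiable (at z)" "g differentiable (at z)"
  shows "dder v (\<lambda>x. f x - g x) z = dder v f z - dder v g z"
  by (rule dder_eqI) (intro has_derivative_diff has_derivative_dder assms)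

lemma Ck_add:
  assumes "open U" "Ck n U f" "Ck n U g"
  shows "Ck n U (\<lambda>x. f x + g x)"
  using assms(2,3)
proof (induction n arbitrary: f g)
  case 0
  then show ?case by (simp add: continuous_on_add)
next
  case (Suc n)
  have "Ck n U (dder v (\<lambda>x. f x + g x))" for v
    by (rule Ck_cong[OF assms(1), of "\<lambda>x. dder v f x + dder v g x"])
      (use Suc in \<open>auto simp: dder_add\<close>)
  then show ?case using Suc.prems by simp
qed

lemma Ck_uminus: "open U \<Longrightarrow> Ck n U f \<Longrightarrow> Ck n U (\<lambda>x. - f x)"
  using Ck_bounded_linear[OF _ bounded_linear_minus[OF bounded_linear_ident]] by blast

lemma Ck_diff: "open U \<Longrightarrow> Ck n U f \<Longrightarrow> Ck n U g \<Longrightarrow> Ck n U (\<lambda>x. f x - g x)"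
  using Ck_add[of U n f "\<lambda>x. - g x"] Ck_uminus[of U n g] by simp

lemma dder_bilinear:
  assumes "bounded_bilinear P" "f differentiable (at z)" "g differentiable (at z)"
  shows "dder v (\<lambda>x. P (f x) (g x)) z = P (f z) (dder v g z) + P (dder v f z) (g z)"
  by (rule dder_eqI)
    (rule bounded_bilinear.FDERIV[OF assms(1) has_derivative_dder[OF assms(2)] has_derivative_dder[OF assms(3)]])

lemma Ck_bilinear:
  assumes "open U" "bounded_bilinear P" "Ck n U f" "Ck n U g"
  shows "Ck n U (\<lambda>x. P (f x) (g x))"
  using assms(3,4)
proof (induction n arbitrary: f g)
  case 0
  then show ?case by (simp add: bounded_bilinear.continuous_on[OF assms(2)])
next
  case (Suc n)
  have fg: "Ck n U f" "Ck n U g" using Suc.prems Ck_SucD by blast+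
  have "Ck n U (dder v (\<lambda>x. P (f x) (g x)))" for v
    by (rule Ck_cong[OF assms(1), of "\<lambda>x. P (f x) (dder v g x) + P (dder v f x) (g x)"])
      (use Suc fg in \<open>auto simp: dder_bilinear[OF assms(2)] intro!: Ck_add[OF assms(1)]\<close>)
  moreover have "(\<lambda>x. P (f x) (g x)) differentiable (at z)" if "z \<in> U" for z
  proof -
    have "f differentiable (at z)" "g differentiable (at z)" using Suc.prems that by simp_all
    from bounded_bilinear.FDERIV[OF assms(2) this[THEN has_derivative_dder]]
    show ?thesis unfolding differentiable_def by blast
  qed
  ultimately show ?case by simp
qed

lemma Ck_mult:
  fixes f g :: "'a::euclidean_space \<Rightarrow> 'b::real_normed_algebra"
  shows "open U \<Longrightarrow> Ck n U f \<Longrightarrow> Ck n U g \<Longrightarrow> Ck n U (\<lambda>x. f x * g x)"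
  using Ck_bilinear[OF _ bounded_bilinear_mult] by blast

lemma dder_mult:
  fixes f g :: "'a::euclidean_space \<Rightarrow> 'b::real_normed_algebra"
  assumes "f differentiable (at z)" "g differentiable (at z)"
  shows "dder v (\<lambda>x. f x * g x) z = f z * dder v g z + dder v f z * g z"
  by (rule dder_bilinear[OF bounded_bilinear_mult assms])

lemma Ck_cmult:
  fixes f :: "'a::euclidean_space \<Rightarrow> 'b::real_normed_algebra"
  shows "open U \<Longrightarrow> Ck n U f \<Longrightarrow> Ck n U (\<lambda>x. c * f x)"
  by (rule Ck_mult) auto

lemma dder_cmult:
  fixes f :: "'a::euclidean_space \<Rightarrow> 'b::real_normed_algebra"
  shows "f differentiable (at z) \<Longrightarrow> dder v (\<lambda>x. c * f x) z = c * dder v f z"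
  using dder_bounded_linear[OF bounded_linear_mult_right] by blast

lemma Ck_of_real:
  fixes f :: "'a::euclidean_space \<Rightarrow> real"
  shows "open U \<Longrightarrow> Ck n U f \<Longrightarrow> Ck n U (\<lambda>x. complex_of_real (f x))"
  by (rule Ck_bounded_linear[OF _ bounded_linear_of_real])

lemma dder_of_real:
  fixes f :: "'a::euclidean_space \<Rightarrow> real"
  shows "f differentiable (at z) \<Longrightarrow> dder v (\<lambda>x. complex_of_real (f x)) z = complex_of_real (dder v f z)"
  by (rule dder_bounded_linear[OF bounded_linear_of_real])

lemma Ck_sum:
  assumes "open U" "\<And>i. i \<in> I \<Longrightarrow> Ck n U (f i)"
  shows "Ck n U (\<lambda>x. \<Sum>i\<in>I. f i x)"
  using assms(2)
proof (induction I rule: infinite_finite_induct)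
  case (insert i I)
  then show ?case by (simp add: Ck_add[OF assms(1)])
qed simp_all

lemma dder_sum:
  assumes "\<And>i. i \<in> I \<Longrightarrow> f i differentiable (at z)"
  shows "dder v (\<lambda>x. \<Sum>i\<in>I. f i x) z = (\<Sum>i\<in>I. dder v (f i) z)"
  by (rule dder_eqI) (intro has_derivative_sum has_derivative_dder assms)

lemma Ck_prod:
  fixes f :: "'i \<Rightarrow> 'a::euclidean_space \<Rightarrow> 'b::{real_normed_algebra,comm_ring_1}"
  assumes "open U" "\<And>i. i \<in> I \<Longrightarrow> Ck n U (f i)"
  shows "Ck n U (\<lambda>x. \<Prod>i\<in>I. f i x)"
  using assms(2)
proof (induction I rule: infinite_finite_induct)
  case (insert i I)
  then show ?case by (simp add: Ck_mult[OF assms(1)])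
qed simp_all

lemma dder_prod:
  fixes f :: "'i \<Rightarrow> 'a::euclidean_space \<Rightarrow> 'b::real_normed_field"
  assumes "\<And>i. i \<in> I \<Longrightarrow> f i differentiable (at z)"
  shows "dder v (\<lambda>x. \<Prod>i\<in>I. f i x) z = (\<Sum>i\<in>I. dder v (f i) z * (\<Prod>j\<in>I - {i}. f j z))"
  by (rule dder_eqI) (intro has_derivative_prod has_derivative_dder assms)

lemma Ck_linear:
  assumes "bounded_linear T"
  shows "Ck n U T"
proof (cases n)
  case 0
  then show ?thesis using assms by (simp add: linear_continuous_on)
next
  case (Suc m)
  have "dder v T = (\<lambda>_. T v)" for v
    by (rule ext, rule dder_eqI) (rule bounded_linear_imp_has_derivative[OF assms])
  then show ?thesis using Suc bounded_linear_imp_differentiable[OF assms] by simp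
qed

lemma dder_real_comp:
  fixes f :: "'a::euclidean_space \<Rightarrow> real"
  assumes "(h has_real_derivative d) (at (f z))" "f differentiable (at z)"
  shows "dder v (\<lambda>x. h (f x)) z = d * dder v f z"
proof (rule dder_eqI)
  have "(h has_derivative (*) d) (at (f z))"
    using assms(1) unfolding has_field_derivative_def .
  from diff_chain_at[OF has_derivative_dder[OF assms(2)] this]
  show "((\<lambda>x. h (f x)) has_derivative (\<lambda>v. d * dder v f z)) (at z)"
    by (simp add: o_def)
qed

text \<open>The outer function comes with its whole tower of derivatives \<open>D\<close>, which
  lets the induction pass to the shifted tower \<open>\<lambda>i. D (Suc i)\<close>.\<close>

lemma Ck_real_comp:
  fixes f :: "'a::euclidean_space \<Rightarrow> real" and D :: "nat \<Rightarrow> real \<Rightarrow> real"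
  assumes "open U" "f ` U \<subseteq> S"
    and "\<And>i x. i < n \<Longrightarrow> x \<in> S \<Longrightarrow> (D i has_real_derivative D (Suc i) x) (at x)"
    and "continuous_on S (D n)" and "Ck n U f"
  shows "Ck n U (\<lambda>x. D 0 (f x))"
  using assms(3-5)
proof (induction n arbitrary: D)
  case 0
  then show ?case using assms(2) by (auto intro: continuous_on_compose2)
next
  case (Suc n)
  have f: "Ck n U f" using Suc.prems(3) Ck_SucD by blast
  have "Ck n U (\<lambda>x. D (Suc 0) (f x))"
    using Suc.IH[of "\<lambda>i. D (Suc i)"] Suc.prems(1)[of "Suc _"] Suc.prems(2) f by simp
  then have *: "Ck n U (\<lambda>x. D (Suc 0) (f x) * dder v f x)" for v
    using Ck_mult[OF assms(1), of n "\<lambda>x. D (Suc 0) (f x)" "dder v f"] Suc.prems(3) by simp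
  have d: "(D 0 has_real_derivative D (Suc 0) (f z)) (at (f z))" if "z \<in> U" for z
    using Suc.prems(1)[of 0 "f z"] assms(2) that by auto
  have "Ck n U (dder v (\<lambda>x. D 0 (f x)))" for v
    by (rule Ck_cong[OF assms(1) _ *[of v]]) (use dder_real_comp[where h = "D 0" and f = f, OF d] Suc.prems(3) in simp)
  moreover have "(\<lambda>x. D 0 (f x)) differentiable (at z)" if "z \<in> U" for z
  proof -
    have "D 0 differentiable (at (f z))"
      using d[OF that] real_differentiable_def by blast
    then show ?thesis using differentiable_chain_at[of f z "D 0"] Suc.prems(3) that by (simp add: o_def)
  qed
  ultimately show ?case by simp
qed

lemma linear_dder: "f differentiable (at z) \<Longrightarrow> linear (\<lambda>v. dder v f z)"
  using has_derivative_dder[of f z] by (simp add: has_derivative_def bounded_linear.linear)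

lemma dder_add_dir:
  "f differentiable (at z) \<Longrightarrow> dder (v + w) f z = dder v f z + dder w f z"
  by (rule linear_add[OF linear_dder])

lemma dder_scaleR_dir:
  "f differentiable (at z) \<Longrightarrow> dder (c *\<^sub>R v) f z = c *\<^sub>R dder v f z"
  by (rule linear_scale[OF linear_dder])

lemma dder_sum_dir:
  assumes "f differentiable (at z)"
  shows "dder (\<Sum>i\<in>I. c i *\<^sub>R v i) f z = (\<Sum>i\<in>I. c i *\<^sub>R dder (v i) f z)"
  by (simp add: linear_sum[OF linear_dder[OF assms]] dder_scaleR_dir[OF assms])

lemma has_real_derivative_dder_line:
  fixes f :: "'a::euclidean_space \<Rightarrow> real"
  assumes "f differentiable (at (z + t *\<^sub>R v))"
  shows "((\<lambda>s. f (z + s *\<^sub>R v)) has_real_derivative dder v f (z + t *\<^sub>R v)) (at t)"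
proof -
  have "((\<lambda>s. z + s *\<^sub>R v) has_derivative (\<lambda>s. s *\<^sub>R v)) (at t)"
    by (auto intro!: derivative_eq_intros)
  from diff_chain_at[OF this has_derivative_dder[OF assms]]
  have "((\<lambda>s. f (z + s *\<^sub>R v)) has_derivative (\<lambda>s. dder (s *\<^sub>R v) f (z + t *\<^sub>R v))) (at t)"
    by (simp add: o_def)
  then show ?thesis
    unfolding has_field_derivative_def
    by (simp add: dder_scaleR_dir[OF assms] mult_commute_abs)
qed

text \<open>Both mixed derivatives are limits of the same double difference quotient, by applying the mean
  value theorem in the two orders.\<close>

lemma double_difference_mvt:
  fixes f :: "'a::euclidean_space \<Rightarrow> real"
  assumes C: "Ck 2 U f" and t: "0 < t"
    and sub: "\<And>p q. 0 \<le> p \<Longrightarrow> p \<le> t \<Longrightarrow> 0 \<le> q \<Longrightarrow> q \<le> t \<Longrightarrow> z + p *\<^sub>R v + q *\<^sub>R w \<in> U"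
  shows "\<exists>p q. 0 < p \<and> p < t \<and> 0 < q \<and> q < t \<and>
    f (z + t *\<^sub>R v + t *\<^sub>R w) - f (z + t *\<^sub>R v) - f (z + t *\<^sub>R w) + f z
      = t * t * dder w (dder v f) (z + p *\<^sub>R v + q *\<^sub>R w)"
proof -
  have C1: "f differentiable (at x)" "dder v f differentiable (at x)" if "x \<in> U" for x v
    using C that by (auto simp: numeral_2_eq_2)
  \<comment> \<open>\<open>g\<close> is the first difference of \<open>f\<close> in direction
    \<open>w\<close>, viewed along \<open>v\<close>; its increment over [0, t] is the double
    difference.\<close>
  define g where "g s = f ((z + t *\<^sub>R w) + s *\<^sub>R v) - f (z + s *\<^sub>R v)" for s
  have g': "(g has_real_derivative dder v f ((z + t *\<^sub>R w) + s *\<^sub>R v) - dder v f (z + s *\<^sub>R v)) (at s)"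
    if "0 \<le> s" "s \<le> t" for s
    unfolding g_def
    by (intro DERIV_diff has_real_derivative_dder_line C1)
      (use sub[of s t] sub[of s 0] that t in \<open>auto simp: algebra_simps\<close>)
  obtain p where p: "0 < p" "p < t"
    "g t - g 0 = (t - 0) * (dder v f ((z + t *\<^sub>R w) + p *\<^sub>R v) - dder v f (z + p *\<^sub>R v))"
    using MVT2[OF t, of g "\<lambda>s. dder v f ((z + t *\<^sub>R w) + s *\<^sub>R v) - dder v f (z + s *\<^sub>R v)"] g' by blast
  have h': "((\<lambda>s. dder v f ((z + p *\<^sub>R v) + s *\<^sub>R w)) has_real_derivative
      dder w (dder v f) ((z + p *\<^sub>R v) + s *\<^sub>R w)) (at s)" if "0 \<le> s" "s \<le> t" for s
    by (rule has_real_derivative_dder_line) (use sub[of p s] that p in \<open>auto intro!: C1\<close>)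
  obtain q where q: "0 < q" "q < t"
    "dder v f ((z + p *\<^sub>R v) + t *\<^sub>R w) - dder v f ((z + p *\<^sub>R v) + 0 *\<^sub>R w)
       = (t - 0) * dder w (dder v f) ((z + p *\<^sub>R v) + q *\<^sub>R w)"
    using MVT2[OF t, of "\<lambda>s. dder v f ((z + p *\<^sub>R v) + s *\<^sub>R w)"
        "\<lambda>s. dder w (dder v f) ((z + p *\<^sub>R v) + s *\<^sub>R w)"] h' by blast
  have "g t - g 0 = t * t * dder w (dder v f) (z + p *\<^sub>R v + q *\<^sub>R w)"
    using p(3) q(3) by (simp add: algebra_simps)
  then show ?thesis using p q unfolding g_def by (intro exI[of _ p] exI[of _ q]) (simp add: algebra_simps)
qed

lemma dder_commute_real:
  fixes f :: "'a::euclidean_space \<Rightarrow> real"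
  assumes U: "open U" "z \<in> U" and C: "Ck 2 U f"
  shows "dder v (dder w f) z = dder w (dder v f) z"
proof (rule ccontr)
  assume ne: "dder v (dder w f) z \<noteq> dder w (dder v f) z"
  define e where "e = \<bar>dder v (dder w f) z - dder w (dder v f) z\<bar> / 2"
  have e: "e > 0" using ne by (simp add: e_def)
  have cont: "continuous_on U (dder v (dder w f))" "continuous_on U (dder w (dder v f))"
    using C by (auto simp: numeral_2_eq_2)
  obtain d where d: "d > 0" "ball z d \<subseteq> U" using U open_contains_ball by blast
  obtain d1 where d1: "d1 > 0" "\<And>x. x \<in> U \<Longrightarrow> dist x z < d1 \<Longrightarrow> dist (dder v (dder w f) x) (dder v (dder w f) z) < e"
    using cont(1) U e unfolding continuous_on_iff by metis
  obtain d2 where d2: "d2 > 0" "\<And>x. x \<in> U \<Longrightarrow> dist x z < d2 \<Longrightarrow> dist (dder w (dder v f) x) (dder w (dder v f) z) < e"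
    using cont(2) U e unfolding continuous_on_iff by metis
  define m where "m = Min {d, d1, d2}"
  \<comment> \<open>With both steps at most \<open>t\<close>, the points reached from
    \<open>z\<close> stay within m / 2 of it, where all continuity estimates and the inclusion in
    \<open>U\<close> hold.\<close>
  define t where "t = m / (2 * (norm v + norm w + 1))"
  have m: "m > 0" "m \<le> d" "m \<le> d1" "m \<le> d2" using d d1 d2 by (auto simp: m_def)
  have nn: "norm v + norm w + 1 > 0" by (simp add: add_nonneg_pos)
  have t: "t > 0" using m nn by (simp add: t_def)
  have near: "dist (z + p *\<^sub>R v + q *\<^sub>R w) z < m" if "0 \<le> p" "p \<le> t" "0 \<le> q" "q \<le> t" for p q
  proof -
    have "dist (z + p *\<^sub>R v + q *\<^sub>R w) z \<le> p * norm v + q * norm w"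
      using that norm_triangle_ineq[of "p *\<^sub>R v" "q *\<^sub>R w"] by (simp add: dist_norm add.assoc)
    also have "\<dots> \<le> t * norm v + t * norm w"
      using that by (intro add_mono mult_right_mono) auto
    also have "\<dots> \<le> t * (norm v + norm w + 1)" using t by (simp add: algebra_simps)
    also have "\<dots> = m / 2" using nn by (simp add: t_def divide_simps)
    finally show ?thesis using m by simp
  qed
  have sub: "z + p *\<^sub>R v + q *\<^sub>R w \<in> U" if "0 \<le> p" "p \<le> t" "0 \<le> q" "q \<le> t" for p q
    using near[OF that] m d by (auto simp: dist_commute)
  have sub': "z + p *\<^sub>R w + q *\<^sub>R v \<in> U" if "0 \<le> p" "p \<le> t" "0 \<le> q" "q \<le> t" for p q
    using sub[of q p] that by (simp add: algebra_simps)
  obtain p q where pq: "0 < p" "p < t" "0 < q" "q < t"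
    "f (z + t *\<^sub>R v + t *\<^sub>R w) - f (z + t *\<^sub>R v) - f (z + t *\<^sub>R w) + f z
      = t * t * dder w (dder v f) (z + p *\<^sub>R v + q *\<^sub>R w)"
    using double_difference_mvt[OF C t, of z v w] sub by blast
  obtain p' q' where pq': "0 < p'" "p' < t" "0 < q'" "q' < t"
    "f (z + t *\<^sub>R w + t *\<^sub>R v) - f (z + t *\<^sub>R w) - f (z + t *\<^sub>R v) + f z
      = t * t * dder v (dder w f) (z + p' *\<^sub>R w + q' *\<^sub>R v)"
    using double_difference_mvt[OF C t, of z w v] sub' by blast
  have a: "z + t *\<^sub>R w + t *\<^sub>R v = z + t *\<^sub>R v + t *\<^sub>R w" "z + p' *\<^sub>R w + q' *\<^sub>R v = z + q' *\<^sub>R v + p' *\<^sub>R w"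
    by (simp_all add: algebra_simps)
  have "t * t * dder v (dder w f) (z + q' *\<^sub>R v + p' *\<^sub>R w) = t * t * dder w (dder v f) (z + p *\<^sub>R v + q *\<^sub>R w)"
    using pq(5) pq'(5) unfolding a by linarith
  then have eq: "dder v (dder w f) (z + q' *\<^sub>R v + p' *\<^sub>R w) = dder w (dder v f) (z + p *\<^sub>R v + q *\<^sub>R w)"
    using t by simp
  have "dist (dder v (dder w f) (z + q' *\<^sub>R v + p' *\<^sub>R w)) (dder v (dder w f) z) < e"
    using d1(2) sub[of q' p'] near[of q' p'] pq' m by auto
  moreover have "dist (dder w (dder v f) (z + p *\<^sub>R v + q *\<^sub>R w)) (dder w (dder v f) z) < e"
    using d2(2) sub[of p q] near[of p q] pq m by auto
  ultimately have "\<bar>dder v (dder w f) z - dder w (dder v f) z\<bar> < 2 * e"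
    unfolding eq dist_real_def by linarith
  then show False by (simp add: e_def)
qed

text \<open>Real and imaginary part are bounded linear and commute with differentiation, so the real
  case applies to each.\<close>

lemma dder_commute:
  fixes f :: "'a::euclidean_space \<Rightarrow> complex"
  assumes U: "open U" "z \<in> U" and C: "Ck 2 U f"
  shows "dder v (dder w f) z = dder w (dder v f) z"
proof -
  have *: "dder v (dder w (\<lambda>x. T (f x))) z = T (dder v (dder w f) z)"
    if "bounded_linear T" for T :: "complex \<Rightarrow> real" and v w
  proof -
    have "dder v (dder w (\<lambda>x. T (f x))) z = dder v (\<lambda>x. T (dder w f x)) z"
      by (rule dder_cong[OF U]) (use C in \<open>auto simp: numeral_2_eq_2 dder_bounded_linear[OF that]\<close>)
    also have "\<dots> = T (dder v (dder w f) z)"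
      by (rule dder_bounded_linear[OF that]) (use C U in \<open>auto simp: numeral_2_eq_2\<close>)
    finally show ?thesis .
  qed
  have "T (dder v (dder w f) z) = T (dder w (dder v f) z)"
    if "bounded_linear T" for T :: "complex \<Rightarrow> real"
    using *[OF that] dder_commute_real[OF U Ck_bounded_linear[OF U(1) that C], of v w] by simp
  from this[OF bounded_linear_Re] this[OF bounded_linear_Im] show ?thesis
    by (simp add: complex_eq_iff)
qed

section \<open>The complex Hessian determinant as a null Lagrangian\<close>

lemma integral_lborel_translate:
  fixes f :: "'a::euclidean_space \<Rightarrow> 'b::euclidean_space"
  assumes "f \<in> borel_measurable borel"
  shows "integral\<^sup>L lborel (\<lambda>x. f (x + c)) = integral\<^sup>L lborel f"
proof -
  have "integral\<^sup>L lborel f = integral\<^sup>L (distr lborel borel ((+) c)) f"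
    by (simp add: lborel_distr_plus)
  also have "\<dots> = integral\<^sup>L lborel (\<lambda>x. f (c + x))"
    using assms by (subst integral_distr) auto
  finally show ?thesis by (simp add: add.commute)
qed

lemma integrable_lborel_translate:
  fixes f :: "'a::euclidean_space \<Rightarrow> 'b::euclidean_space"
  assumes "integrable lborel f"
  shows "integrable lborel (\<lambda>x. f (x + c))"
proof -
  have "integrable (distr lborel borel ((+) c)) f"
    using assms by (simp add: lborel_distr_plus)
  then have "integrable lborel (\<lambda>x. f (c + x))"
    by (subst (asm) integrable_distr_eq) (use assms in auto)
  then show ?thesis by (simp add: add.commute)
qed

text \<open>The extension agrees with \<open>G\<close> on the open set \<open>U\<close> and with 0
  on the open complement of \<open>K\<close>, and these two sets cover the space. Integrals over
  \<open>K\<close> then become integrals over the whole space, where translation invariance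
  applies.\<close>

lemma Ck_zero_extension:
  fixes G :: "'a::euclidean_space \<Rightarrow> 'b::euclidean_space"
  assumes U: "open U" and K: "closed K" "K \<subseteq> U" and C: "Ck n U G"
    and z: "\<And>x. x \<in> U - K \<Longrightarrow> G x = 0"
  shows "Ck n UNIV (\<lambda>x. if x \<in> K then G x else 0)"
    and "n > 0 \<Longrightarrow> dder v (\<lambda>x. if x \<in> K then G x else 0) x = (if x \<in> K then dder v G x else 0)"
proof -
  let ?E = "\<lambda>G x. if x \<in> K then G x else (0::'b)"
  have d1: "dder v (?E G) x = dder v G x" if "x \<in> U" "\<And>x. x \<in> U - K \<Longrightarrow> G x = 0" for x v and G :: "'a \<Rightarrow> 'b"
    by (rule dder_cong[OF U that(1)]) (use that(2) in auto)
  have d2: "dder v (?E G) x = 0" if "x \<notin> K" for x v and G :: "'a \<Rightarrow> 'b"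
    using dder_cong[of "- K" x "?E G" "\<lambda>_. 0" v] K that by (simp add: open_Compl)
  have d: "dder v (?E G) = ?E (dder v G)" if "\<And>x. x \<in> U - K \<Longrightarrow> G x = 0" for v and G :: "'a \<Rightarrow> 'b"
    using d1[OF _ that] d2 K(2) by fastforce
  then show "n > 0 \<Longrightarrow> dder v (?E G) x = ?E (dder v G) x" using z by simp
  have dz: "dder v G x = 0" if "\<And>x. x \<in> U - K \<Longrightarrow> G x = 0" "x \<in> U - K" for x v and G :: "'a \<Rightarrow> 'b"
    using d1[of x G v] d2[of x v G] that by auto
  show "Ck n UNIV (?E G)"
    using C z
  proof (induction n arbitrary: G)
    case 0
    have "continuous_on U (?E G)"
      using 0 by (subst continuous_on_cong[of U U _ G]) auto
    moreover have "continuous_on (- K) (?E G)"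
      by (subst continuous_on_cong[of "-K" "-K" _ "\<lambda>_. 0"]) auto
    ultimately have "continuous_on (U \<union> - K) (?E G)"
      using U K by (intro continuous_on_open_Un) auto
    moreover have "U \<union> - K = UNIV" using K by auto
    ultimately show ?case by simp
  next
    case (Suc n)
    have "?E G differentiable (at x)" for x
    proof (cases "x \<in> U")
      case True
      show ?thesis
        by (rule differentiable_cong_open[OF U True, of G]) (use Suc.prems True in auto)
    next
      case False
      then show ?thesis
        by (intro differentiable_cong_open[of "- K" x "\<lambda>_. 0" "?E G"]) (use K(1) K(2) in auto)
    qed
    moreover have "Ck n UNIV (dder v (?E G))" for v
      using Suc.IH[of "dder v G"] Suc.prems dz[of G _ v] d[of G v] by auto
    ultimately show ?case by simp
  qed
qed

text \<open>Difference quotients have integral zero by translation invariance.\<close>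

lemma integral_dder_eq_0:
  fixes G :: "'a::euclidean_space \<Rightarrow> 'b::euclidean_space"
  assumes U: "open U" and K: "compact K" "K \<subseteq> U" and C: "Ck 1 U G"
    and z: "\<And>x. x \<in> U - K \<Longrightarrow> G x = 0"
  shows "(LINT x:K|lborel. dder v G x) = 0"
proof -
  define H where "H x = (if x \<in> K then G x else 0)" for x
  have clK: "closed K" using K compact_imp_closed by blast
  have H1: "Ck 1 UNIV H" unfolding H_def by (rule Ck_zero_extension[OF U clK K(2) C z])
  have dH: "dder v H x = indicator K x *\<^sub>R dder v G x" for x
    unfolding H_def using Ck_zero_extension(2)[OF U clK K(2) C z, of v x] by simp
  have Hcont: "continuous_on UNIV H" and dcont: "continuous_on UNIV (dder v H)"
    and diff: "H differentiable (at x)" for x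
    using H1 Ck_imp_continuous[OF H1] by auto
  have [measurable]: "H \<in> borel_measurable borel" "dder v H \<in> borel_measurable borel"
    using Hcont dcont by (auto intro: borel_measurable_continuous_onI)
  have intH: "integrable lborel H"
  proof -
    have "integrable lborel (\<lambda>x. indicator K x *\<^sub>R H x)"
      by (rule borel_integrable_compact[OF K(1)]) (use Hcont continuous_on_subset in blast)
    moreover have "(\<lambda>x. indicator K x *\<^sub>R H x) = H" by (auto simp: H_def fun_eq_iff)
    ultimately show ?thesis by simp
  qed
  obtain B where B: "\<And>x. norm (dder v H x) \<le> B"
  proof -
    have "compact (dder v H ` K)" using K dcont by (meson compact_continuous_image continuous_on_subset subset_UNIV)
    then obtain B where "\<forall>y\<in>dder v H ` K. norm y \<le> B" using compact_imp_bounded bounded_iff by blast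
    then have "norm (dder v H x) \<le> max B 0" for x
      by (cases "x \<in> K") (auto simp: dH)
    then show thesis using that by blast
  qed
  obtain R where R: "\<And>x. x \<in> K \<Longrightarrow> norm x \<le> R"
    using compact_imp_bounded[OF K(1)] bounded_iff by blast
  define q where "q n x = real (Suc n) *\<^sub>R (H (x + (1 / real (Suc n)) *\<^sub>R v) - H x)" for n x
  have line: "((\<lambda>t. H (x + t *\<^sub>R v)) has_vector_derivative dder v H (x + t *\<^sub>R v)) (at t)" for x t
  proof -
    have "((\<lambda>s. x + s *\<^sub>R v) has_derivative (\<lambda>s. s *\<^sub>R v)) (at t)"
      by (auto intro!: derivative_eq_intros)
    from diff_chain_at[OF this has_derivative_dder[OF diff]]
    have "((\<lambda>s. H (x + s *\<^sub>R v)) has_derivative (\<lambda>s. dder (s *\<^sub>R v) H (x + t *\<^sub>R v))) (at t)"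
      by (simp add: o_def)
    then show ?thesis unfolding has_vector_derivative_def by (simp add: dder_scaleR_dir[OF diff])
  qed
  have bound: "norm (H (x + t *\<^sub>R v) - H x) \<le> B * t" if "t \<ge> 0" for x t
  proof -
    have "norm (H (x + t *\<^sub>R v) - H (x + 0 *\<^sub>R v)) \<le> B * norm (t - 0)"
    proof (rule differentiable_bound[where S = UNIV and f' = "\<lambda>t s. s *\<^sub>R dder v H (x + t *\<^sub>R v)"])
      show "((\<lambda>t. H (x + t *\<^sub>R v)) has_derivative (\<lambda>s. s *\<^sub>R dder v H (x + t *\<^sub>R v))) (at t within UNIV)" for t
        using line[of x t] unfolding has_vector_derivative_def by simp
      show "onorm (\<lambda>s. s *\<^sub>R dder v H (x + t *\<^sub>R v)) \<le> B" for t
        by (rule onorm_le) (simp add: B mult.commute[of B] mult_left_mono)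
    qed auto
    then show ?thesis using that by simp
  qed
  \<comment> \<open>All steps have length at most \<open>norm v\<close>, so every \<open>q n\<close>
    vanishes outside the ball of radius \<open>R + norm v\<close>; inside, the mean value estimate
    \<open>bound\<close> gives the constant \<open>B\<close>.\<close>
  have "(\<lambda>n. integral\<^sup>L lborel (q n)) \<longlonglongrightarrow> integral\<^sup>L lborel (dder v H)"
  proof (rule integral_dominated_convergence[where w = "\<lambda>x. indicator (cball 0 (R + norm v)) x *\<^sub>R B"])
    show "integrable lborel (\<lambda>x. indicator (cball 0 (R + norm v)) x *\<^sub>R B)"
      by (rule borel_integrable_compact) auto
    show "AE x in lborel. (\<lambda>n. q n x) \<longlonglongrightarrow> dder v H x"
    proof (rule AE_I2)
      fix x
      have "((\<lambda>t. H (x + t *\<^sub>R v)) has_vector_derivative dder v H x) (at 0)"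
        using line[of x 0] by simp
      then have "((\<lambda>h. (H (x + h *\<^sub>R v) - H x) /\<^sub>R h) \<longlongrightarrow> dder v H x) (at 0)"
      proof -
        assume a: "((\<lambda>t. H (x + t *\<^sub>R v)) has_vector_derivative dder v H x) (at 0)"
        have eq: "dist ((H (x + h *\<^sub>R v) - H x) /\<^sub>R h) (dder v H x)
            = norm (H (x + h *\<^sub>R v) - H x - h *\<^sub>R dder v H x) / \<bar>h\<bar>" if "h \<noteq> 0" for h
        proof -
          have "(H (x + h *\<^sub>R v) - H x) /\<^sub>R h - dder v H x
              = (H (x + h *\<^sub>R v) - H x - h *\<^sub>R dder v H x) /\<^sub>R h"
            using that by (simp add: scaleR_diff_right)
          then show ?thesis by (simp add: dist_norm divide_inverse mult.commute)
        qed
        show ?thesis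
          using a unfolding tendsto_iff eventually_at has_vector_derivative_def has_derivative_at'
          by (auto simp: eq)
      qed
      moreover have "filterlim (\<lambda>n. 1 / real (Suc n)) (at 0) sequentially"
        using LIMSEQ_Suc[OF lim_1_over_n[where 'a = real]] by (auto simp: filterlim_at intro!: eventuallyI)
      ultimately have "(\<lambda>n. (H (x + (1 / real (Suc n)) *\<^sub>R v) - H x) /\<^sub>R (1 / real (Suc n))) \<longlonglongrightarrow> dder v H x"
        by (rule filterlim_compose)
      then show "(\<lambda>n. q n x) \<longlonglongrightarrow> dder v H x" by (simp add: q_def)
    qed
    show "AE x in lborel. norm (q n x) \<le> indicator (cball 0 (R + norm v)) x *\<^sub>R B" for n
    proof (rule AE_I2)
      fix x
      show "norm (q n x) \<le> indicator (cball 0 (R + norm v)) x *\<^sub>R B"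
      proof (cases "x \<in> cball 0 (R + norm v)")
        case True
        have "norm (q n x) \<le> real (Suc n) * (B * (1 / real (Suc n)))"
          unfolding q_def norm_scaleR using bound[of "1 / real (Suc n)" x] by (simp add: pos_le_divide_eq mult.commute del: of_nat_Suc)
        then show ?thesis using True by simp
      next
        case False
        then have far: "norm x > R + norm v" by simp
        have "norm x \<le> norm (x + (1 / real (Suc n)) *\<^sub>R v) + norm ((1 / real (Suc n)) *\<^sub>R v)"
          by (metis add_diff_cancel_right' norm_triangle_ineq4)
        moreover have "norm ((1 / real (Suc n)) *\<^sub>R v) \<le> norm v"
          by (simp add: divide_le_eq algebra_simps)
        ultimately have "norm (x + (1 / real (Suc n)) *\<^sub>R v) > R" using far by linarith
        then have "x + (1 / real (Suc n)) *\<^sub>R v \<notin> K" using R not_le by blast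
        moreover have "x \<notin> K" using R[of x] far norm_ge_zero[of v] by linarith
        ultimately show ?thesis using False by (simp add: q_def H_def)
      qed
    qed
    show "q n \<in> borel_measurable lborel" for n unfolding q_def[abs_def] by measurable
  qed simp
  moreover have "integral\<^sup>L lborel (q n) = 0" for n
  proof -
    let ?t = "(1 / real (Suc n)) *\<^sub>R v"
    have "integral\<^sup>L lborel (\<lambda>x. H (x + ?t) - H x) = integral\<^sup>L lborel (\<lambda>x. H (x + ?t)) - integral\<^sup>L lborel H"
      by (rule Bochner_Integration.integral_diff[OF integrable_lborel_translate[OF intH] intH])
    also have "\<dots> = 0" by (simp only: integral_lborel_translate[OF \<open>H \<in> borel_measurable borel\<close>] diff_self)
    finally show ?thesis unfolding q_def by (simp only: integral_scaleR_right scaleR_zero_right)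
  qed
  ultimately have "integral\<^sup>L lborel (dder v H) = 0"
    by (simp add: LIMSEQ_const_iff)
  then show ?thesis unfolding set_lebesgue_integral_def dH .
qed

section \<open>The Wirtinger derivatives d/dz_j (\<open>dz\<close>) and d/dzbar_j
  (\<open>dzb\<close>)\<close>

definition dz :: "'n \<Rightarrow> (complex^'n \<Rightarrow> complex) \<Rightarrow> complex^'n \<Rightarrow> complex" where
  "dz j f z = (dder (axis j 1) f z - \<i> * dder (axis j \<i>) f z) / 2"

definition dzb :: "'n \<Rightarrow> (complex^'n \<Rightarrow> complex) \<Rightarrow> complex^'n \<Rightarrow> complex" where
  "dzb j f z = (dder (axis j 1) f z + \<i> * dder (axis j \<i>) f z) / 2"

lemma Ck_half: "open U \<Longrightarrow> Ck n U f \<Longrightarrow> Ck n U (\<lambda>x. f x / (2::complex))"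
  using Ck_bounded_linear[OF _ bounded_linear_divide] by blast

lemma Ck_dz: "open U \<Longrightarrow> Ck (Suc n) U f \<Longrightarrow> Ck n U (dz j f)"
  unfolding dz_def by (intro Ck_half Ck_diff Ck_cmult Ck_dder)

lemma Ck_dzb: "open U \<Longrightarrow> Ck (Suc n) U f \<Longrightarrow> Ck n U (dzb j f)"
  unfolding dzb_def by (intro Ck_half Ck_add Ck_cmult Ck_dder)

lemma dz_cong:
  assumes "open U" "z \<in> U" "\<And>x. x \<in> U \<Longrightarrow> f x = g x"
  shows "dz j f z = dz j g z"
  unfolding dz_def using dder_cong[OF assms] by simp

lemma dzb_cong:
  assumes "open U" "z \<in> U" "\<And>x. x \<in> U \<Longrightarrow> f x = g x"
  shows "dzb j f z = dzb j g z"
  unfolding dzb_def using dder_cong[OF assms] by simp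

lemma dz_add: "f differentiable (at z) \<Longrightarrow> g differentiable (at z) \<Longrightarrow>
    dz j (\<lambda>x. f x + g x) z = dz j f z + dz j g z"
  by (simp add: dz_def dder_add field_simps)

lemma dzb_add: "f differentiable (at z) \<Longrightarrow> g differentiable (at z) \<Longrightarrow>
    dzb j (\<lambda>x. f x + g x) z = dzb j f z + dzb j g z"
  by (simp add: dzb_def dder_add field_simps)

lemma dz_diff: "f differentiable (at z) \<Longrightarrow> g differentiable (at z) \<Longrightarrow>
    dz j (\<lambda>x. f x - g x) z = dz j f z - dz j g z"
  by (simp add: dz_def dder_diff field_simps)

lemma dzb_diff: "f differentiable (at z) \<Longrightarrow> g differentiable (at z) \<Longrightarrow>
    dzb j (\<lambda>x. f x - g x) z = dzb j f z - dzb j g z"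
  by (simp add: dzb_def dder_diff field_simps)

lemma dz_mult: "f differentiable (at z) \<Longrightarrow> g differentiable (at z) \<Longrightarrow>
    dz j (\<lambda>x. f x * g x) z = f z * dz j g z + dz j f z * g z"
  by (simp add: dz_def dder_mult field_simps)

lemma dzb_mult: "f differentiable (at z) \<Longrightarrow> g differentiable (at z) \<Longrightarrow>
    dzb j (\<lambda>x. f x * g x) z = f z * dzb j g z + dzb j f z * g z"
  by (simp add: dzb_def dder_mult field_simps)

lemma dzb_prod:
  assumes "\<And>i. i \<in> I \<Longrightarrow> f i differentiable (at z)"
  shows "dzb j (\<lambda>x. \<Prod>i\<in>I. f i x) z = (\<Sum>i\<in>I. dzb j (f i) z * (\<Prod>k\<in>I - {i}. f k z))"
  using assms by (simp add: dzb_def dder_prod sum_distrib_left sum.distrib[symmetric] sum_divide_distrib algebra_simps)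

lemma dder_dz:
  assumes "open U" "z \<in> U" "Ck 2 U f"
  shows "dder v (dz j f) z = dz j (dder v f) z"
proof -
  have d: "dder w f differentiable (at z)" for w using assms by (auto simp: numeral_2_eq_2)
  have "dder v (dz j f) z = dder v (\<lambda>x. dder (axis j 1) f x - \<i> * dder (axis j \<i>) f x) z / 2"
    unfolding dz_def using d
    by (intro dder_bounded_linear[OF bounded_linear_divide] differentiable_diff differentiable_mult) auto
  also have "\<dots> = (dder v (dder (axis j 1) f) z - \<i> * dder v (dder (axis j \<i>) f) z) / 2"
    using d by (simp add: dder_cmult dder_diff differentiable_diff differentiable_mult)
  finally show ?thesis
    by (simp add: dz_def dder_commute[OF assms, of v])
qed

lemma dder_dzb:
  assumes "open U" "z \<in> U" "Ck 2 U f"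
  shows "dder v (dzb j f) z = dzb j (dder v f) z"
proof -
  have d: "dder w f differentiable (at z)" for w using assms by (auto simp: numeral_2_eq_2)
  have "dder v (dzb j f) z = dder v (\<lambda>x. dder (axis j 1) f x + \<i> * dder (axis j \<i>) f x) z / 2"
    unfolding dzb_def using d
    by (intro dder_bounded_linear[OF bounded_linear_divide] differentiable_add differentiable_mult) auto
  also have "\<dots> = (dder v (dder (axis j 1) f) z + \<i> * dder v (dder (axis j \<i>) f) z) / 2"
    using d by (simp add: dder_cmult dder_add differentiable_add differentiable_mult)
  finally show ?thesis
    by (simp add: dzb_def dder_commute[OF assms, of v])
qed

lemma dzb_dz:
  assumes "open U" "z \<in> U" "Ck 2 U f"
  shows "dzb k (dz j f) z = dz j (dzb k f) z"
  unfolding dzb_def[of k "dz j f"] dder_dz[OF assms] unfolding dz_def[of j "dzb k f"] dder_dzb[OF assms]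
  unfolding dz_def dzb_def dder_commute[OF assms, of "axis k _"] by (simp add: field_simps)

lemma dzb_dzb:
  assumes "open U" "z \<in> U" "Ck 2 U f"
  shows "dzb k (dzb j f) z = dzb j (dzb k f) z"
  unfolding dzb_def[of k "dzb j f"] dder_dzb[OF assms] unfolding dzb_def[of j "dzb k f"] dder_dzb[OF assms]
  unfolding dzb_def dder_commute[OF assms, of "axis k _"] by (simp add: field_simps)

text \<open>The symmetry of third derivatives in the two conjugate indices; it pairs off the
  unwanted terms in \<open>det_row_hess_divergence\<close>.\<close>

lemma dzb_dz_dzb:
  assumes U: "open U" "z \<in> U" and C: "Ck 3 U f"
  shows "dzb a (dz l (dzb b f)) z = dzb b (dz l (dzb a f)) z"
proof -
  have C2: "Ck 2 U f" "Ck 2 U (dz l f)"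
    using Ck_mono[OF C, of 2] Ck_dz[OF U(1), of 2 f l] C by (simp_all add: numeral_3_eq_3 numeral_2_eq_2)
  have *: "dzb a (dz l (dzb b f)) z = dzb a (dzb b (dz l f)) z" for a b
    by (rule dzb_cong[OF U]) (simp add: dzb_dz[OF U(1) _ C2(1)])
  show ?thesis unfolding * by (rule dzb_dzb[OF U C2(2)])
qed

text \<open>Taking each row from its own function makes the determinant linear in each function separately.\<close>

definition row_hess :: "('n \<Rightarrow> complex^'n \<Rightarrow> complex) \<Rightarrow> complex^'n \<Rightarrow> complex^'n^'n" where
  "row_hess u z = (\<chi> j. \<chi> k. dz j (dzb k (u j)) z)"

text \<open>The terms with third derivatives cancel in pairs under \<open>p \<mapsto> p \<circ> (i l)\<close>.\<close>

lemma det_row_hess_divergence: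
  fixes u :: "'n::finite \<Rightarrow> complex^'n \<Rightarrow> complex"
  assumes U: "open U" "z \<in> U" and C: "\<And>j. Ck 3 U (u j)"
  shows "det (row_hess u z) = (\<Sum>p | p permutes UNIV. of_int (sign p) *
     dzb (p i) (\<lambda>x. dz i (u i) x * (\<Prod>j\<in>UNIV - {i}. dz j (dzb (p j) (u j)) x)) z)"
proof -
  \<comment> \<open>Up to the factor \<open>dz i (u i) z\<close>, this is the product-rule term in
    which the outer derivative \<open>dzb (p i)\<close> hits the factor of row
    \<open>l\<close>.\<close>
  define S where "S l p = dzb (p i) (dz l (dzb (p l) (u l))) z * (\<Prod>j\<in>UNIV - {i} - {l}. dz j (dzb (p j) (u j)) z)"
    for l and p :: "'n \<Rightarrow> 'n"
  have C': "Ck 2 U (u j)" "Ck 2 U (dz j (u j))" "Ck 1 U (dz j (dzb k (u j)))" for j k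
  proof -
    show "Ck 2 U (u j)" "Ck 2 U (dz j (u j))"
      using Ck_mono[OF C, of 2] Ck_dz[OF U(1), of 2 "u j" j] C[of j] by (simp_all add: numeral_3_eq_3 numeral_2_eq_2)
    have "Ck 2 U (dzb k (u j))" using Ck_dzb[OF U(1), of 2 "u j"] C[of j] by (simp add: numeral_3_eq_3 numeral_2_eq_2)
    then show "Ck 1 U (dz j (dzb k (u j)))" using Ck_dz[OF U(1), of 1 "dzb k (u j)" j] by (simp add: numeral_2_eq_2)
  qed
  have df: "dz j (u j) differentiable (at z)" "dz j (dzb k (u j)) differentiable (at z)" for j k
    using C'(2)[of j] C'(3)[of j k] U by (auto simp: numeral_2_eq_2)
  have term_eq: "dzb (p i) (\<lambda>x. dz i (u i) x * (\<Prod>j\<in>UNIV - {i}. dz j (dzb (p j) (u j)) x)) z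
      = dz i (u i) z * (\<Sum>l\<in>UNIV - {i}. S l p) + (\<Prod>j\<in>UNIV. dz j (dzb (p j) (u j)) z)" for p :: "'n \<Rightarrow> 'n"
  proof -
    have "(\<lambda>x. \<Prod>j\<in>UNIV - {i}. dz j (dzb (p j) (u j)) x) differentiable (at z)"
      using Ck_prod[OF U(1), of "UNIV - {i}" 1 "\<lambda>j. dz j (dzb (p j) (u j))"] C'(3) U by simp
    then have "dzb (p i) (\<lambda>x. dz i (u i) x * (\<Prod>j\<in>UNIV - {i}. dz j (dzb (p j) (u j)) x)) z
      = dz i (u i) z * dzb (p i) (\<lambda>x. \<Prod>j\<in>UNIV - {i}. dz j (dzb (p j) (u j)) x) z
        + dzb (p i) (dz i (u i)) z * (\<Prod>j\<in>UNIV - {i}. dz j (dzb (p j) (u j)) z)"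
      by (rule dzb_mult[OF df(1)])
    also have "dzb (p i) (dz i (u i)) z = dz i (dzb (p i) (u i)) z"
      by (rule dzb_dz[OF U C'(1)])
    also have "dz i (dzb (p i) (u i)) z * (\<Prod>j\<in>UNIV - {i}. dz j (dzb (p j) (u j)) z)
        = (\<Prod>j\<in>UNIV. dz j (dzb (p j) (u j)) z)"
      by (rule prod.remove[symmetric]) auto
    also have "dzb (p i) (\<lambda>x. \<Prod>j\<in>UNIV - {i}. dz j (dzb (p j) (u j)) x) z = (\<Sum>l\<in>UNIV - {i}. S l p)"
      unfolding S_def by (rule dzb_prod) (rule df(2))
    finally show ?thesis .
  qed
  have S0: "(\<Sum>p | p permutes (UNIV::'n set). of_int (sign p) * S l p) = 0" if "l \<noteq> i" for l
  proof -
    let ?t = "Transposition.transpose i l"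
    have "(\<Sum>p | p permutes (UNIV::'n set). of_int (sign p) * S l p)
        = (\<Sum>p | p permutes (UNIV::'n set). of_int (sign (p \<circ> ?t)) * S l (p \<circ> ?t))"
      by (rule sum_permutations_compose_right) (simp add: permutes_swap_id)
    also have "\<dots> = (\<Sum>p | p permutes (UNIV::'n set). - (of_int (sign p) * S l p))"
    proof (rule sum.cong[OF refl])
      fix p :: "'n \<Rightarrow> 'n" assume "p \<in> {p. p permutes UNIV}"
      then have perm: "permutation p" by (simp add: permutation_permutes) (use finite_class.finite_UNIV in blast)
      have "sign (p \<circ> ?t) = - sign p"
        using perm that by (simp add: sign_compose permutation_swap_id sign_swap_id)
      moreover have "S l (p \<circ> ?t) = S l p"
      proof -
        have "(\<Prod>j\<in>UNIV - {i} - {l}. dz j (dzb ((p \<circ> ?t) j) (u j)) z) = (\<Prod>j\<in>UNIV - {i} - {l}. dz j (dzb (p j) (u j)) z)"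
          by (rule prod.cong) (auto simp: Transposition.transpose_def)
        then show ?thesis
          unfolding S_def using dzb_dz_dzb[OF U C[of l], of "p i" l "p l"] by simp
      qed
      ultimately show "of_int (sign (p \<circ> ?t)) * S l (p \<circ> ?t) = - (of_int (sign p) * S l p)" by simp
    qed
    finally show ?thesis by (simp add: sum_negf)
  qed
  have "(\<Sum>p | p permutes UNIV. of_int (sign p) *
     dzb (p i) (\<lambda>x. dz i (u i) x * (\<Prod>j\<in>UNIV - {i}. dz j (dzb (p j) (u j)) x)) z)
    = (\<Sum>p | p permutes (UNIV::'n set). \<Sum>l\<in>UNIV - {i}. dz i (u i) z * (of_int (sign p) * S l p))
      + (\<Sum>p | p permutes UNIV. of_int (sign p) * (\<Prod>j\<in>UNIV. dz j (dzb (p j) (u j)) z))"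
    unfolding term_eq by (simp add: distrib_left sum.distrib sum_distrib_left mult_ac)
  also have "(\<Sum>p | p permutes (UNIV::'n set). \<Sum>l\<in>UNIV - {i}. dz i (u i) z * (of_int (sign p) * S l p))
      = (\<Sum>l\<in>UNIV - {i}. dz i (u i) z * (\<Sum>p | p permutes (UNIV::'n set). (of_int (sign p) * S l p)))"
    by (subst sum.swap) (simp add: sum_distrib_left)
  also have "\<dots> = 0" using S0 by simp
  finally show ?thesis by (simp add: det_def row_hess_def)
qed

lemma Ck_row_hess_entry:
  assumes "open U" "Ck 3 U (u j)"
  shows "Ck 1 U (\<lambda>z. row_hess u z $ j $ k)"
  using Ck_dz[OF assms(1), of 1 "dzb k (u j)" j] Ck_dzb[OF assms(1), of 2 "u j" k] assms(2)
  by (simp add: row_hess_def numeral_3_eq_3 numeral_2_eq_2)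

lemma continuous_on_det_row_hess:
  assumes "open U" "\<And>j. Ck 3 U (u j)"
  shows "continuous_on U (\<lambda>z. det (row_hess u z))"
proof -
  have "continuous_on U (\<lambda>z. row_hess u z $ j $ k)" for j k
    using Ck_imp_continuous Ck_row_hess_entry[OF assms(1), of u j k] assms(2) by blast
  then show ?thesis unfolding det_def
    by (intro continuous_on_sum continuous_on_mult continuous_on_const continuous_on_prod)
qed

lemma set_integrable_compact:
  fixes f :: "'a::euclidean_space \<Rightarrow> 'b::euclidean_space"
  assumes "compact K" "K \<subseteq> U" "continuous_on U f"
  shows "set_integrable lborel K f"
  unfolding set_integrable_def
  by (rule borel_integrable_compact) (use assms continuous_on_subset in auto)

lemma integral_dzb_eq_0:
  fixes G :: "complex^'n::finite \<Rightarrow> complex"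
  assumes U: "open U" and K: "compact K" "K \<subseteq> U" and C: "Ck 1 U G"
    and z: "\<And>x. x \<in> U - K \<Longrightarrow> G x = 0"
  shows "(LINT x:K|lborel. dzb a G x) = 0"
proof -
  have i: "set_integrable lborel K (dder v G)" for v
    by (rule set_integrable_compact[OF K]) (use C in auto)
  have "(LINT x:K|lborel. dzb a G x)
      = ((LINT x:K|lborel. dder (axis a 1) G x) + \<i> * (LINT x:K|lborel. dder (axis a \<i>) G x)) / 2"
    unfolding dzb_def using i by simp
  then show ?thesis using integral_dder_eq_0[OF U K C z] by simp
qed

text \<open>Row \<open>i\<close> is the one pulled out in the divergence form: each component then
  contains the factor \<open>dz i (u i)\<close>, which vanishes off \<open>K\<close>, so its
  derivative integrates to zero.\<close>

lemma integral_det_row_hess_eq_0: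
  fixes u :: "'n::finite \<Rightarrow> complex^'n \<Rightarrow> complex"
  assumes U: "open U" and K: "compact K" "K \<subseteq> U" and C: "\<And>j. Ck 3 U (u j)"
    and z: "\<And>x. x \<in> U - K \<Longrightarrow> u i x = 0"
  shows "(LINT x:K|lborel. det (row_hess u x)) = 0"
proof -
  define G where "G p x = dz i (u i) x * (\<Prod>j\<in>UNIV - {i}. dz j (dzb (p j) (u j)) x)" for p x
  have CG: "Ck 1 U (G p)" for p
  proof -
    have "Ck 1 U (dz j (dzb k (u j)))" for j k
      using Ck_row_hess_entry[OF U, of u j k] C by (simp add: row_hess_def)
    moreover have "Ck 1 U (dz i (u i))"
      using Ck_dz[OF U, of 1 "u i"] Ck_mono[OF C, of 2] by (simp add: numeral_2_eq_2)
    ultimately show ?thesis unfolding G_def by (intro Ck_mult[OF U] Ck_prod[OF U])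
  qed
  have G0: "G p x = 0" if "x \<in> U - K" for p x
  proof -
    have "dz i (u i) x = dz i (\<lambda>_. 0) x"
      by (rule dz_cong[of "U - K"]) (use that U K z compact_imp_closed in \<open>auto intro!: open_Diff\<close>)
    then show ?thesis by (simp add: G_def dz_def)
  qed
  have int: "set_integrable lborel K (dzb a (G p))" for a p
    by (rule set_integrable_compact[OF K]) (use Ck_dzb[OF U, of 0 "G p" a] CG[of p] in auto)
  have "(LINT x:K|lborel. det (row_hess u x))
      = (LINT x:K|lborel. (\<Sum>p | p permutes UNIV. of_int (sign p) * dzb (p i) (G p) x))"
    by (rule set_lebesgue_integral_cong)
      (use K U det_row_hess_divergence[where u = u and i = i, OF U _ C] in \<open>auto simp: G_def[abs_def] compact_imp_closed\<close>)
  also have "\<dots> = (\<Sum>p | p permutes UNIV. LINT x:K|lborel. of_int (sign p) * dzb (p i) (G p) x)"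
    unfolding set_lebesgue_integral_def scaleR_sum_right
    by (rule Bochner_Integration.integral_sum)
      (use int in \<open>simp add: set_integrable_def mult_scaleR_right[symmetric] del: mult_scaleR_right\<close>)
  also have "\<dots> = 0"
    using integral_dzb_eq_0[OF U K CG G0] by (intro sum.neutral) simp
  finally show ?thesis .
qed

abbreviation chess :: "(complex^'n \<Rightarrow> complex) \<Rightarrow> complex^'n \<Rightarrow> complex^'n^'n" where
  "chess f \<equiv> row_hess (\<lambda>_. f)"

text \<open>Passing from \<open>g\<close> to \<open>f\<close> one row at a time, each exchange
  changes the determinant by one whose row \<open>i\<close> comes from \<open>f - g\<close>. That
  function vanishes off \<open>K\<close>, so the integral does not move.\<close>

lemma integral_det_chess_eq:
  fixes f g :: "complex^'n::finite \<Rightarrow> complex"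
  assumes U: "open U" and K: "compact K" "K \<subseteq> U" and C: "Ck 3 U f" "Ck 3 U g"
    and z: "\<And>x. x \<in> U - K \<Longrightarrow> f x = g x"
  shows "(LINT x:K|lborel. det (chess f x)) = (LINT x:K|lborel. det (chess g x))"
proof -
  define w where "w S j = (if j \<in> S then f else g)" for S :: "'n set" and j
  have Cw: "Ck 3 U (w S j)" for S j using C by (simp add: w_def)
  have "(LINT x:K|lborel. det (row_hess (w S) x)) = (LINT x:K|lborel. det (row_hess (w {}) x))" if "finite S" for S
    using that
  proof induction
    case (insert i S)
    define d where "d j = (if j = i then (\<lambda>x. f x - g x) else w S j)" for j
    have Cd: "Ck 3 U (d j)" for j using Cw C Ck_diff[OF U] by (auto simp: d_def)
    have "det (row_hess (w (insert i S)) x) = det (row_hess d x) + det (row_hess (w S) x)" if x: "x \<in> U" for x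
    proof -
      have df: "f differentiable (at y)" "g differentiable (at y)" if "y \<in> U" for y
        using C that by (auto simp: numeral_3_eq_3)
      have db: "dzb k f differentiable (at x)" "dzb k g differentiable (at x)" for k
        using Ck_dzb[OF U, of 2 f k] Ck_dzb[OF U, of 2 g k] C x by (auto simp: numeral_3_eq_3 numeral_2_eq_2)
      have "dz i (dzb k (\<lambda>x. f x - g x)) x = dz i (\<lambda>x. dzb k f x - dzb k g x) x" for k
        by (rule dz_cong[OF U x]) (simp add: df dzb_diff)
      then have D: "dz i (dzb k f) x = dz i (dzb k (\<lambda>x. f x - g x)) x + dz i (dzb k g) x" for k
        using dz_diff[OF db] by simp
      let ?a = "\<lambda>j. \<chi> k. dz i (dzb k (\<lambda>x. f x - g x)) x"
      let ?b = "\<lambda>j. \<chi> k. dz i (dzb k g) x"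
      let ?c = "\<lambda>j. \<chi> k. dz j (dzb k (w S j)) x"
      have "row_hess (w (insert i S)) x = (\<chi> j. if j = i then ?a j + ?b j else ?c j)"
        using insert.hyps by (auto simp: row_hess_def vec_eq_iff w_def D)
      moreover have "row_hess d x = (\<chi> j. if j = i then ?a j else ?c j)"
        by (auto simp: row_hess_def vec_eq_iff d_def)
      moreover have "row_hess (w S) x = (\<chi> j. if j = i then ?b j else ?c j)"
        using insert.hyps by (auto simp: row_hess_def vec_eq_iff w_def)
      ultimately show ?thesis by (simp only: det_row_add)
    qed
    then have "(LINT x:K|lborel. det (row_hess (w (insert i S)) x))
        = (LINT x:K|lborel. det (row_hess d x) + det (row_hess (w S) x))"
      by (intro set_lebesgue_integral_cong) (use K in \<open>auto simp: compact_imp_closed\<close>)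
    also have "\<dots> = (LINT x:K|lborel. det (row_hess d x)) + (LINT x:K|lborel. det (row_hess (w S) x))"
      by (intro set_integral_add set_integrable_compact[OF K] continuous_on_det_row_hess U Cd Cw)
    also have "(LINT x:K|lborel. det (row_hess d x)) = 0"
      by (rule integral_det_row_hess_eq_0[where u = d and i = i, OF U K Cd]) (use z in \<open>auto simp: d_def\<close>)
    finally show ?case using insert.IH by simp
  qed simp
  from this[of UNIV] show ?thesis by (simp add: w_def[abs_def])
qed

section \<open>Positive semidefinite Hermitian matrices\<close>

definition herm_form :: "complex^'n^'n \<Rightarrow> complex^'n \<Rightarrow> complex" where
  "herm_form A x = (\<Sum>j\<in>UNIV. \<Sum>k\<in>UNIV. x $ j * A $ j $ k * cnj (x $ k))"

definition psd :: "complex^'n^'n \<Rightarrow> bool" where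
  "psd A \<longleftrightarrow> (\<forall>j k. A $ j $ k = cnj (A $ k $ j)) \<and> (\<forall>x. 0 \<le> Re (herm_form A x))"

text \<open>Conjugating the entries transposes a Hermitian matrix, and transposition preserves the
  determinant.\<close>

lemma det_hermitian_real:
  fixes A :: "complex^'n::finite^'n"
  assumes "\<And>j k. A $ j $ k = cnj (A $ k $ j)"
  shows "Im (det A) = 0"
proof -
  have c: "cnj (A $ j $ k) = A $ k $ j" for j k by (rule assms[symmetric])
  have "cnj (det A) = (\<Sum>p | p permutes UNIV. of_int (sign p) * (\<Prod>i\<in>UNIV. cnj (A $ i $ p i)))"
    by (simp add: det_def)
  also have "\<dots> = det (transpose A)"
    unfolding det_def transpose_def by (simp add: c)
  finally have "cnj (det A) = det A" by (simp add: det_transpose)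
  then show ?thesis by (metis Im_complex_of_real Reals_cnj_iff Reals_cases)
qed

text \<open>Along the segment from the identity to \<open>A\<close> the determinant is real and does not vanish
  before the endpoint.\<close>

lemma psd_det_nonneg:
  fixes A :: "complex^'n::finite^'n"
  assumes A: "psd A"
  shows "0 \<le> Re (det A)"
proof -
  define M where "M s = (\<chi> j k. of_real (1 - s) * (if j = k then 1 else 0) + of_real s * A $ j $ k)" for s :: real
  have herm: "M s $ j $ k = cnj (M s $ k $ j)" for s j k
  proof -
    have "cnj (A $ k $ j) = A $ j $ k" using A unfolding psd_def by metis
    then show ?thesis by (simp add: M_def)
  qed
  have form: "herm_form (M s) x = of_real (1 - s) * (\<Sum>j\<in>UNIV. of_real ((cmod (x $ j))\<^sup>2)) + of_real s * herm_form A x" for s x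
  proof -
    have "(\<Sum>k\<in>UNIV. x $ j * (of_real (1 - s) * (if j = k then 1 else 0)) * cnj (x $ k)) = of_real (1 - s) * of_real ((cmod (x $ j))\<^sup>2)" for j
      by (subst sum.cong[OF refl, of _ _ "\<lambda>k. if j = k then of_real (1 - s) * (x $ j * cnj (x $ j)) else 0"])
        (auto simp: complex_norm_square[symmetric] simp del: of_real_power)
    then show ?thesis
      unfolding herm_form_def M_def
      by (simp add: distrib_left distrib_right sum.distrib sum_distrib_left mult_ac)
  qed
  have nz: "Re (det (M s)) \<noteq> 0" if s: "0 \<le> s" "s < 1" for s
  proof
    assume "Re (det (M s)) = 0"
    then have "det (M s) = 0" using det_hermitian_real[OF herm, of s] by (simp add: complex_eq_iff)
    then have "\<not> invertible (M s)" using invertible_det_nz by blast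
    then have "\<not> (\<exists>B. B ** M s = mat 1)" using invertible_left_inverse by blast
    then obtain y where y: "M s *v y = 0" "y \<noteq> 0" using matrix_left_invertible_ker by blast
    \<comment> \<open>\<open>herm_form\<close> conjugates its right-hand argument, so a kernel
      vector \<open>y\<close> of the matrix enters as the conjugate of \<open>x\<close>.\<close>
    define x where "x = (\<chi> j. cnj (y $ j))"
    have "(\<Sum>k\<in>UNIV. M s $ j $ k * y $ k) = 0" for j
      using y(1) by (simp add: matrix_vector_mult_def vec_eq_iff)
    then have "herm_form (M s) x = 0"
      unfolding herm_form_def x_def by (simp add: mult.assoc sum_distrib_left[symmetric])
    then have "(1 - s) * (\<Sum>j\<in>UNIV. (cmod (x $ j))\<^sup>2) + s * Re (herm_form A x) = 0"
      using arg_cong[OF form[of s x], of Re] by simp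
    moreover have "0 \<le> s * Re (herm_form A x)" using A s by (simp add: psd_def)
    moreover have "0 < (\<Sum>j\<in>UNIV. (cmod (x $ j))\<^sup>2)"
    proof -
      obtain j where "y $ j \<noteq> 0" using y(2) by (auto simp: vec_eq_iff)
      then have "0 < (cmod (x $ j))\<^sup>2" by (simp add: x_def)
      then show ?thesis by (intro sum_pos2[of _ j]) auto
    qed
    ultimately show False using s by (smt (verit) mult_pos_pos)
  qed
  have cont: "continuous_on UNIV (\<lambda>s. Re (det (M s)))"
    unfolding M_def det_def by (auto intro!: continuous_intros)
  have M0: "Re (det (M 0)) = 1"
  proof -
    have "M 0 = mat 1" by (simp add: M_def mat_def vec_eq_iff)
    then show ?thesis by simp
  qed
  have pos: "0 \<le> Re (det (M s))" if "0 \<le> s" "s < 1" for s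
  proof (rule ccontr)
    assume "\<not> ?thesis"
    then have "\<exists>t. 0 \<le> t \<and> t \<le> s \<and> Re (det (M t)) = 0"
      using M0 that cont by (intro IVT2') (auto intro: continuous_on_subset)
    then show False using nz that by force
  qed
  \<comment> \<open>\<open>A\<close> itself may be singular, so it is reached only as the limit of
    the nonsingular matrices before the endpoint.\<close>
  have "(\<lambda>n. Re (det (M (1 - 1 / real (Suc n))))) \<longlonglongrightarrow> Re (det (M (1 - 0)))"
  proof (rule continuous_on_tendsto_compose[OF cont])
    show "(\<lambda>n. 1 - 1 / real (Suc n)) \<longlonglongrightarrow> 1 - 0"
      by (intro tendsto_intros LIMSEQ_Suc lim_1_over_n)
  qed auto
  then have "0 \<le> Re (det (M (1 - 0)))"
    by (rule LIMSEQ_le_const) (auto intro!: pos)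
  moreover have "M 1 = A" by (simp add: M_def vec_eq_iff)
  ultimately show ?thesis by simp
qed

section \<open>Comparison of smooth plurisubharmonic functions\<close>

definition pospow :: "nat \<Rightarrow> real \<Rightarrow> real" where
  "pospow n t = max 0 t ^ n"

lemma pospow_nonneg [simp]: "0 \<le> pospow n t"
  by (simp add: pospow_def)

lemma continuous_on_pospow [continuous_intros]:
  "continuous_on S f \<Longrightarrow> continuous_on S (\<lambda>x. pospow n (f x))"
  unfolding pospow_def by (intro continuous_intros)

text \<open>The exponent starts at 2 because the first truncated power has a corner at 0; from then
  on the one-sided derivatives agree there.\<close>

lemma has_real_derivative_pospow:
  "(pospow (Suc (Suc n)) has_real_derivative real (Suc (Suc n)) * pospow (Suc n) t) (at t)"
proof -
  consider "t > 0" | "t < 0" | "t = 0" by linarith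
  then show ?thesis
  proof cases
    case 1
    have "((\<lambda>t. t ^ Suc (Suc n)) has_real_derivative real (Suc (Suc n)) * t ^ Suc n) (at t)"
      by (rule derivative_eq_intros refl)+ simp
    then have "(pospow (Suc (Suc n)) has_real_derivative real (Suc (Suc n)) * t ^ Suc n) (at t)"
      by (rule has_field_derivative_transform_within_open[of _ _ _ "{0<..}"])
        (use 1 in \<open>auto simp: pospow_def\<close>)
    then show ?thesis using 1 by (simp add: pospow_def)
  next
    case 2
    have "((\<lambda>t::real. 0::real) has_real_derivative 0) (at t)" by simp
    then have "(pospow (Suc (Suc n)) has_real_derivative 0) (at t)"
      by (rule has_field_derivative_transform_within_open[of _ _ _ "{..<0}"])
        (use 2 in \<open>auto simp: pospow_def\<close>)
    then show ?thesis using 2 by (simp add: pospow_def)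
  next
    case 3
    have "((\<lambda>h. (pospow (Suc (Suc n)) (0 + h) - pospow (Suc (Suc n)) 0) / h) \<longlongrightarrow> 0) (at 0)"
    proof (rule Lim_null_comparison)
      show "\<forall>\<^sub>F h in at 0. norm ((pospow (Suc (Suc n)) (0 + h) - pospow (Suc (Suc n)) 0) / h) \<le> \<bar>h\<bar> ^ Suc n"
      proof (intro always_eventually allI)
        fix h :: real
        show "norm ((pospow (Suc (Suc n)) (0 + h) - pospow (Suc (Suc n)) 0) / h) \<le> \<bar>h\<bar> ^ Suc n"
        proof (cases "h > 0")
          case True
          then show ?thesis by (simp add: pospow_def)
        next
          case False
          then show ?thesis by (simp add: pospow_def flip: power_Suc)
        qed
      qed
      have "((\<lambda>h::real. \<bar>h\<bar> ^ Suc n) \<longlongrightarrow> \<bar>0\<bar> ^ Suc n) (at 0)"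
        by (intro tendsto_intros)
      then show "((\<lambda>h::real. \<bar>h\<bar> ^ Suc n) \<longlongrightarrow> 0) (at 0)" by simp
    qed
    then show ?thesis using 3 by (simp add: DERIV_def pospow_def)
  qed
qed

text \<open>The second derivative is the quadratic B-spline with knots 0, 1, 2, 3.\<close>

lemma exists_convex_cutoff:
  obtains D :: "nat \<Rightarrow> real \<Rightarrow> real" where
    "\<And>i x. i < 3 \<Longrightarrow> (D i has_real_derivative D (Suc i) x) (at x)"
    "continuous_on UNIV (D 3)" "\<And>t. t \<le> 0 \<Longrightarrow> D 0 t = 0"
    "\<And>t. 0 \<le> D 1 t" "\<And>t. D 1 t \<le> 1" "\<And>t. 3 \<le> t \<Longrightarrow> D 1 t = 1"
    "\<And>t. 0 \<le> D 2 t" "\<And>t. 3 \<le> t \<Longrightarrow> D 2 t = 0"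
proof -
  \<comment> \<open>Third differences of truncated powers: past the last knot they equal the third
    difference of t^n / n!, which is 1 for n = 3 and 0 for n = 2.\<close>
  define B where "B n t = (pospow n t - 3 * pospow n (t - 1) + 3 * pospow n (t - 2) - pospow n (t - 3)) / fact n" for n t
  \<comment> \<open>The degree falls as derivatives are taken: \<open>D 3\<close> is the continuous
    \<open>B 1\<close>, \<open>D 2\<close> the B-spline, \<open>D 1\<close> its primitive rising
    from 0 to 1, and \<open>D 0\<close> a convex function that vanishes up to the first
    knot.\<close>
  define D where "D i = B (4 - i)" for i
  have B': "(B (Suc (Suc n)) has_real_derivative B (Suc n) t) (at t)" for n t
  proof -
    have *: "((\<lambda>t. pospow (Suc (Suc n)) (t - c)) has_real_derivative real (Suc (Suc n)) * pospow (Suc n) (t - c)) (at t)" for c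
    proof -
      have "((\<lambda>t. t - c) has_real_derivative 1) (at t)" by (auto intro!: derivative_eq_intros)
      from DERIV_chain2[OF has_real_derivative_pospow this] show ?thesis by simp
    qed
    have "(B (Suc (Suc n)) has_real_derivative
       (real (Suc (Suc n)) * pospow (Suc n) t - 3 * (real (Suc (Suc n)) * pospow (Suc n) (t - 1))
        + 3 * (real (Suc (Suc n)) * pospow (Suc n) (t - 2)) - real (Suc (Suc n)) * pospow (Suc n) (t - 3)) / fact (Suc (Suc n))) (at t)"
      unfolding B_def
      by (intro DERIV_cdivide DERIV_diff DERIV_add DERIV_cmult * has_real_derivative_pospow)
    also have "(real (Suc (Suc n)) * pospow (Suc n) t - 3 * (real (Suc (Suc n)) * pospow (Suc n) (t - 1))
        + 3 * (real (Suc (Suc n)) * pospow (Suc n) (t - 2)) - real (Suc (Suc n)) * pospow (Suc n) (t - 3)) / fact (Suc (Suc n))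
      = real (Suc (Suc n)) * (pospow (Suc n) t - 3 * pospow (Suc n) (t - 1) + 3 * pospow (Suc n) (t - 2) - pospow (Suc n) (t - 3))
         / (real (Suc (Suc n)) * fact (Suc n))"
      by (simp only: fact_Suc[of "Suc n"]) (simp add: algebra_simps)
    also have "\<dots> = B (Suc n) t" unfolding B_def by (subst mult_divide_mult_cancel_left) auto
    finally show ?thesis .
  qed
  have D': "(D i has_real_derivative D (Suc i) x) (at x)" if i: "i < 3" for i x
  proof -
    have "4 - i = Suc (Suc (2 - i))" "4 - Suc i = Suc (2 - i)" using i by auto
    then show ?thesis unfolding D_def using B' by simp
  qed
  have B2: "0 \<le> B 2 t" for t
  proof -
    consider "t \<le> 0" | "0 \<le> t" "t \<le> 1" | "1 \<le> t" "t \<le> 2" | "2 \<le> t" "t \<le> 3" | "3 \<le> t" by linarith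
    then show ?thesis
    proof cases
      case 3
      then have "B 2 t = (t\<^sup>2 - 3 * (t - 1)\<^sup>2) / 2" by (simp add: B_def pospow_def)
      also have "t\<^sup>2 - 3 * (t - 1)\<^sup>2 = 1 + 2 * ((t - 1) * (2 - t))" by (simp add: power2_eq_square algebra_simps)
      finally have eq: "B 2 t = (1 + 2 * ((t - 1) * (2 - t))) / 2" .
      show ?thesis unfolding eq
        by (intro divide_nonneg_nonneg add_nonneg_nonneg mult_nonneg_nonneg) (use 3 in auto)
    next
      case 4
      then have "B 2 t = (t\<^sup>2 - 3 * (t - 1)\<^sup>2 + 3 * (t - 2)\<^sup>2) / 2" by (simp add: B_def pospow_def)
      also have "t\<^sup>2 - 3 * (t - 1)\<^sup>2 + 3 * (t - 2)\<^sup>2 = (3 - t)\<^sup>2" by (simp add: power2_eq_square algebra_simps)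
      finally have eq: "B 2 t = (3 - t)\<^sup>2 / 2" .
      show ?thesis unfolding eq by simp
    next
      case 5
      then have "B 2 t = (t\<^sup>2 - 3 * (t - 1)\<^sup>2 + 3 * (t - 2)\<^sup>2 - (t - 3)\<^sup>2) / 2" by (simp add: B_def pospow_def)
      also have "t\<^sup>2 - 3 * (t - 1)\<^sup>2 + 3 * (t - 2)\<^sup>2 - (t - 3)\<^sup>2 = 0" by (simp add: power2_eq_square algebra_simps)
      finally show ?thesis by simp
    qed (auto simp: B_def pospow_def)
  qed
  have B1_big: "D 1 t = 1" if "3 \<le> t" for t
  proof -
    have "D 1 t = (t ^ 3 - 3 * (t - 1) ^ 3 + 3 * (t - 2) ^ 3 - (t - 3) ^ 3) / 6"
      using that by (simp add: D_def B_def pospow_def fact_numeral)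
    also have "\<dots> = 1" by (simp add: power3_eq_cube algebra_simps)
    finally show ?thesis .
  qed
  have D1_small: "D 1 t = 0" if "t \<le> 0" for t using that by (simp add: D_def B_def pospow_def)
  have mono: "D 1 s \<le> D 1 t" if "s \<le> t" for s t
  proof (rule DERIV_nonneg_imp_nondecreasing[OF that])
    fix x
    have "(D 1 has_real_derivative D (Suc 1) x) (at x)" by (rule D') simp
    moreover have "0 \<le> D (Suc 1) x" using B2[of x] by (simp add: D_def)
    ultimately show "\<exists>y. (D 1 has_real_derivative y) (at x) \<and> 0 \<le> y" by blast
  qed
  show thesis
  proof
    show "continuous_on UNIV (D 3)" unfolding D_def B_def by (intro continuous_intros) auto
    show "D 0 t = 0" if "t \<le> 0" for t using that by (simp add: D_def B_def pospow_def)
    show "0 \<le> D 1 t" for t using mono[of "min t 0" t] D1_small[of "min t 0"] by simp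
    show "D 1 t \<le> 1" for t using mono[of t "max t 3"] B1_big[of "max t 3"] by simp
    show "0 \<le> D 2 t" for t using B2 by (simp add: D_def)
    show "D 2 t = 0" if "3 \<le> t" for t
    proof -
      have "D 2 t = (t\<^sup>2 - 3 * (t - 1)\<^sup>2 + 3 * (t - 2)\<^sup>2 - (t - 3)\<^sup>2) / 2" using that by (simp add: D_def B_def pospow_def)
      also have "\<dots> = 0" by (simp add: power2_eq_square algebra_simps)
      finally show ?thesis .
    qed
  qed (use D' B1_big in auto)
qed

abbreviation cr :: "('a \<Rightarrow> real) \<Rightarrow> 'a \<Rightarrow> complex" where
  "cr f \<equiv> \<lambda>x. complex_of_real (f x)"

lemma dz_real_comp:
  assumes "(h has_real_derivative d) (at (g z))" "g differentiable (at z)"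
  shows "dz j (cr (\<lambda>x. h (g x))) z = of_real d * dz j (cr g) z"
    and "dzb j (cr (\<lambda>x. h (g x))) z = of_real d * dzb j (cr g) z"
proof -
  have "h differentiable (at (g z))" using assms(1) real_differentiable_def by blast
  then have "(\<lambda>x. h (g x)) differentiable (at z)"
    using differentiable_chain_at[OF assms(2)] by (simp add: o_def)
  then show "dz j (cr (\<lambda>x. h (g x))) z = of_real d * dz j (cr g) z"
    and "dzb j (cr (\<lambda>x. h (g x))) z = of_real d * dzb j (cr g) z"
    unfolding dz_def dzb_def using assms
    by (simp_all add: dder_of_real dder_real_comp[OF assms] algebra_simps)
qed

lemma dzb_cr: "g differentiable (at z) \<Longrightarrow> dzb j (cr g) z = cnj (dz j (cr g) z)"
  by (simp add: dz_def dzb_def dder_of_real)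

lemma differentiable_cr: "g differentiable (at z) \<Longrightarrow> cr g differentiable (at z)"
  using bounded_linear.has_derivative[OF bounded_linear_of_real] unfolding differentiable_def by blast

text \<open>The rank-one matrix \<open>v j * cnj (v k)\<close> has the Hermitian form |sum of x_j
  v_j|^2. The three summands are those that \<open>chess_cutoff\<close> produces.\<close>

lemma psd_combination:
  fixes A B :: "complex^'n::finite^'n"
  assumes "psd A" "psd B" "0 \<le> a" "0 \<le> b" "0 \<le> c"
  shows "psd (\<chi> j k. of_real a * A $ j $ k + of_real b * B $ j $ k + of_real c * (v j * cnj (v k)))" (is "psd ?M")
proof -
  have c: "cnj (A $ j $ k) = A $ k $ j" "cnj (B $ j $ k) = B $ k $ j" for j k
    using assms(1,2) unfolding psd_def by metis+
  have "herm_form ?M x = of_real a * herm_form A x + of_real b * herm_form B x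
      + of_real c * ((\<Sum>j\<in>UNIV. x $ j * v j) * cnj (\<Sum>k\<in>UNIV. x $ k * v k))" for x
    unfolding herm_form_def cnj_sum sum_product
    by (simp add: sum_distrib_left sum.distrib[symmetric] algebra_simps)
  also have "Re (of_real a * herm_form A x + of_real b * herm_form B x
      + of_real c * ((\<Sum>j\<in>UNIV. x $ j * v j) * cnj (\<Sum>k\<in>UNIV. x $ k * v k))) \<ge> 0" for x
    using assms unfolding psd_def complex_mult_cnj by simp
  finally show ?thesis unfolding psd_def by (simp add: c mult.commute)
qed

text \<open>The Monge-Ampere density through Wirtinger derivatives;
  \<open>ma_density_hess_bl\<close> identifies it with \<open>ma_density\<close>.\<close>

definition mad :: "(complex^'n \<Rightarrow> real) \<Rightarrow> complex^'n::finite \<Rightarrow> real" where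
  "mad f z = Re (det (chess (cr f) z))"

lemma continuous_on_mad: "open U \<Longrightarrow> Ck 3 U f \<Longrightarrow> continuous_on U (mad f)"
  unfolding mad_def[abs_def]
  by (intro continuous_on_Re continuous_on_det_row_hess Ck_of_real)

lemma Re_set_integral:
  assumes "set_integrable lborel K f"
  shows "(LINT x:K|lborel. Re (f x)) = Re (LINT x:K|lborel. f x)"
  using integral_Re[OF assms[unfolded set_integrable_def]] by (simp add: set_lebesgue_integral_def)

text \<open>The chain rule weighs the two Hessians by \<open>1 - D 1\<close> and \<open>D 1\<close>
  and adds \<open>D 2\<close> times the rank-one matrix of the gradient of \<open>w - f\<close>. For
  the cutoff of \<open>exists_convex_cutoff\<close> all three weights are nonnegative, so
  semidefiniteness is inherited.\<close>

lemma chess_cutoff: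
  fixes f w :: "complex^'n::finite \<Rightarrow> real"
  assumes U: "open U" "z \<in> U" and C: "Ck 3 U f" "Ck 3 U w"
    and D: "\<And>i x. i < 3 \<Longrightarrow> (D i has_real_derivative D (Suc i) x) (at x)"
  shows "chess (cr (\<lambda>x. f x + D 0 (w x - f x))) z = (\<chi> j k.
      of_real (1 - D 1 (w z - f z)) * chess (cr f) z $ j $ k + of_real (D 1 (w z - f z)) * chess (cr w) z $ j $ k
      + of_real (D 2 (w z - f z)) * (dz j (cr (\<lambda>x. w x - f x)) z * cnj (dz k (cr (\<lambda>x. w x - f x)) z)))"
proof -
  let ?g = "\<lambda>x. w x - f x"
  have d: "f differentiable (at x)" "w differentiable (at x)" "?g differentiable (at x)" if "x \<in> U" for x
    using C that by (auto simp: numeral_3_eq_3)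
  have D': "(D 0 has_real_derivative D 1 t) (at t)" "(D 1 has_real_derivative D 2 t) (at t)" for t
    using D[of 0] D[of 1] by (auto simp: numeral_2_eq_2)
  have dD: "(\<lambda>x. D i (?g x)) differentiable (at x)" if "x \<in> U" "i < 3" for x i
    using differentiable_chain_at[OF d(3)[OF that(1)], of "D i"] D[OF that(2)]
    by (auto simp: o_def real_differentiable_def)
  have Cg: "Ck 3 U (cr ?g)" by (intro Ck_of_real Ck_diff C U)
  have db: "dzb k (cr f) differentiable (at x)" "dzb k (cr w) differentiable (at x)" "dzb k (cr ?g) differentiable (at x)"
    if "x \<in> U" for k x
    using Ck_dzb[OF U(1), of 2 "cr f" k] Ck_dzb[OF U(1), of 2 "cr w" k] Ck_dzb[OF U(1), of 2 "cr ?g" k]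
      Ck_of_real[OF U(1) C(1)] Ck_of_real[OF U(1) C(2)] Cg that by (auto simp: numeral_3_eq_3 numeral_2_eq_2)
  have e1: "dzb k (cr (\<lambda>x. f x + D 0 (?g x))) x = dzb k (cr f) x + cr (\<lambda>x. D 1 (?g x)) x * dzb k (cr ?g) x"
    if "x \<in> U" for k x
    using dzb_add[OF differentiable_cr[OF d(1)[OF that]] differentiable_cr[OF dD[OF that, of 0]], of k]
      dz_real_comp(2)[OF D'(1) d(3)[OF that], of k] by simp
  have g1: "dzb k (cr ?g) x = dzb k (cr w) x - dzb k (cr f) x" if "x \<in> U" for k x
    using dzb_diff[OF differentiable_cr[OF d(2)[OF that]] differentiable_cr[OF d(1)[OF that]], of k] by simp
  have g2: "dz j (dzb k (cr ?g)) z = dz j (dzb k (cr w)) z - dz j (dzb k (cr f)) z" for j k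
  proof -
    have "dz j (dzb k (cr ?g)) z = dz j (\<lambda>x. dzb k (cr w) x - dzb k (cr f) x) z"
      by (rule dz_cong[OF U]) (rule g1)
    then show ?thesis using dz_diff[OF db(2,1)[OF U(2)]] by simp
  qed
  have "dz j (dzb k (cr (\<lambda>x. f x + D 0 (?g x)))) z
      = of_real (1 - D 1 (?g z)) * dz j (dzb k (cr f)) z + of_real (D 1 (?g z)) * dz j (dzb k (cr w)) z
      + of_real (D 2 (?g z)) * (dz j (cr ?g) z * cnj (dz k (cr ?g) z))" for j k
  proof -
    have "dz j (dzb k (cr (\<lambda>x. f x + D 0 (?g x)))) z
        = dz j (\<lambda>x. dzb k (cr f) x + cr (\<lambda>x. D 1 (?g x)) x * dzb k (cr ?g) x) z"
      by (rule dz_cong[OF U]) (rule e1)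
    also have "\<dots> = dz j (dzb k (cr f)) z + dz j (\<lambda>x. cr (\<lambda>x. D 1 (?g x)) x * dzb k (cr ?g) x) z"
      by (intro dz_add db U(2) differentiable_mult differentiable_cr dD) auto
    also have "dz j (\<lambda>x. cr (\<lambda>x. D 1 (?g x)) x * dzb k (cr ?g) x) z
        = of_real (D 1 (?g z)) * dz j (dzb k (cr ?g)) z + dz j (cr (\<lambda>x. D 1 (?g x))) z * dzb k (cr ?g) z"
      by (intro dz_mult db U(2) differentiable_cr dD) auto
    also have "dz j (cr (\<lambda>x. D 1 (?g x))) z = of_real (D 2 (?g z)) * dz j (cr ?g) z"
      by (rule dz_real_comp(1)[OF D'(2) d(3)[OF U(2)]])
    also have "dzb k (cr ?g) z = cnj (dz k (cr ?g) z)"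
      by (rule dzb_cr[OF d(3)[OF U(2)]])
    finally have *: "dz j (dzb k (cr (\<lambda>x. f x + D 0 (?g x)))) z = dz j (dzb k (cr f)) z
      + (of_real (D 1 (?g z)) * dz j (dzb k (cr ?g)) z
         + of_real (D 2 (?g z)) * dz j (cr ?g) z * cnj (dz k (cr ?g) z))" .
    have "complex_of_real (1 - D 1 (?g z)) = 1 - of_real (D 1 (?g z))" by simp
    then show ?thesis unfolding * g2 by (simp only: ring_distribs mult_1_left mult.assoc) simp
  qed
  then show ?thesis by (simp add: row_hess_def vec_eq_iff)
qed

text \<open>\<open>f + D 0 (w - f)\<close> serves as a smooth maximum: it equals \<open>f\<close>
  where \<open>w \<le> f\<close>, and it has the Hessian of \<open>w\<close> where \<open>w\<close>
  exceeds \<open>f\<close> by 3, since there \<open>D 1\<close> is 1 and \<open>D 2\<close> is 0.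
  Its mass over \<open>K\<close> is that of \<open>f\<close> by the null Lagrangian property. The
  margin 3 is the last knot of the spline.\<close>

lemma smooth_comparison:
  fixes f w :: "complex^'n::finite \<Rightarrow> real"
  assumes U: "open U" and K: "compact K" "K \<subseteq> U" and T: "compact T" "T \<subseteq> U"
    and C: "Ck 3 U f" "Ck 3 U w"
    and P: "\<And>z. z \<in> U \<Longrightarrow> psd (chess (cr f) z)" "\<And>z. z \<in> U \<Longrightarrow> psd (chess (cr w) z)"
    and out: "\<And>z. z \<in> U - K \<Longrightarrow> w z \<le> f z" and big: "\<And>z. z \<in> T \<Longrightarrow> f z + 3 \<le> w z"
  shows "(LINT z:T|lborel. mad w z) \<le> (LINT z:K|lborel. mad f z)"
proof -
  obtain D :: "nat \<Rightarrow> real \<Rightarrow> real" where D: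
    "\<And>i x. i < 3 \<Longrightarrow> (D i has_real_derivative D (Suc i) x) (at x)"
    "continuous_on UNIV (D 3)" "\<And>t. t \<le> 0 \<Longrightarrow> D 0 t = 0"
    "\<And>t. 0 \<le> D 1 t" "\<And>t. D 1 t \<le> 1" "\<And>t. 3 \<le> t \<Longrightarrow> D 1 t = 1"
    "\<And>t. 0 \<le> D 2 t" "\<And>t. 3 \<le> t \<Longrightarrow> D 2 t = 0" using exists_convex_cutoff by blast
  define F where "F x = f x + D 0 (w x - f x)" for x
  have hess: "chess (cr F) z = (\<chi> j k.
      of_real (1 - D 1 (w z - f z)) * chess (cr f) z $ j $ k + of_real (D 1 (w z - f z)) * chess (cr w) z $ j $ k
      + of_real (D 2 (w z - f z)) * (dz j (cr (\<lambda>x. w x - f x)) z * cnj (dz k (cr (\<lambda>x. w x - f x)) z)))"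
    if "z \<in> U" for z
    unfolding F_def by (rule chess_cutoff[where D = D, OF U that C D(1)])
  have CF: "Ck 3 U F" unfolding F_def[abs_def]
    by (intro Ck_add[OF U] C Ck_real_comp[where S = UNIV and D = D, OF U] Ck_diff[OF U]) (use D(1,2) in auto)
  have F_eq: "F z = f z" if "z \<in> U - K" for z using out[OF that] D(3) by (simp add: F_def)
  have psdF: "psd (chess (cr F) z)" if "z \<in> U" for z
    unfolding hess[OF that] by (rule psd_combination[OF P[OF that]]) (use D in auto)
  \<comment> \<open>On \<open>T\<close> the function \<open>w\<close> exceeds \<open>f\<close>,
    which \<open>out\<close> forbids off \<open>K\<close>.\<close>
  have TK: "T \<subseteq> K" using T big out by force
  have on_T: "mad F z = mad w z" if "z \<in> T" for z
  proof -
    have "chess (cr F) z = chess (cr w) z"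
      using hess[of z] that T big[OF that] D(6,8)[of "w z - f z"] by (auto simp: vec_eq_iff)
    then show ?thesis by (simp add: mad_def)
  qed
  have int: "set_integrable lborel K (mad F)" "set_integrable lborel T (mad F)"
    by (intro set_integrable_compact[of _ U] K T continuous_on_mad U CF)+
  have "(LINT z:T|lborel. mad w z) = (LINT z:T|lborel. mad F z)"
    by (rule set_lebesgue_integral_cong) (use T on_T in \<open>auto simp: compact_imp_closed\<close>)
  also have "\<dots> \<le> (LINT z:K|lborel. mad F z)"
    unfolding set_lebesgue_integral_def
    by (rule integral_mono) (use int TK psd_det_nonneg[OF psdF] K in \<open>auto simp: set_integrable_def mad_def indicator_def\<close>)
  also have "\<dots> = Re (LINT z:K|lborel. det (chess (cr F) z))"
    unfolding mad_def by (intro Re_set_integral set_integrable_compact[OF K] continuous_on_det_row_hess U Ck_of_real CF)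
  also have "(LINT z:K|lborel. det (chess (cr F) z)) = (LINT z:K|lborel. det (chess (cr f) z))"
    by (rule integral_det_chess_eq[OF U K]) (use CF C Ck_of_real[OF U] F_eq in auto)
  also have "Re \<dots> = (LINT z:K|lborel. mad f z)"
    unfolding mad_def by (intro Re_set_integral[symmetric] set_integrable_compact[OF K] continuous_on_det_row_hess U Ck_of_real C)
  finally show ?thesis .
qed

section \<open>Mean value inequalities\<close>

lemma nn_integral_lborel_translate:
  fixes f :: "'a::euclidean_space \<Rightarrow> ennreal"
  assumes "f \<in> borel_measurable borel"
  shows "(\<integral>\<^sup>+x. f (x + c) \<partial>lborel) = (\<integral>\<^sup>+x. f x \<partial>lborel)"
proof -
  have "(\<integral>\<^sup>+x. f x \<partial>lborel) = (\<integral>\<^sup>+x. f x \<partial>distr lborel borel ((+) c))"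
    by (simp add: lborel_distr_plus)
  also have "\<dots> = (\<integral>\<^sup>+x. f (c + x) \<partial>lborel)"
    using assms by (subst nn_integral_distr) auto
  finally show ?thesis by (simp add: add.commute)
qed

text \<open>Convolving with the indicator of the unit ball, which is invariant under isometries.\<close>

lemma nn_integral_lborel_isometry:
  fixes f :: "'a::euclidean_space \<Rightarrow> ennreal" and T S :: "'a \<Rightarrow> 'a"
  assumes [measurable]: "f \<in> borel_measurable borel"
    and T: "linear T" and S: "linear S" and nS: "\<And>x. norm (S x) = norm x"
    and ST: "\<And>x. S (T x) = x" and TS: "\<And>x. T (S x) = x"
  shows "(\<integral>\<^sup>+x. f (T x) \<partial>lborel) = (\<integral>\<^sup>+x. f x \<partial>lborel)"
proof -
  have [measurable]: "T \<in> borel_measurable borel" "S \<in> borel_measurable borel"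
    using T S by (auto intro!: borel_measurable_continuous_onI linear_continuous_on simp: linear_conv_bounded_linear)
  let ?B = "ball (0::'a) 1"
  have [measurable]: "?B \<in> sets borel" by simp
  define c where "c = emeasure lborel ?B"
  have c_fin: "c \<noteq> \<infinity>" unfolding c_def using emeasure_lborel_ball_finite[of "0::'a" 1] by simp
  have c_pos: "c \<noteq> 0"
    unfolding c_def by (simp add: emeasure_ball unit_ball_vol_pos less_imp_neq[symmetric])
  have tr: "(\<integral>\<^sup>+x. f (T x + y) \<partial>lborel) = (\<integral>\<^sup>+x. f (T x) \<partial>lborel)" for y
  proof -
    have "(\<integral>\<^sup>+x. f (T x + y) \<partial>lborel) = (\<integral>\<^sup>+x. f (T (x + S y)) \<partial>lborel)"
      using T TS by (simp add: linear_add)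
    then show ?thesis by (subst (asm) nn_integral_lborel_translate) auto
  qed
  have "c * (\<integral>\<^sup>+x. f (T x) \<partial>lborel) = (\<integral>\<^sup>+y. indicator ?B y * (\<integral>\<^sup>+x. f (T x) \<partial>lborel) \<partial>lborel)"
    unfolding c_def by (subst nn_integral_multc) (auto intro!: borel_measurable_indicator)
  also have "\<dots> = (\<integral>\<^sup>+y. (\<integral>\<^sup>+x. indicator ?B y * f (T x + y) \<partial>lborel) \<partial>lborel)"
    by (subst nn_integral_cmult) (auto simp: tr)
  also have "\<dots> = (\<integral>\<^sup>+x. (\<integral>\<^sup>+y. indicator ?B y * f (T x + y) \<partial>lborel) \<partial>lborel)"
    by (rule lborel_pair.Fubini') measurable
  also have "\<dots> = (\<integral>\<^sup>+x. (\<integral>\<^sup>+y. indicator ?B (y - T x) * f y \<partial>lborel) \<partial>lborel)"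
  proof (rule nn_integral_cong)
    fix x
    have "(\<integral>\<^sup>+y. indicator ?B ((y + T x) - T x) * f (y + T x) \<partial>lborel) = (\<integral>\<^sup>+y. indicator ?B (y - T x) * f y \<partial>lborel)"
      by (rule nn_integral_lborel_translate[of "\<lambda>y. indicator ?B (y - T x) * f y" "T x"]) measurable
    then show "(\<integral>\<^sup>+y. indicator ?B y * f (T x + y) \<partial>lborel) = (\<integral>\<^sup>+y. indicator ?B (y - T x) * f y \<partial>lborel)"
      by (simp add: add.commute)
  qed
  also have "\<dots> = (\<integral>\<^sup>+y. (\<integral>\<^sup>+x. indicator ?B (y - T x) * f y \<partial>lborel) \<partial>lborel)"
    by (rule lborel_pair.Fubini') measurable
  also have "\<dots> = (\<integral>\<^sup>+y. c * f y \<partial>lborel)"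
  proof (rule nn_integral_cong)
    fix y
    have "(y - T x \<in> ?B) \<longleftrightarrow> (x + (- S y) \<in> ?B)" for x
    proof -
      have "norm (y - T x) = norm (S y - x)"
        using nS[of "y - T x"] S ST by (simp add: linear_diff)
      then show ?thesis by (simp add: norm_minus_commute)
    qed
    then have "(\<integral>\<^sup>+x. indicator ?B (y - T x) * f y \<partial>lborel) = (\<integral>\<^sup>+x. indicator ?B (x + (- S y)) * f y \<partial>lborel)"
      by (intro nn_integral_cong) (simp add: indicator_def)
    also have "\<dots> = (\<integral>\<^sup>+x. indicator ?B (x + (- S y)) \<partial>lborel) * f y"
      by (rule nn_integral_multc) measurable
    also have "(\<integral>\<^sup>+x. indicator ?B (x + (- S y)) \<partial>lborel) = (\<integral>\<^sup>+x. indicator ?B x \<partial>lborel)"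
      by (rule nn_integral_lborel_translate) measurable
    also have "\<dots> = c" by (simp add: c_def)
    finally show "(\<integral>\<^sup>+x. indicator ?B (y - T x) * f y \<partial>lborel) = c * f y" .
  qed
  also have "\<dots> = c * (\<integral>\<^sup>+y. f y \<partial>lborel)" by (rule nn_integral_cmult) measurable
  finally show ?thesis using c_fin c_pos by (simp add: ennreal_mult_cancel_left)
qed

lemma norm_cis_smult: "norm (cis t *s (x :: complex^'n)) = norm x"
  by (simp add: norm_vec_def L2_set_def norm_mult)

lemma linear_smult: "linear (\<lambda>x. (c::complex) *s (x :: complex^'n))"
  by (rule linearI) (auto simp: vec_eq_iff algebra_simps)

lemma nn_integral_rotate:
  fixes f :: "complex^'n \<Rightarrow> ennreal"
  assumes "f \<in> borel_measurable borel"
  shows "(\<integral>\<^sup>+x. f (cis t *s x) \<partial>lborel) = (\<integral>\<^sup>+x. f x \<partial>lborel)"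
proof (rule nn_integral_lborel_isometry[OF assms linear_smult linear_smult[of "cis (- t)"]])
  show "norm (cis (- t) *s x) = norm x" for x :: "complex^'n" by (rule norm_cis_smult)
  have "cis (- t) * cis t = 1" "cis t * cis (- t) = 1" by (simp_all add: cis_mult)
  then show "cis (- t) *s (cis t *s x) = x" "cis t *s (cis (- t) *s x) = x" for x :: "complex^'n"
    by (simp_all add: vector_smult_assoc)
qed

lemma continuous_on_smult [continuous_intros]:
  fixes g :: "'a::topological_space \<Rightarrow> complex^'n"
  assumes "continuous_on S f" "continuous_on S g"
  shows "continuous_on S (\<lambda>x. f x *s g x)"
  unfolding vector_scalar_mult_def by (intro continuous_intros assms)

lemma measurable_smult [measurable]:
  "(\<lambda>(c, x). (c::complex) *s (x::complex^'n)) \<in> borel_measurable (borel \<Otimes>\<^sub>M borel)"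
  unfolding borel_prod split_beta by (intro borel_measurable_continuous_onI continuous_intros)

lemma measurable_smult_raw [measurable (raw)]:
  assumes "f \<in> borel_measurable M" "g \<in> borel_measurable M"
  shows "(\<lambda>x. (f x :: complex) *s (g x :: complex^'n)) \<in> borel_measurable M"
  using measurable_compose[OF measurable_Pair[OF assms] measurable_smult] by simp

lemma measurable_cis [measurable]: "cis \<in> borel_measurable borel"
  by (intro borel_measurable_continuous_onI continuous_on_cis continuous_on_id)

section \<open>Semicontinuity and circle means\<close>

lemma usc_on_open:
  assumes "usc_on \<Omega> u" "open \<Omega>"
  shows "open {x\<in>\<Omega>. u x < c}"
proof (subst open_subopen, safe)
  fix x assume x: "x \<in> \<Omega>" "u x < c"
  \<comment> \<open>\<open>usc_on\<close> speaks of punctured neighbourhoods; the value at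
    \<open>x\<close> itself is covered by \<open>u x < c\<close>.\<close>
  then have "\<forall>\<^sub>F y in nhds x. y \<in> \<Omega> \<longrightarrow> u y < c"
    using assms unfolding usc_on_def eventually_at_filter by (auto elim!: eventually_mono dest!: bspec)
  then obtain S where "open S" "x \<in> S" "\<forall>y\<in>S. y \<in> \<Omega> \<longrightarrow> u y < c" unfolding eventually_nhds by blast
  then show "\<exists>T. open T \<and> x \<in> T \<and> T \<subseteq> {x\<in>\<Omega>. u x < c}"
    using assms x by (intro exI[of _ "S \<inter> \<Omega>"]) auto
qed

lemma usc_onI_open:
  assumes "\<And>c. open {x\<in>\<Omega>. u x < c}"
  shows "usc_on \<Omega> u"
  unfolding usc_on_def eventually_at_topological using assms by blast

lemma usc_comp_measurable:
  fixes \<gamma> :: "real \<Rightarrow> 'a::topological_space"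
  assumes "usc_on \<Omega> u" "open \<Omega>" "continuous_on UNIV \<gamma>" "\<And>t. \<gamma> t \<in> \<Omega>"
  shows "(\<lambda>t. u (\<gamma> t)) \<in> borel_measurable borel"
proof (rule borel_measurableI_less)
  fix c
  have "{t. u (\<gamma> t) < c} = \<gamma> -` {x\<in>\<Omega>. u x < c}" using assms(4) by auto
  moreover have "open (\<gamma> -` {x\<in>\<Omega>. u x < c})"
    using usc_on_open[OF assms(1,2)] assms(3) by (intro open_vimage)
  ultimately show "{x \<in> space borel. u (\<gamma> x) < c} \<in> sets borel" by simp
qed

text \<open>\<open>circle_mean\<close> is a difference of two integrals. Adding the positive part,
  which has finite integral because \<open>g\<close> is bounded by \<open>M\<close>, leaves the
  single nonnegative integral of \<open>M - g\<close>, for which Tonelli and Fatou are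
  available.\<close>

lemma circle_mean_ge_iff:
  fixes g :: "real \<Rightarrow> ereal"
  assumes [measurable]: "g \<in> borel_measurable borel" and gM: "\<And>t. g t \<le> ereal M" and M: "0 \<le> M"
    and x: "x \<le> ereal M"
  shows "x \<le> circle_mean g \<longleftrightarrow>
    (\<integral>\<^sup>+t. e2ennreal (ereal M - g t) * indicator {0..2*pi} t \<partial>lborel) \<le> ennreal (2*pi) * e2ennreal (ereal M - x)"
proof -
  define P where "P = (\<integral>\<^sup>+t. e2ennreal (g t) * indicator {0..2*pi} t \<partial>lborel)"
  define N where "N = (\<integral>\<^sup>+t. e2ennreal (- g t) * indicator {0..2*pi} t \<partial>lborel)"
  define H where "H = (\<integral>\<^sup>+t. e2ennreal (ereal M - g t) * indicator {0..2*pi} t \<partial>lborel)"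
  have pt: "e2ennreal (ereal M - y) + e2ennreal y = ennreal M + e2ennreal (- y)" if "y \<le> ereal M" for y
  proof (cases y)
    case (real r)
    then show ?thesis
      using that M by (cases "0 \<le> r") (simp_all add: ennreal_neg ennreal_plus[symmetric] del: ennreal_plus)
  qed (use that in \<open>auto simp: e2ennreal_neg\<close>)
  have HP: "H + P = ennreal (2*pi*M) + N"
  proof -
    have "H + P = (\<integral>\<^sup>+t. (e2ennreal (ereal M - g t) + e2ennreal (g t)) * indicator {0..2*pi} t \<partial>lborel)"
      unfolding H_def P_def by (subst nn_integral_add[symmetric]) (auto simp: distrib_right)
    also have "\<dots> = (\<integral>\<^sup>+t. (ennreal M + e2ennreal (- g t)) * indicator {0..2*pi} t \<partial>lborel)"
      by (simp add: pt[OF gM])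
    also have "\<dots> = (\<integral>\<^sup>+t. ennreal M * indicator {0..2*pi} t \<partial>lborel) + N"
      unfolding N_def by (subst nn_integral_add[symmetric]) (auto simp: distrib_right)
    also have "(\<integral>\<^sup>+t. ennreal M * indicator {0..2*pi} t \<partial>lborel) = ennreal (2*pi*M)"
      using M by (subst nn_integral_cmult_indicator) (auto simp: ennreal_mult[symmetric] mult.commute)
    finally show ?thesis .
  qed
  have Pfin: "P \<noteq> \<infinity>"
  proof -
    have "P \<le> (\<integral>\<^sup>+t. ennreal M * indicator {0..2*pi} t \<partial>lborel)"
      unfolding P_def using e2ennreal_mono[OF gM] by (intro nn_integral_mono mult_right_mono) (auto simp: e2ennreal_ereal)
    also have "\<dots> = ennreal (2*pi*M)"
      using M by (subst nn_integral_cmult_indicator) (auto simp: ennreal_mult[symmetric] mult.commute)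
    finally show ?thesis using neq_top_trans[of "ennreal (2*pi*M)" P] by simp
  qed
  then obtain p where p: "P = ennreal p" "0 \<le> p" by (metis ennreal_cases infinity_ennreal_def)
  have cm: "circle_mean g = (enn2ereal P - enn2ereal N) / ereal (2*pi)"
    unfolding circle_mean_def P_def N_def ..
  have "x \<le> circle_mean g \<longleftrightarrow> H \<le> ennreal (2*pi) * e2ennreal (ereal M - x)"
  proof (cases x)
    case (real r)
    have rM: "r \<le> M" using x real by simp
    have R: "ennreal (2*pi) * e2ennreal (ereal M - x) = ennreal (2*pi*(M - r))"
      using real rM by (simp add: e2ennreal_ereal ennreal_mult)
    show ?thesis
    proof (cases N rule: ennreal_cases)
      case top
      then have "H = \<infinity>" using HP p by simp
      then show ?thesis unfolding R cm top using p real by (simp add: top_unique)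
    next
      case (real n)
      have "H \<noteq> top" using HP p real by (metis ennreal_add_eq_top ennreal_neq_top)
      then obtain h where h: "H = ennreal h" "0 \<le> h" by (metis ennreal_cases)
      have "ennreal (h + p) = ennreal (2*pi*M + n)" using HP M real p h by simp
      then have eq: "h + p = 2*pi*M + n"
        using M real p h by (subst (asm) ennreal_inj) auto
      have "x \<le> circle_mean g \<longleftrightarrow> r \<le> (p - n) / (2*pi)"
        unfolding cm \<open>x = ereal r\<close> real p using p real by (simp add: enn2ereal_ennreal)
      also have "\<dots> \<longleftrightarrow> r * (2*pi) \<le> p - n" by (subst pos_le_divide_eq) auto
      also have "\<dots> \<longleftrightarrow> h \<le> 2*pi*(M - r)" using eq by (auto simp: algebra_simps)
      also have "\<dots> \<longleftrightarrow> H \<le> ennreal (2*pi*(M - r))" using h rM by (simp add: ennreal_le_iff)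
      finally show ?thesis unfolding R .
    qed
  next
    case PInf
    then show ?thesis using x by simp
  next
    case MInf
    then show ?thesis by (simp add: e2ennreal_infty ennreal_mult_top)
  qed
  then show ?thesis unfolding H_def .
qed

text \<open>The typical member is \<open>M - u\<close> with \<open>u\<close> plurisubharmonic and \<open>u \<le> M\<close>; values in
  \<open>ennreal\<close> make all mean values unconditionally defined.\<close>

definition super_on :: "(complex^'n) set \<Rightarrow> (complex^'n \<Rightarrow> ennreal) \<Rightarrow> bool" where
  "super_on V h \<longleftrightarrow> open V \<and> (\<forall>c. open {x\<in>V. c < h x}) \<and>
     (\<forall>a b. (\<forall>\<zeta>. cmod \<zeta> \<le> 1 \<longrightarrow> a + \<zeta> *s b \<in> V) \<longrightarrow>
        (\<integral>\<^sup>+t. h (a + cis t *s b) * indicator {0..2*pi} t \<partial>lborel) \<le> ennreal (2*pi) * h a)"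

lemma super_on_measurable:
  assumes "super_on V h"
  shows "(\<lambda>x. if x \<in> V then h x else 0) \<in> borel_measurable borel"
proof (rule borel_measurableI_greater)
  fix c
  have "{x \<in> space borel. c < (if x \<in> V then h x else 0)} = {x\<in>V. c < h x}" by auto
  then show "{x \<in> space borel. c < (if x \<in> V then h x else 0)} \<in> sets borel"
    using assms by (simp add: super_on_def)
qed

lemma super_on_circle_measurable:
  assumes "super_on V h" "\<And>t. a + cis t *s b \<in> V"
  shows "(\<lambda>t. h (a + cis t *s b)) \<in> borel_measurable borel"
proof -
  have "(\<lambda>t. if a + cis t *s b \<in> V then h (a + cis t *s b) else 0) \<in> borel_measurable borel"
    by (rule measurable_compose[OF _ super_on_measurable[OF assms(1)], of "\<lambda>t. a + cis t *s b"]) measurable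
  then show ?thesis using assms(2) by simp
qed

lemma less_e2ennreal_iff: "c < e2ennreal y \<longleftrightarrow> enn2ereal c < y"
proof (cases "0 \<le> y")
  case True
  then show ?thesis by (simp add: less_ennreal.rep_eq enn2ereal_e2ennreal)
next
  case False
  then have "\<not> enn2ereal c < y" using enn2ereal_nonneg[of c] by (meson less_le_trans less_imp_le not_le order.strict_trans1)
  then show ?thesis using False by (simp add: e2ennreal_neg)
qed

lemma psh_imp_super_on:
  fixes u :: "complex^'n \<Rightarrow> ereal"
  assumes u: "psh_on \<Omega> u" and V: "open V" "V \<subseteq> \<Omega>" and M: "0 \<le> M" "\<And>z. z \<in> V \<Longrightarrow> u z \<le> ereal M"
  shows "super_on V (\<lambda>z. e2ennreal (ereal M - u z))"
  unfolding super_on_def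
proof (intro conjI allI impI V(1))
  have us: "usc_on \<Omega> u" "open \<Omega>" using u by (auto simp: psh_on_def)
  fix c :: ennreal
  have "c < e2ennreal (ereal M - u x) \<longleftrightarrow> u x < ereal M - enn2ereal c" if "x \<in> V" for x
    unfolding less_e2ennreal_iff using M(2)[OF that] enn2ereal_nonneg[of c]
    by (cases "u x"; cases "enn2ereal c") auto
  then have "{x\<in>V. c < e2ennreal (ereal M - u x)} = {x\<in>\<Omega>. u x < ereal M - enn2ereal c} \<inter> V"
    using V by auto
  then show "open {x\<in>V. c < e2ennreal (ereal M - u x)}"
    using usc_on_open[OF us] V(1) by (simp add: open_Int)
next
  fix a b assume ab: "\<forall>\<zeta>. cmod \<zeta> \<le> 1 \<longrightarrow> a + \<zeta> *s b \<in> V"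
  have us: "usc_on \<Omega> u" "open \<Omega>" using u by (auto simp: psh_on_def)
  have circ: "a + cis t *s b \<in> V" for t using ab by simp
  have "a \<in> V" using ab[rule_format, of 0] by simp
  have "u a \<le> circle_mean (\<lambda>t. u (a + cis t *s b))"
    using u ab V unfolding psh_on_def by blast
  then show "(\<integral>\<^sup>+t. e2ennreal (ereal M - u (a + cis t *s b)) * indicator {0..2*pi} t \<partial>lborel)
      \<le> ennreal (2*pi) * e2ennreal (ereal M - u a)"
    using circle_mean_ge_iff[OF usc_comp_measurable[OF us, of "\<lambda>t. a + cis t *s b"], of M "u a"] circ V M \<open>a \<in> V\<close>
    by (force intro!: continuous_intros)
qed

lemma super_on_imp_psh:
  fixes h :: "complex^'n \<Rightarrow> ennreal"
  assumes h: "super_on V h" and V: "connected V" and z: "z \<in> V" "h z \<noteq> \<infinity>"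
  shows "psh_on V (\<lambda>z. - enn2ereal (h z))"
  unfolding psh_on_def
proof (intro conjI allI impI ballI)
  show oV: "open V" using h by (simp add: super_on_def)
  show "- enn2ereal (h x) \<noteq> \<infinity>" for x using enn2ereal_nonneg[of "h x"] by (cases "enn2ereal (h x)") auto
  show us: "usc_on V (\<lambda>z. - enn2ereal (h z))"
  proof (rule usc_onI_open)
    fix c :: ereal
    show "open {x\<in>V. - enn2ereal (h x) < c}"
    proof (cases "c \<le> 0")
      case True
      have "- enn2ereal (h x) < c \<longleftrightarrow> e2ennreal (- c) < h x" for x
      proof -
        have "- enn2ereal (h x) < c \<longleftrightarrow> - c < enn2ereal (h x)" using ereal_minus_less_minus[of c "- enn2ereal (h x)"] by simp
        also have "\<dots> \<longleftrightarrow> enn2ereal (e2ennreal (- c)) < enn2ereal (h x)"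
          using True by (simp add: enn2ereal_e2ennreal)
        finally show ?thesis by (simp add: less_ennreal.rep_eq)
      qed
      then show ?thesis using h by (simp add: super_on_def)
    next
      case False
      then have "{x\<in>V. - enn2ereal (h x) < c} = V"
        by (auto simp: not_le intro!: le_less_trans[of _ 0 c])
      then show ?thesis using oV by simp
    qed
  qed
  fix a b assume ab: "\<forall>\<zeta>. cmod \<zeta> \<le> 1 \<longrightarrow> a + \<zeta> *s b \<in> V"
  have circ: "a + cis t *s b \<in> V" for t using ab by simp
  have e: "e2ennreal (ereal 0 - - enn2ereal y) = y" for y by (simp add: zero_ereal_def[symmetric])
  have "(\<lambda>t. - enn2ereal (h (a + cis t *s b))) \<in> borel_measurable borel"
    by (rule usc_comp_measurable[OF us oV _ circ]) (intro continuous_intros)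
  from circle_mean_ge_iff[OF this, of 0 "- enn2ereal (h a)"]
  show "- enn2ereal (h a) \<le> circle_mean (\<lambda>t. - enn2ereal (h (a + cis t *s b)))"
    using h ab unfolding super_on_def e by (simp add: zero_ereal_def[symmetric])
next
  fix C assume "C \<in> components V"
  \<comment> \<open>A connected \<open>V\<close> is its only component, so the single point
    \<open>z\<close> of finiteness serves all of them.\<close>
  then have "C = V" using V by (metis components_eq_sing_iff empty_iff singletonD components_empty)
  moreover have "- enn2ereal (h z) \<noteq> - \<infinity>" using z(2) by (cases "h z" rule: ennreal_cases) auto
  ultimately show "\<exists>x\<in>C. - enn2ereal (h x) \<noteq> - \<infinity>" using z(1) by blast
qed

text \<open>Every rotation \<open>cis t\<close> preserves both Lebesgue measure and the weight, so
  averaging over t leaves the integral unchanged. After exchanging the integrals, the circle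
  inequality applies to each \<open>x\<close> separately.\<close>

lemma super_on_mean:
  fixes h :: "complex^'n \<Rightarrow> ennreal" and \<phi> :: "complex^'n \<Rightarrow> ennreal"
  assumes h: "super_on V h" and [measurable]: "\<phi> \<in> borel_measurable borel"
    and rot: "\<And>t x. \<phi> (cis t *s x) = \<phi> x" and e: "0 \<le> e"
    and sub: "\<And>x. \<phi> x \<noteq> 0 \<Longrightarrow> cball z (e * norm x) \<subseteq> V"
  shows "(\<integral>\<^sup>+x. \<phi> x * h (z + e *\<^sub>R x) \<partial>lborel) \<le> h z * (\<integral>\<^sup>+x. \<phi> x \<partial>lborel)"
proof -
  define h0 where "h0 x = (if x \<in> V then h x else 0)" for x
  have [measurable]: "h0 \<in> borel_measurable borel"
    unfolding h0_def using super_on_measurable[OF h] .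
  define g where "g x = \<phi> x * h0 (z + e *\<^sub>R x)" for x
  have [measurable]: "g \<in> borel_measurable borel" unfolding g_def by measurable
  have inV: "z + \<zeta> *s (e *\<^sub>R x) \<in> V" if "\<phi> x \<noteq> 0" "cmod \<zeta> \<le> 1" for x \<zeta>
  proof -
    have "norm (\<zeta> *s (e *\<^sub>R x)) = cmod \<zeta> * (e * norm x)"
      using e by (simp add: norm_vec_def L2_set_def norm_mult power_mult_distrib sum_distrib_left[symmetric] real_sqrt_mult)
    also have "\<dots> \<le> e * norm x" using that(2) e by (simp add: mult_left_le_one_le)
    finally have "z + \<zeta> *s (e *\<^sub>R x) \<in> cball z (e * norm x)" by (simp add: dist_norm)
    then show ?thesis using sub[OF that(1)] by blast
  qed
  have gh: "g x = \<phi> x * h (z + e *\<^sub>R x)" for x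
    using inV[of x 1] by (cases "\<phi> x = 0") (auto simp: g_def h0_def)
  have "ennreal (2*pi) * (\<integral>\<^sup>+x. g x \<partial>lborel) = (\<integral>\<^sup>+t. indicator {0..2*pi} t * (\<integral>\<^sup>+x. g x \<partial>lborel) \<partial>lborel)"
    by (subst nn_integral_multc) auto
  also have "\<dots> = (\<integral>\<^sup>+t. (\<integral>\<^sup>+x. indicator {0..2*pi} t * g (cis t *s x) \<partial>lborel) \<partial>lborel)"
    by (subst nn_integral_cmult) (auto simp: nn_integral_rotate)
  also have "\<dots> = (\<integral>\<^sup>+x. (\<integral>\<^sup>+t. indicator {0..2*pi} t * g (cis t *s x) \<partial>lborel) \<partial>lborel)"
    by (rule lborel_pair.Fubini') measurable
  also have "\<dots> \<le> (\<integral>\<^sup>+x. \<phi> x * (ennreal (2*pi) * h z) \<partial>lborel)"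
  proof (rule nn_integral_mono)
    fix x
    show "(\<integral>\<^sup>+t. indicator {0..2*pi} t * g (cis t *s x) \<partial>lborel) \<le> \<phi> x * (ennreal (2*pi) * h z)"
    proof (cases "\<phi> x = 0")
      case True
      then show ?thesis by (simp add: g_def rot)
    next
      case False
      have eq: "e *\<^sub>R (cis t *s x) = cis t *s (e *\<^sub>R x)" for t by (simp add: vec_eq_iff)
      have m: "(\<lambda>t. h (z + cis t *s (e *\<^sub>R x))) \<in> borel_measurable borel"
        by (rule super_on_circle_measurable[OF h]) (use inV[OF False] in simp)
      have "(\<integral>\<^sup>+t. indicator {0..2*pi} t * g (cis t *s x) \<partial>lborel)
          = (\<integral>\<^sup>+t. \<phi> x * (h (z + cis t *s (e *\<^sub>R x)) * indicator {0..2*pi} t) \<partial>lborel)"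
        by (intro nn_integral_cong) (simp add: gh rot eq mult_ac)
      also have "\<dots> = \<phi> x * (\<integral>\<^sup>+t. h (z + cis t *s (e *\<^sub>R x)) * indicator {0..2*pi} t \<partial>lborel)"
        by (rule nn_integral_cmult) (use m in simp)
      also have "\<dots> \<le> \<phi> x * (ennreal (2*pi) * h z)"
        using h inV[OF False] unfolding super_on_def by (intro mult_left_mono) auto
      finally show ?thesis .
    qed
  qed
  also have "\<dots> = ennreal (2*pi) * (h z * (\<integral>\<^sup>+x. \<phi> x \<partial>lborel))"
    by (subst nn_integral_multc) (auto simp: mult_ac)
  finally have "(\<integral>\<^sup>+x. g x \<partial>lborel) \<le> h z * (\<integral>\<^sup>+x. \<phi> x \<partial>lborel)"
    by (subst (asm) ennreal_mult_le_mult_iff) auto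
  then show ?thesis by (simp add: gh)
qed

section \<open>The Levi form\<close>

text \<open>Used with p = r cos t, q = r sin t and w = \<open>\<i> *s v\<close>: along a circle in a
  complex line the second derivative becomes a trigonometric quadratic form that can be averaged
  over t.\<close>

lemma dder_plane:
  fixes f :: "'a::euclidean_space \<Rightarrow> real"
  assumes U: "open U" "x \<in> U" and C: "Ck 2 U f" and h: "h = p *\<^sub>R v + q *\<^sub>R w"
  shows "dder h f x = p * dder v f x + q * dder w f x"
    and "dder h (dder h f) x = p * p * dder v (dder v f) x + p * q * (dder v (dder w f) x + dder w (dder v f) x)
      + q * q * dder w (dder w f) x"
proof -
  have d: "f differentiable (at y)" "dder v f differentiable (at y)" "dder w f differentiable (at y)" if "y \<in> U" for y
    using C that by (auto simp: numeral_2_eq_2)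
  have 1: "dder h f y = p * dder v f y + q * dder w f y" if "y \<in> U" for y
    unfolding h using d[OF that] by (simp add: dder_add_dir dder_scaleR_dir)
  show "dder h f x = p * dder v f x + q * dder w f x" by (rule 1[OF U(2)])
  have D: "dder h g x = p * dder v g x + q * dder w g x" if "g differentiable (at x)" for g :: "'a \<Rightarrow> real"
    unfolding h using that by (simp add: dder_add_dir dder_scaleR_dir)
  have "dder h (dder h f) x = dder h (\<lambda>y. p * dder v f y + q * dder w f y) x"
    by (rule dder_cong[OF U]) (rule 1)
  also have "\<dots> = p * dder h (dder v f) x + q * dder h (dder w f) x"
    using d[OF U(2)] by (simp add: dder_add dder_cmult differentiable_mult)
  also have "\<dots> = p * (p * dder v (dder v f) x + q * dder w (dder v f) x) + q * (p * dder v (dder w f) x + q * dder w (dder w f) x)"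
    using D d[OF U(2)] by simp
  finally show "dder h (dder h f) x = p * p * dder v (dder v f) x + p * q * (dder v (dder w f) x + dder w (dder v f) x)
      + q * q * dder w (dder w f) x" by (simp add: algebra_simps)
qed

lemma taylor2_line:
  fixes f :: "'a::euclidean_space \<Rightarrow> real"
  assumes C: "Ck 2 U f" and sub: "\<And>t. 0 \<le> t \<Longrightarrow> t \<le> 1 \<Longrightarrow> z + t *\<^sub>R h \<in> U"
  shows "\<exists>t. 0 < t \<and> t < 1 \<and> f (z + h) = f z + dder h f z + dder h (dder h f) (z + t *\<^sub>R h) / 2"
proof -
  have d: "f differentiable (at y)" "dder v f differentiable (at y)" if "y \<in> U" for y v
    using C that by (auto simp: numeral_2_eq_2)
  define D where "D m t = (if m = 0 then f (z + t *\<^sub>R h) else if m = 1 then dder h f (z + t *\<^sub>R h) else dder h (dder h f) (z + t *\<^sub>R h))"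
    for m :: nat and t
  have "\<exists>t>0. t < 1 \<and> D 0 1 = (\<Sum>m<2. D m 0 / fact m * (1 - 0) ^ m) + D 2 t / fact 2 * (1 - 0) ^ 2"
  proof (rule Taylor_up)
    show "\<forall>m t. m < 2 \<and> 0 \<le> t \<and> t \<le> 1 \<longrightarrow> (D m has_real_derivative D (Suc m) t) (at t)"
    proof (intro allI impI)
      fix m :: nat and t :: real assume a: "m < 2 \<and> 0 \<le> t \<and> t \<le> 1"
      then have "z + t *\<^sub>R h \<in> U" using sub by blast
      then show "(D m has_real_derivative D (Suc m) t) (at t)"
        using a d unfolding D_def
        by (cases "m = 0") (auto intro!: has_real_derivative_dder_line simp: less_Suc_eq numeral_2_eq_2)
    qed
  qed auto
  then show ?thesis by (auto simp: D_def numeral_2_eq_2)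
qed

text \<open>If the Levi form were negative, the second order Taylor polynomial along small circles would
  contradict the sub-mean value inequality.\<close>

lemma levi_nonneg:
  fixes f :: "complex^'n \<Rightarrow> real"
  assumes U: "open U" "z \<in> U" and C: "Ck 2 U f" and S: "super_on U (\<lambda>z. ennreal (M - f z))"
    and M: "\<And>z. z \<in> U \<Longrightarrow> f z \<le> M"
  shows "0 \<le> dder b (dder b f) z + dder (\<i> *s b) (dder (\<i> *s b) f) z"
proof (rule ccontr)
  let ?c = "\<i> *s b"
  assume neg: "\<not> ?thesis"
  define L where "L = dder b (dder b f) z + dder ?c (dder ?c f) z"
  have L: "L < 0" using neg by (simp add: L_def)
  define e where "e = - L / 16"
  have e: "e > 0" using L by (simp add: e_def)
  have cont: "continuous_on U (dder v (dder w f))" for v w using C by (auto simp: numeral_2_eq_2)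
  have nb: "\<exists>d>0. \<forall>x. dist x z < d \<longrightarrow> x \<in> U \<and> \<bar>dder v (dder w f) x - dder v (dder w f) z\<bar> < e" for v w
  proof -
    obtain d1 where "d1 > 0" "ball z d1 \<subseteq> U" using U open_contains_ball by blast
    moreover obtain d2 where "d2 > 0" "\<forall>x\<in>U. dist x z < d2 \<longrightarrow> \<bar>dder v (dder w f) x - dder v (dder w f) z\<bar> < e"
      using cont[of v w] U e unfolding continuous_on_iff dist_real_def by metis
    ultimately show ?thesis by (intro exI[of _ "min d1 d2"]) (auto simp: dist_commute subset_iff)
  qed
  obtain d1 where d1: "d1 > 0" "\<forall>x. dist x z < d1 \<longrightarrow> x \<in> U \<and> \<bar>dder b (dder b f) x - dder b (dder b f) z\<bar> < e" using nb by blast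
  obtain d2 where d2: "d2 > 0" "\<forall>x. dist x z < d2 \<longrightarrow> x \<in> U \<and> \<bar>dder b (dder ?c f) x - dder b (dder ?c f) z\<bar> < e" using nb by blast
  obtain d3 where d3: "d3 > 0" "\<forall>x. dist x z < d3 \<longrightarrow> x \<in> U \<and> \<bar>dder ?c (dder b f) x - dder ?c (dder b f) z\<bar> < e" using nb by blast
  obtain d4 where d4: "d4 > 0" "\<forall>x. dist x z < d4 \<longrightarrow> x \<in> U \<and> \<bar>dder ?c (dder ?c f) x - dder ?c (dder ?c f) z\<bar> < e" using nb by blast
  define d where "d = Min {d1, d2, d3, d4}"
  have d: "d > 0" "d \<le> d1" "d \<le> d2" "d \<le> d3" "d \<le> d4" using d1 d2 d3 d4 by (auto simp: d_def)
  define r where "r = d / (2 * (norm b + 1))"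
  have nb1: "norm b + 1 > 0" by (simp add: add_nonneg_pos)
  have r: "r > 0" "r * norm b < d"
  proof -
    show "r > 0" using d nb1 by (simp add: r_def)
    have "r * norm b \<le> r * (norm b + 1)" using \<open>r > 0\<close> by (intro mult_left_mono) auto
    also have "\<dots> = d / 2" using nb1 by (simp add: r_def divide_simps)
    also have "\<dots> < d" using d by simp
    finally show "r * norm b < d" .
  qed
  have near: "dist (z + (t * r) *\<^sub>R (\<zeta> *s b)) z < d" if "0 \<le> t" "t \<le> 1" "cmod \<zeta> \<le> 1" for t \<zeta>
  proof -
    have "norm (\<zeta> *s b) = cmod \<zeta> * norm b"
      by (simp add: norm_vec_def L2_set_def norm_mult power_mult_distrib sum_distrib_left[symmetric] real_sqrt_mult)
    then have "dist (z + (t * r) *\<^sub>R (\<zeta> *s b)) z = t * cmod \<zeta> * (r * norm b)"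
      using that r by (simp add: dist_norm)
    also have "\<dots> \<le> 1 * (r * norm b)" using that r by (intro mult_right_mono mult_le_one) auto
    finally show ?thesis using r by simp
  qed
  define q where "q t = f z + r * (cos t * dder b f z + sin t * dder ?c f z)
      + r\<^sup>2 / 2 * ((cos t)\<^sup>2 * dder b (dder b f) z + cos t * sin t * (dder b (dder ?c f) z + dder ?c (dder b f) z)
          + (sin t)\<^sup>2 * dder ?c (dder ?c f) z) + 2 * e * r\<^sup>2" for t
  have fq: "f (z + cis t *s (r *\<^sub>R b)) \<le> q t" for t
  proof -
    define h where "h = (r * cos t) *\<^sub>R b + (r * sin t) *\<^sub>R ?c"
    have heq: "h = r *\<^sub>R (cis t *s b)" "cis t *s (r *\<^sub>R b) = h"
      by (simp_all add: h_def vec_eq_iff complex_eq_iff algebra_simps)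
    have inU: "z + s *\<^sub>R h \<in> U" if "0 \<le> s" "s \<le> 1" for s
      using near[OF that, of "cis t"] d d1 unfolding heq by (simp add: scaleR_scaleR)
    obtain s where s: "0 < s" "s < 1" "f (z + h) = f z + dder h f z + dder h (dder h f) (z + s *\<^sub>R h) / 2"
      using taylor2_line[OF C inU] by blast
    let ?x = "z + s *\<^sub>R h"
    have nx: "dist ?x z < d" using near[of s "cis t"] s unfolding heq by (simp add: scaleR_scaleR)
    have xU: "?x \<in> U" using inU s by simp
    have A: "dder h f z = r * (cos t * dder b f z + sin t * dder ?c f z)"
      using dder_plane(1)[OF U C h_def] by (simp add: algebra_simps)
    have B: "dder h (dder h f) ?x = r\<^sup>2 * ((cos t)\<^sup>2 * dder b (dder b f) ?x
        + cos t * sin t * dder b (dder ?c f) ?x + cos t * sin t * dder ?c (dder b f) ?x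
          + (sin t)\<^sup>2 * dder ?c (dder ?c f) ?x)"
      using dder_plane(2)[OF U(1) xU C h_def] by (simp add: power2_eq_square algebra_simps)
    have bnd: "a * X \<le> a * Y + e" if "\<bar>a\<bar> \<le> 1" "\<bar>X - Y\<bar> < e" for a X Y :: real
    proof -
      have "a * (X - Y) \<le> \<bar>a\<bar> * \<bar>X - Y\<bar>" by (metis abs_ge_self abs_mult)
      also have "\<dots> \<le> 1 * e" using that by (intro mult_mono) auto
      finally show ?thesis by (simp add: algebra_simps)
    qed
    have c1: "\<bar>(cos t)\<^sup>2\<bar> \<le> 1" "\<bar>(sin t)\<^sup>2\<bar> \<le> 1" "\<bar>cos t * sin t\<bar> \<le> 1"
      by (auto simp: abs_square_le_1 abs_mult intro!: mult_le_one)
    have "dder h (dder h f) ?x \<le> r\<^sup>2 * (((cos t)\<^sup>2 * dder b (dder b f) z + e)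
        + (cos t * sin t * dder b (dder ?c f) z + e) + (cos t * sin t * dder ?c (dder b f) z + e)
          + ((sin t)\<^sup>2 * dder ?c (dder ?c f) z + e))"
      unfolding B using nx d d1 d2 d3 d4 c1
      by (intro mult_left_mono add_mono bnd) auto
    then have "f (z + h) \<le> q t"
      unfolding s(3) A q_def by (simp add: algebra_simps)
    then show ?thesis by (simp add: heq)
  qed
  have disc: "z + \<zeta> *s (r *\<^sub>R b) \<in> U" if "cmod \<zeta> \<le> 1" for \<zeta>
  proof -
    have "\<zeta> *s (r *\<^sub>R b) = (1 * r) *\<^sub>R (\<zeta> *s b)" by (simp add: vec_eq_iff)
    then show ?thesis using near[of 1 \<zeta>] that d d1 by simp
  qed
  let ?g = "\<lambda>t. M - f (z + cis t *s (r *\<^sub>R b))"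
  have gcont: "continuous_on {0..2*pi} ?g"
    by (intro continuous_intros continuous_on_compose2[OF Ck_imp_continuous[OF C]]) (use disc in auto)
  have gpos: "0 \<le> ?g t" for t using M[OF disc[of "cis t"]] by simp
  have gint: "?g integrable_on {0..2*pi}" by (rule integrable_continuous_interval[OF gcont])
  have gm: "?g \<in> borel_measurable borel"
    by (intro borel_measurable_continuous_onI continuous_intros continuous_on_compose2[OF Ck_imp_continuous[OF C]]) (use disc in auto)
  have "ennreal (integral {0..2*pi} ?g) = (\<integral>\<^sup>+t. ennreal (?g t) * indicator {0..2*pi} t \<partial>lborel)"
  proof -
    have "((\<lambda>t. if t \<in> {0..2*pi} then ?g t else 0) has_integral integral {0..2*pi} ?g) UNIV"
      unfolding has_integral_restrict_UNIV by (rule integrable_integral[OF gint])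
    from nn_integral_has_integral_lborel[OF _ _ this]
    have "(\<integral>\<^sup>+t. ennreal (if t \<in> {0..2*pi} then ?g t else 0) \<partial>lborel) = ennreal (integral {0..2*pi} ?g)"
      using gm gpos by simp
    moreover have "ennreal (if t \<in> {0..2*pi} then ?g t else 0) = ennreal (?g t) * indicator {0..2*pi} t" for t
      by (simp add: indicator_def)
    ultimately show ?thesis by simp
  qed
  also have "\<dots> \<le> ennreal (2*pi) * ennreal (M - f z)"
    using S disc unfolding super_on_def by blast
  also have "\<dots> = ennreal (2*pi * (M - f z))" using M[OF U(2)] by (simp add: ennreal_mult)
  finally have "integral {0..2*pi} ?g \<le> 2*pi * (M - f z)"
    using M[OF U(2)] by (subst (asm) ennreal_le_iff) auto
  moreover have "integral {0..2*pi} (\<lambda>t. M - q t) \<le> integral {0..2*pi} ?g"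
  proof (rule integral_le[OF _ gint])
    show "(\<lambda>t. M - q t) integrable_on {0..2*pi}"
      unfolding q_def by (intro integrable_continuous_interval continuous_intros)
  qed (use fq in auto)
  moreover have "integral {0..2*pi} (\<lambda>t. M - q t) = 2*pi * (M - f z) - 2 * pi * (r\<^sup>2 * L / 8)"
  proof -
    define F where "F t = (M - f z - 2 * e * r\<^sup>2) * t - r * (sin t * dder b f z - cos t * dder ?c f z)
      - r\<^sup>2 / 2 * ((t + sin t * cos t) / 2 * dder b (dder b f) z + (sin t)\<^sup>2 / 2 * (dder b (dder ?c f) z + dder ?c (dder b f) z)
          + (t - sin t * cos t) / 2 * dder ?c (dder ?c f) z)" for t
    have F': "(F has_vector_derivative (M - q t)) (at t within {0..2*pi})" for t
    proof -
      have cs: "(1 + (cos t * cos t - sin t * sin t)) / 2 = (cos t)\<^sup>2" "(1 - (cos t * cos t - sin t * sin t)) / 2 = (sin t)\<^sup>2"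
        using sin_cos_squared_add[of t] by (auto simp: power2_eq_square field_simps)
      have "(F has_real_derivative ((M - f z - 2 * e * r\<^sup>2) - r * (cos t * dder b f z + sin t * dder ?c f z)
        - r\<^sup>2 / 2 * ((1 + (cos t * cos t - sin t * sin t)) / 2 * dder b (dder b f) z
          + (sin t * cos t) * (dder b (dder ?c f) z + dder ?c (dder b f) z)
          + (1 - (cos t * cos t - sin t * sin t)) / 2 * dder ?c (dder ?c f) z))) (at t)"
        unfolding F_def by (auto intro!: derivative_eq_intros simp: power2_eq_square field_simps)
      then have "(F has_real_derivative (M - q t)) (at t)"
        unfolding cs q_def by (simp add: algebra_simps)
      then show ?thesis
        using has_real_derivative_iff_has_vector_derivative has_vector_derivative_at_within by blast
    qed
    have "((\<lambda>t. M - q t) has_integral (F (2*pi) - F 0)) {0..2*pi}"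
      by (rule fundamental_theorem_of_calculus[OF _ F']) auto
    then have "integral {0..2*pi} (\<lambda>t. M - q t) = F (2*pi) - F 0" by (rule integral_unique)
    also have "\<dots> = 2*pi * (M - f z) - 2 * pi * (r\<^sup>2 * (L / 4 + 2 * e))"
      by (simp add: F_def L_def field_simps)
    also have "L / 4 + 2 * e = L / 8" by (simp add: e_def)
    finally show ?thesis by simp
  qed
  moreover have "2 * pi * (r\<^sup>2 * L / 8) < 0" using r L by (simp add: mult_neg_pos)
  ultimately show False by linarith
qed

lemma vec_axis_expand:
  "(x :: complex^'n) = (\<Sum>j\<in>UNIV. Re (x $ j) *\<^sub>R axis j 1) + (\<Sum>j\<in>UNIV. Im (x $ j) *\<^sub>R axis j \<i>)"
proof -
  have e: "(r *\<^sub>R axis j c) $ i = (if j = i then of_real r * c else 0)" for r i j and c :: complex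
    by (simp add: axis_def complex_eq_iff)
  have "(\<Sum>j\<in>UNIV. Re (x $ j) *\<^sub>R axis j (1::complex)) $ i = of_real (Re (x $ i))" for i
    unfolding sum_component e by simp
  moreover have "(\<Sum>j\<in>UNIV. Im (x $ j) *\<^sub>R axis j \<i>) $ i = of_real (Im (x $ i)) * \<i>" for i
    unfolding sum_component e by simp
  ultimately show ?thesis by (simp add: vec_eq_iff complex_eq_iff)
qed

lemma dder_axis_expand:
  fixes g :: "complex^'n \<Rightarrow> complex"
  assumes "g differentiable (at z)"
  shows "dder x g z = (\<Sum>j\<in>UNIV. of_real (Re (x $ j)) * dder (axis j 1) g z + of_real (Im (x $ j)) * dder (axis j \<i>) g z)"
proof -
  have "dder x g z = dder ((\<Sum>j\<in>UNIV. Re (x $ j) *\<^sub>R axis j 1) + (\<Sum>j\<in>UNIV. Im (x $ j) *\<^sub>R axis j \<i>)) g z"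
    using vec_axis_expand[of x] by simp
  then show ?thesis
    unfolding dder_add_dir[OF assms] dder_sum_dir[OF assms] sum.distrib by (simp only: scaleR_conv_of_real)
qed

text \<open>The Wirtinger operator in the complex direction \<open>x\<close> is built from real
  derivatives along \<open>x\<close> and \<open>\<i> *s x\<close>. This computes the Hermitian form
  of the Hessian without looking at its entries.\<close>

lemma sum_dz:
  assumes "g differentiable (at z)"
  shows "(\<Sum>j\<in>UNIV. x $ j * dz j g z) = (dder x g z - \<i> * dder (\<i> *s x) g z) / 2"
    and "(\<Sum>j\<in>UNIV. cnj (x $ j) * dzb j g z) = (dder x g z + \<i> * dder (\<i> *s x) g z) / 2"
proof -
  have c: "x $ j = of_real (Re (x $ j)) + \<i> * of_real (Im (x $ j))" for j by (simp add: complex_eq_iff)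
  have a: "x $ j * dz j g z = (of_real (Re (x $ j)) * dder (axis j 1) g z + of_real (Im (x $ j)) * dder (axis j \<i>) g z
       - \<i> * (of_real (Re ((\<i> *s x) $ j)) * dder (axis j 1) g z + of_real (Im ((\<i> *s x) $ j)) * dder (axis j \<i>) g z)) / 2" for j
    by (subst c) (simp add: dz_def algebra_simps)
  have b: "cnj (x $ j) * dzb j g z = (of_real (Re (x $ j)) * dder (axis j 1) g z + of_real (Im (x $ j)) * dder (axis j \<i>) g z
       + \<i> * (of_real (Re ((\<i> *s x) $ j)) * dder (axis j 1) g z + of_real (Im ((\<i> *s x) $ j)) * dder (axis j \<i>) g z)) / 2" for j
    by (subst c) (simp add: dzb_def algebra_simps)
  show "(\<Sum>j\<in>UNIV. x $ j * dz j g z) = (dder x g z - \<i> * dder (\<i> *s x) g z) / 2"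
    unfolding dder_axis_expand[OF assms, of x] dder_axis_expand[OF assms, of "\<i> *s x"] a by (simp only: sum_divide_distrib[symmetric] sum_subtractf sum_distrib_left)
  show "(\<Sum>j\<in>UNIV. cnj (x $ j) * dzb j g z) = (dder x g z + \<i> * dder (\<i> *s x) g z) / 2"
    unfolding dder_axis_expand[OF assms, of x] dder_axis_expand[OF assms, of "\<i> *s x"] b by (simp add: sum_divide_distrib[symmetric] sum.distrib sum_distrib_left distrib_left)
qed

lemma dder2_cr:
  assumes "open U" "z \<in> U" "Ck 2 U f"
  shows "dder v (dder w (cr f)) z = of_real (dder v (dder w f) z)"
proof -
  have d: "f differentiable (at y)" "dder w f differentiable (at y)" if "y \<in> U" for y
    using assms(3) that by (auto simp: numeral_2_eq_2)
  have "dder v (dder w (cr f)) z = dder v (cr (dder w f)) z"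
    by (rule dder_cong[OF assms(1,2)]) (rule dder_of_real[OF d(1)])
  then show ?thesis by (simp add: dder_of_real[OF d(2)[OF assms(2)]])
qed

text \<open>This is the formula of \<open>cplx_hess\<close>; the order of differentiation is
  adjusted by the symmetry of second derivatives.\<close>

lemma chess_entry:
  fixes f :: "complex^'n \<Rightarrow> real"
  assumes U: "open U" "z \<in> U" and C: "Ck 2 U f"
  shows "chess (cr f) z $ j $ k = (of_real (dder (axis j 1) (dder (axis k 1) f) z + dder (axis j \<i>) (dder (axis k \<i>) f) z)
      + \<i> * of_real (dder (axis j 1) (dder (axis k \<i>) f) z - dder (axis j \<i>) (dder (axis k 1) f) z)) / 4"
proof -
  have Cc: "Ck 2 U (cr f)" by (rule Ck_of_real[OF U(1) C])
  show ?thesis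
    unfolding row_hess_def dz_def
    unfolding vec_lambda_beta dder_dzb[OF U Cc] dzb_def dder2_cr[OF U C]
      dder_commute_real[OF U C, of "axis k 1" "axis j 1"] dder_commute_real[OF U C, of "axis k 1" "axis j \<i>"]
      dder_commute_real[OF U C, of "axis k \<i>" "axis j 1"] dder_commute_real[OF U C, of "axis k \<i>" "axis j \<i>"]
    by (simp add: field_simps)
qed

text \<open>The Hermitian form at \<open>x\<close> is a quarter of the Laplacian of \<open>f\<close>
  along the complex line in direction \<open>x\<close>.\<close>

lemma psd_chess:
  fixes f :: "complex^'n \<Rightarrow> real"
  assumes U: "open U" "z \<in> U" and C: "Ck 2 U f"
    and L: "\<And>b. 0 \<le> dder b (dder b f) z + dder (\<i> *s b) (dder (\<i> *s b) f) z"
  shows "psd (chess (cr f) z)"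
proof -
  have Cc: "Ck 2 U (cr f)" by (rule Ck_of_real[OF U(1) C])
  have d: "cr f differentiable (at y)" "dder w (cr f) differentiable (at y)" if "y \<in> U" for y w
    using Cc that by (auto simp: numeral_2_eq_2)
  have dzbd: "dzb k (cr f) differentiable (at z)" for k
    using Ck_dzb[OF U(1), of 1 "cr f" k] Cc U by (auto simp: numeral_2_eq_2)
  have cj: "(of_real A + \<i> * of_real (p - q)) / 4 = cnj ((of_real A + \<i> * of_real (q - p)) / 4)" for A p q
    by (simp add: complex_eq_iff)
  have herm: "chess (cr f) z $ j $ k = cnj (chess (cr f) z $ k $ j)" for j k
    unfolding chess_entry[OF U C] dder_commute_real[OF U C, of "axis k 1" "axis j 1"] dder_commute_real[OF U C, of "axis k 1" "axis j \<i>"]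
      dder_commute_real[OF U C, of "axis k \<i>" "axis j 1"] dder_commute_real[OF U C, of "axis k \<i>" "axis j \<i>"] by (rule cj)
  have form: "herm_form (chess (cr f) z) x = of_real (dder x (dder x f) z + dder (\<i> *s x) (dder (\<i> *s x) f) z) / 4" for x
  proof -
    let ?y = "\<i> *s x"
    have "herm_form (chess (cr f) z) x = (\<Sum>k\<in>UNIV. cnj (x $ k) * (\<Sum>j\<in>UNIV. x $ j * dz j (dzb k (cr f)) z))"
      unfolding herm_form_def row_hess_def by (subst sum.swap) (simp add: sum_distrib_left mult_ac)
    also have "\<dots> = (\<Sum>k\<in>UNIV. cnj (x $ k) * ((dzb k (dder x (cr f)) z - \<i> * dzb k (dder ?y (cr f)) z) / 2))"
      unfolding sum_dz(1)[OF dzbd] dder_dzb[OF U Cc] ..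
    also have "\<dots> = ((\<Sum>k\<in>UNIV. cnj (x $ k) * dzb k (dder x (cr f)) z) - \<i> * (\<Sum>k\<in>UNIV. cnj (x $ k) * dzb k (dder ?y (cr f)) z)) / 2"
      by (simp add: sum_distrib_left sum_subtractf[symmetric] sum_divide_distrib algebra_simps)
    also have "\<dots> = ((dder x (dder x (cr f)) z + \<i> * dder ?y (dder x (cr f)) z) / 2
        - \<i> * ((dder x (dder ?y (cr f)) z + \<i> * dder ?y (dder ?y (cr f)) z) / 2)) / 2"
      unfolding sum_dz(2)[OF d(2)[OF U(2)]] ..
    also have "\<dots> = of_real (dder x (dder x f) z + dder ?y (dder ?y f) z) / 4"
      unfolding dder2_cr[OF U C] dder_commute_real[OF U C, of ?y x] by (simp add: field_simps)
    finally show ?thesis .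
  qed
  have "0 \<le> Re (herm_form (chess (cr f) z) x)" for x
    unfolding form using L[of x] by simp
  then show ?thesis unfolding psd_def using herm by blast
qed

section \<open>Mollification\<close>

lemma uniformly_continuous_compact_support:
  fixes k :: "'a::euclidean_space \<Rightarrow> real"
  assumes k: "continuous_on UNIV k" and R: "\<And>x. norm x > R \<Longrightarrow> k x = 0" and e: "e > 0"
  obtains d where "d > 0" "\<And>x y. norm (x - y) < d \<Longrightarrow> \<bar>k x - k y\<bar> < e"
proof -
  have "uniformly_continuous_on (cball 0 (R + 1)) k"
    by (rule compact_uniformly_continuous) (use k continuous_on_subset in auto)
  then obtain d where d: "d > 0" "\<And>x y. x \<in> cball 0 (R + 1) \<Longrightarrow> y \<in> cball 0 (R + 1) \<Longrightarrow> dist y x < d \<Longrightarrow> dist (k y) (k x) < e"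
    using e unfolding uniformly_continuous_on_def by metis
  show thesis
  proof (rule that[of "min d 1"])
    fix x y :: 'a assume xy: "norm (x - y) < min d 1"
    show "\<bar>k x - k y\<bar> < e"
    proof (cases "norm x \<le> R + 1 \<and> norm y \<le> R + 1")
      case True
      then show ?thesis using d(2)[of y x] xy by (simp add: dist_norm)
    next
      case False
      have "norm x \<le> norm y + norm (x - y)" "norm y \<le> norm x + norm (x - y)"
        using norm_triangle_sub norm_triangle_sub[of y x] by (auto simp: norm_minus_commute)
      then have "norm x > R" "norm y > R" using False xy by auto
      then show ?thesis using R e by simp
    qed
  qed (use d in simp)
qed

lemma bounded_compact_support:
  fixes k :: "'a::euclidean_space \<Rightarrow> real"
  assumes k: "continuous_on UNIV k" and R: "\<And>x. norm x > R \<Longrightarrow> k x = 0"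
  obtains B where "0 \<le> B" "\<And>x. \<bar>k x\<bar> \<le> B"
proof -
  have "compact (k ` cball 0 R)" by (rule compact_continuous_image) (use k continuous_on_subset in auto)
  then obtain B where B: "\<forall>y\<in>k ` cball 0 R. norm y \<le> B" using compact_imp_bounded bounded_iff by blast
  show thesis
  proof (rule that[of "max B 0"])
    show "\<bar>k x\<bar> \<le> max B 0" for x
      using B R[of x] by (cases "norm x \<le> R") (auto simp: le_max_iff_disj)
  qed simp
qed

lemma integrable_mult_bounded_continuous:
  fixes g k :: "'a::euclidean_space \<Rightarrow> real"
  assumes g: "integrable lborel g" and k: "continuous_on UNIV k" and B: "\<And>x. \<bar>k x\<bar> \<le> B"
  shows "integrable lborel (\<lambda>y. g y * k (y - z))"
proof (rule Bochner_Integration.integrable_bound[of _ "\<lambda>y. B * g y"])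
  have [measurable]: "k \<in> borel_measurable borel" by (rule borel_measurable_continuous_onI[OF k])
  show "(\<lambda>y. g y * k (y - z)) \<in> borel_measurable lborel" using g by measurable
  have "0 \<le> B" using B[of 0] by simp
  then show "AE x in lborel. norm (g x * k (x - z)) \<le> norm (B * g x)"
    using B by (auto simp: abs_mult mult.commute[of B] intro!: mult_left_mono)
qed (use g in simp)

lemma continuous_on_conv:
  fixes g k :: "'a::euclidean_space \<Rightarrow> real"
  assumes g: "integrable lborel g" and k: "continuous_on UNIV k" and R: "\<And>x. norm x > R \<Longrightarrow> k x = 0"
  shows "continuous_on UNIV (\<lambda>z. \<integral>y. g y * k (y - z) \<partial>lborel)"
proof -
  obtain B where B: "0 \<le> B" "\<And>x. \<bar>k x\<bar> \<le> B" using bounded_compact_support[where R = R, OF k R] by blast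
  note int = integrable_mult_bounded_continuous[OF g k B(2)]
  define I where "I = (\<integral>y. \<bar>g y\<bar> \<partial>lborel)"
  have I: "0 \<le> I" by (simp add: I_def)
  show ?thesis unfolding continuous_on_iff
  proof (intro ballI allI impI)
    fix z :: 'a and e :: real assume e: "e > 0"
    obtain d where d: "d > 0" "\<And>x y. norm (x - y) < d \<Longrightarrow> \<bar>k x - k y\<bar> < e / (I + 1)"
      using uniformly_continuous_compact_support[where R = R and e = "e / (I + 1)", OF k R] e I
      by (metis add_nonneg_pos divide_pos_pos zero_less_one)
    have "dist (\<integral>y. g y * k (y - z') \<partial>lborel) (\<integral>y. g y * k (y - z) \<partial>lborel) < e" if "dist z' z < d" for z'
    proof -
      have "\<bar>(\<integral>y. g y * k (y - z') \<partial>lborel) - (\<integral>y. g y * k (y - z) \<partial>lborel)\<bar>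
          = \<bar>\<integral>y. g y * k (y - z') - g y * k (y - z) \<partial>lborel\<bar>"
        by (simp add: Bochner_Integration.integral_diff[OF int int])
      also have "\<dots> \<le> (\<integral>y. \<bar>g y\<bar> * (e / (I + 1)) \<partial>lborel)"
      proof (rule integral_abs_bound_integral)
        show "integrable lborel (\<lambda>y. g y * k (y - z') - g y * k (y - z))" using int by simp
        show "integrable lborel (\<lambda>y. \<bar>g y\<bar> * (e / (I + 1)))" using g by simp
        fix y
        have "\<bar>g y * k (y - z') - g y * k (y - z)\<bar> = \<bar>g y\<bar> * \<bar>k (y - z') - k (y - z)\<bar>"
          by (simp add: abs_mult[symmetric] right_diff_distrib)
        also have "\<dots> \<le> \<bar>g y\<bar> * (e / (I + 1))"
          using d(2)[of "y - z'" "y - z"] that by (intro mult_left_mono) (auto simp: dist_norm norm_minus_commute)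
        finally show "\<bar>g y * k (y - z') - g y * k (y - z)\<bar> \<le> \<bar>g y\<bar> * (e / (I + 1))" .
      qed
      also have "\<dots> = I * (e / (I + 1))" by (simp add: I_def)
      also have "\<dots> < e" using I e by (simp add: field_simps)
      finally show ?thesis by (simp add: dist_real_def)
    qed
    then show "\<exists>d>0. \<forall>x'\<in>UNIV. dist x' z < d \<longrightarrow>
        dist (\<integral>y. g y * k (y - x') \<partial>lborel) (\<integral>y. g y * k (y - z) \<partial>lborel) < e"
      using d(1) by blast
  qed
qed

lemma dder_zero_outside:
  fixes k :: "'a::euclidean_space \<Rightarrow> real"
  assumes "\<And>x. norm x > R \<Longrightarrow> k x = 0" "norm x > R"
  shows "dder v k x = 0"
proof -
  have "open {x::'a. norm x > R}" by (intro open_Collect_less continuous_intros)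
  from dder_cong[OF this, of x k "\<lambda>_. 0" v] show ?thesis using assms by simp
qed

text \<open>The partial derivatives of the kernel are uniformly continuous, so its first order
  Taylor remainder is small relative to the increment, uniformly in the base point. This bound
  survives integration against the integrable \<open>g\<close>.\<close>

lemma has_derivative_conv:
  fixes g k :: "'a::euclidean_space \<Rightarrow> real"
  assumes g: "integrable lborel g" and k: "Ck 1 UNIV k" and R: "\<And>x. norm x > R \<Longrightarrow> k x = 0"
  shows "((\<lambda>z. \<integral>y. g y * k (y - z) \<partial>lborel) has_derivative (\<lambda>h. \<integral>y. g y * - dder h k (y - z) \<partial>lborel)) (at z)"
proof -
  have kd: "k differentiable (at x)" and kc: "continuous_on UNIV (dder v k)" for x v using k by auto
  have k0: "continuous_on UNIV k" by (rule Ck_imp_continuous[OF k])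
  have kz: "dder v k x = 0" if "norm x > R" for v x by (rule dder_zero_outside[OF R that])
  obtain B where B: "0 \<le> B" "\<And>x. \<bar>k x\<bar> \<le> B" using bounded_compact_support[where R = R, OF k0 R] by blast
  note int = integrable_mult_bounded_continuous[OF g k0 B(2)]
  have int': "integrable lborel (\<lambda>y. g y * - dder v k (y - z))" for v z
  proof -
    obtain B' where "\<And>x. \<bar>dder v k x\<bar> \<le> B'" using bounded_compact_support[where R = R, OF kc kz] by blast
    from integrable_mult_bounded_continuous[OF g kc this, of z] show ?thesis by simp
  qed
  define I where "I = (\<integral>y. \<bar>g y\<bar> \<partial>lborel)"
  have I: "0 \<le> I" by (simp add: I_def)
  show ?thesis unfolding has_derivative_at_alt
  proof (intro conjI allI impI)
    have "linear (\<lambda>h. \<integral>y. g y * - dder h k (y - z) \<partial>lborel)"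
    proof (rule linearI)
      show "(\<integral>y. g y * - dder (v + w) k (y - z) \<partial>lborel) = (\<integral>y. g y * - dder v k (y - z) \<partial>lborel) + (\<integral>y. g y * - dder w k (y - z) \<partial>lborel)" for v w
        using int' by (subst Bochner_Integration.integral_add[symmetric]) (auto simp: dder_add_dir[OF kd] algebra_simps)
      show "(\<integral>y. g y * - dder (c *\<^sub>R v) k (y - z) \<partial>lborel) = c *\<^sub>R (\<integral>y. g y * - dder v k (y - z) \<partial>lborel)" for c v
        by (subst integral_scaleR_right[symmetric]) (auto simp: dder_scaleR_dir[OF kd] algebra_simps)
    qed
    then show "bounded_linear (\<lambda>h. \<integral>y. g y * - dder h k (y - z) \<partial>lborel)"
      by (simp add: linear_conv_bounded_linear)
  next
    fix e :: real assume e: "e > 0"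
    \<comment> \<open>\<open>DIM('a)\<close> counts the coordinate directions in the remainder, and
      \<open>I + 1\<close> instead of \<open>I\<close> keeps the divisor positive when
      \<open>g\<close> vanishes almost everywhere.\<close>
    define e' where "e' = e / ((I + 1) * real DIM('a))"
    have e': "e' > 0" using e I by (simp add: e'_def add_nonneg_pos)
    have "\<exists>d>0. \<forall>x y. norm (x - y) < d \<longrightarrow> \<bar>dder b k x - dder b k y\<bar> < e'" for b
      using uniformly_continuous_compact_support[where R = R, OF kc kz e', of b] by metis
    then obtain d where d: "\<And>b. d b > 0" "\<And>b x y. norm (x - y) < d b \<Longrightarrow> \<bar>dder b k x - dder b k y\<bar> < e'" by metis
    define D where "D = Min (d ` (Basis :: 'a set))"
    have D: "D > 0" "\<And>b. b \<in> Basis \<Longrightarrow> D \<le> d b" using d(1) by (auto simp: D_def)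
    have pt: "\<bar>k (x - h) - k x + dder h k x\<bar> \<le> e / (I + 1) * norm h" if h: "norm h < D" for x h
    proof -
      have "\<exists>t. 0 < t \<and> t < 1 \<and> k (x + 1 *\<^sub>R (- h)) - k (x + 0 *\<^sub>R (- h)) = (1 - 0) * dder (- h) k (x + t *\<^sub>R (- h))"
        using MVT2[of 0 1 "\<lambda>t. k (x + t *\<^sub>R (- h))" "\<lambda>t. dder (- h) k (x + t *\<^sub>R (- h))"]
          has_real_derivative_dder_line[OF kd] by (metis zero_less_one)
      then obtain t where t: "0 < t" "t < 1" "k (x - h) - k x = dder (- h) k (x - t *\<^sub>R h)" by auto
      have neg: "dder (- h) k y = - dder h k y" for y
        using dder_scaleR_dir[OF kd, of "-1" h y] by simp
      have ex: "dder h k y = (\<Sum>b\<in>Basis. (h \<bullet> b) * dder b k y)" for y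
        using dder_sum_dir[OF kd, of "\<lambda>b. h \<bullet> b" "\<lambda>b. b" Basis y] by (simp add: euclidean_representation)
      have "k (x - h) - k x + dder h k x = (\<Sum>b\<in>Basis. (h \<bullet> b) * (dder b k x - dder b k (x - t *\<^sub>R h)))"
        unfolding t(3) neg ex[of x] ex[of "x - t *\<^sub>R h"] by (simp add: sum_subtractf right_diff_distrib)
      also have "\<bar>\<dots>\<bar> \<le> (\<Sum>b\<in>(Basis::'a set). norm h * e')"
      proof (rule order_trans[OF sum_abs], rule sum_mono)
        fix b :: 'a assume b: "b \<in> Basis"
        have "norm (x - (x - t *\<^sub>R h)) \<le> norm h" using t by (simp add: mult_left_le_one_le)
        then have "\<bar>dder b k x - dder b k (x - t *\<^sub>R h)\<bar> < e'" using h D(2)[OF b] by (intro d(2)) linarith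
        then show "\<bar>(h \<bullet> b) * (dder b k x - dder b k (x - t *\<^sub>R h))\<bar> \<le> norm h * e'"
          unfolding abs_mult using Basis_le_norm[OF b, of h] by (intro mult_mono) auto
      qed
      also have "\<dots> = (real DIM('a) * e') * norm h" by simp
      also have "real DIM('a) * e' = e / (I + 1)" by (simp add: e'_def)
      finally show ?thesis .
    qed
    have "norm ((\<integral>y. g y * k (y - w) \<partial>lborel) - (\<integral>y. g y * k (y - z) \<partial>lborel)
        - (\<integral>y. g y * - dder (w - z) k (y - z) \<partial>lborel)) \<le> e * norm (w - z)" if w: "norm (w - z) < D" for w
    proof -
      have "(\<integral>y. g y * k (y - w) \<partial>lborel) - (\<integral>y. g y * k (y - z) \<partial>lborel)
        - (\<integral>y. g y * - dder (w - z) k (y - z) \<partial>lborel)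
        = (\<integral>y. g y * k (y - w) - g y * k (y - z) - g y * - dder (w - z) k (y - z) \<partial>lborel)"
        using int int' by (simp del: mult_minus_right)
      also have "norm \<dots> \<le> (\<integral>y. \<bar>g y\<bar> * (e / (I + 1) * norm (w - z)) \<partial>lborel)"
        unfolding real_norm_def
      proof (rule integral_abs_bound_integral)
        show "integrable lborel (\<lambda>y. g y * k (y - w) - g y * k (y - z) - g y * - dder (w - z) k (y - z))"
          using int int' by (simp del: mult_minus_right)
        show "integrable lborel (\<lambda>y. \<bar>g y\<bar> * (e / (I + 1) * norm (w - z)))" using g by simp
        fix y
        have eq: "y - z - (w - z) = y - w" by simp
        have "\<bar>g y * k (y - w) - g y * k (y - z) - g y * - dder (w - z) k (y - z)\<bar>
            = \<bar>g y\<bar> * \<bar>k (y - w) - k (y - z) + dder (w - z) k (y - z)\<bar>"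
          by (simp add: abs_mult[symmetric] algebra_simps)
        also have "\<dots> \<le> \<bar>g y\<bar> * (e / (I + 1) * norm (w - z))"
          using pt[OF w, of "y - z"] unfolding eq by (intro mult_left_mono) auto
        finally show "\<bar>g y * k (y - w) - g y * k (y - z) - g y * - dder (w - z) k (y - z)\<bar>
            \<le> \<bar>g y\<bar> * (e / (I + 1) * norm (w - z))" .
      qed
      also have "\<dots> = (I / (I + 1)) * (e * norm (w - z))" by (simp add: I_def)
      also have "\<dots> \<le> 1 * (e * norm (w - z))" using I e by (intro mult_right_mono) auto
      finally show ?thesis by simp
    qed
    then show "\<exists>d>0. \<forall>y. norm (y - z) < d \<longrightarrow>
       norm ((\<integral>ya. g ya * k (ya - y) \<partial>lborel) - (\<integral>y. g y * k (y - z) \<partial>lborel)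
        - (\<integral>ya. g ya * - dder (y - z) k (ya - z) \<partial>lborel)) \<le> e * norm (y - z)"
      using D(1) by blast
  qed
qed

text \<open>Every derivative falls on the kernel, with a minus sign because the kernel is evaluated
  at \<open>y - z\<close>; so the kernel passes its smoothness on to a merely integrable
  \<open>g\<close>.\<close>

lemma Ck_conv:
  fixes g k :: "'a::euclidean_space \<Rightarrow> real"
  assumes g: "integrable lborel g" and k: "Ck n UNIV k" and R: "\<And>x. norm x > R \<Longrightarrow> k x = 0"
  shows "Ck n UNIV (\<lambda>z. \<integral>y. g y * k (y - z) \<partial>lborel)"
  using k R
proof (induction n arbitrary: k)
  case 0
  then show ?case using continuous_on_conv[OF g, of k R] by simp
next
  case (Suc n)
  have k1: "Ck 1 UNIV k" using Ck_mono[OF Suc.prems(1), of 1] by simp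
  note der = has_derivative_conv[where R = R, OF g k1 Suc.prems(2)]
  have "dder v (\<lambda>z. \<integral>y. g y * k (y - z) \<partial>lborel) = (\<lambda>z. \<integral>y. g y * - dder v k (y - z) \<partial>lborel)" for v
    by (rule ext, rule dder_eqI[OF der])
  moreover have "Ck n UNIV (\<lambda>z. \<integral>y. g y * - dder v k (y - z) \<partial>lborel)" for v
    by (rule Suc.IH) (use Suc.prems Ck_uminus[OF open_UNIV, of n "dder v k"] dder_zero_outside[of R k] in auto)
  moreover have "(\<lambda>z. \<integral>y. g y * k (y - z) \<partial>lborel) differentiable (at z)" for z
    using der unfolding differentiable_def by blast
  ultimately show ?case by simp
qed

section \<open>A polynomial kernel of finite smoothness\<close>

lemma Ck_pospow_kernel:
  fixes c :: real
  assumes "n < p"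
  shows "Ck n UNIV (\<lambda>x::'a::euclidean_space. pospow p (1 - c * (x \<bullet> x)))"
proof -
  define D where "D i t = (fact p / fact (p - i)) * pospow (p - i) t" for i t
  have "Ck n UNIV (\<lambda>x::'a. D 0 (1 - c * (x \<bullet> x)))"
  proof (rule Ck_real_comp[where D = D and S = UNIV])
    show "(D i has_real_derivative D (Suc i) x) (at x)" if i: "i < n" for i x
    proof -
      obtain m where m: "p - i = Suc (Suc m)" "p - Suc i = Suc m"
        using i assms by (metis Suc_diff_Suc Suc_lessI less_trans_Suc order.strict_trans)
      have "(D i has_real_derivative (fact p / fact (Suc (Suc m))) * (real (Suc (Suc m)) * pospow (Suc m) x)) (at x)"
        unfolding D_def m by (intro DERIV_cmult has_real_derivative_pospow)
      also have "(fact p / fact (Suc (Suc m))) * (real (Suc (Suc m)) * pospow (Suc m) x) = D (Suc i) x"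
        unfolding D_def m by (simp only: fact_Suc[of "Suc m"]) (simp add: field_simps del: of_nat_Suc fact_Suc)
      finally show ?thesis .
    qed
    show "continuous_on UNIV (D n)" unfolding D_def by (intro continuous_intros)
    show "Ck n UNIV (\<lambda>x::'a. 1 - c * (x \<bullet> x))"
      by (intro Ck_diff Ck_const Ck_cmult Ck_bilinear[OF _ bounded_bilinear_inner] Ck_linear bounded_linear_ident open_UNIV)
  qed auto
  then show ?thesis by (simp add: D_def)
qed

lemma Ck_affine:
  fixes F :: "'a::euclidean_space \<Rightarrow> 'b::real_normed_vector"
  assumes "Ck n UNIV F"
  shows "Ck n UNIV (\<lambda>x. F (z + s *\<^sub>R x))"
    and "F differentiable (at (z + s *\<^sub>R x)) \<Longrightarrow> dder v (\<lambda>x. F (z + s *\<^sub>R x)) x = s *\<^sub>R dder v F (z + s *\<^sub>R x)"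
proof -
  have d: "((\<lambda>x. F (z + s *\<^sub>R x)) has_derivative (\<lambda>v. s *\<^sub>R dder v F (z + s *\<^sub>R x))) (at x)"
    if "F differentiable (at (z + s *\<^sub>R x))" for x and F :: "'a \<Rightarrow> 'b"
  proof -
    have "((\<lambda>x. z + s *\<^sub>R x) has_derivative (\<lambda>v. s *\<^sub>R v)) (at x)"
      by (auto intro!: derivative_eq_intros)
    from diff_chain_at[OF this has_derivative_dder[OF that]]
    show ?thesis by (simp add: o_def dder_scaleR_dir[OF that])
  qed
  then show "F differentiable (at (z + s *\<^sub>R x)) \<Longrightarrow> dder v (\<lambda>x. F (z + s *\<^sub>R x)) x = s *\<^sub>R dder v F (z + s *\<^sub>R x)"
    by (rule dder_eqI)
  show "Ck n UNIV (\<lambda>x. F (z + s *\<^sub>R x))"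
    using assms
  proof (induction n arbitrary: F)
    case 0
    then show ?case
      by (auto intro!: continuous_on_compose2[of UNIV F UNIV "\<lambda>x. z + s *\<^sub>R x"] continuous_intros)
  next
    case (Suc n)
    have "dder v (\<lambda>x. F (z + s *\<^sub>R x)) = (\<lambda>x. s *\<^sub>R dder v F (z + s *\<^sub>R x))" for v
      by (rule ext, rule dder_eqI[OF d]) (use Suc.prems in simp)
    moreover have "Ck n UNIV (\<lambda>x. s *\<^sub>R dder v F (z + s *\<^sub>R x))" for v
      using Suc by (intro Ck_bounded_linear[OF open_UNIV bounded_linear_scaleR_right]) simp
    moreover have "(\<lambda>x. F (z + s *\<^sub>R x)) differentiable (at x)" for x
      by (rule differentiableI[OF d]) (use Suc.prems in simp)
    ultimately show ?case by simp
  qed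
qed

text \<open>Built from the inner product rather than the norm, this kernel is smooth at the origin,
  and its finite smoothness at the unit sphere is enough for class \<open>Ck 3\<close>. Its gradient
  is a multiple of \<open>x\<close> times the next lower power, which makes the dependence of the
  averages on the radius computable.\<close>

definition bump :: "nat \<Rightarrow> 'a::euclidean_space \<Rightarrow> real" where
  "bump p x = pospow p (1 - x \<bullet> x)"

lemma bump_nonneg [simp]: "0 \<le> bump p x"
  by (simp add: bump_def)

lemma bump_outside: "norm x > 1 \<Longrightarrow> bump (Suc p) x = 0"
proof -
  assume "norm x > 1"
  then have "x \<bullet> x > 1" by (simp add: dot_square_norm)
  then show ?thesis by (simp add: bump_def pospow_def)
qed

lemma Ck_bump: "n < p \<Longrightarrow> Ck n UNIV (bump p)"
  unfolding bump_def[abs_def] using Ck_pospow_kernel[of n p 1] by simp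

lemma dder_bump: "dder b (bump (Suc (Suc n))) x = - 2 * real (Suc (Suc n)) * (x \<bullet> b) * bump (Suc n) x"
proof -
  have d: "((\<lambda>x::'a. 1 - x \<bullet> x) has_derivative (\<lambda>v. - (2 * (x \<bullet> v)))) (at x)"
    by (auto intro!: derivative_eq_intros simp: inner_commute)
  then have "(\<lambda>x::'a. 1 - x \<bullet> x) differentiable (at x)" unfolding differentiable_def by blast
  from dder_real_comp[OF has_real_derivative_pospow this, of b n]
  show ?thesis unfolding bump_def[abs_def] dder_eqI[OF d] by (simp add: algebra_simps)
qed

lemma set_integral_restrict:
  fixes f :: "'a::euclidean_space \<Rightarrow> real"
  assumes "\<And>x. x \<notin> K \<Longrightarrow> f x = 0" "K \<subseteq> C"
  shows "(LINT x:C|lborel. f x) = (LINT x:K|lborel. f x)"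
  unfolding set_lebesgue_integral_def
  by (rule Bochner_Integration.integral_cong) (use assms in \<open>auto simp: indicator_def\<close>)

text \<open>Since \<open>\<nabla> bump 6 = - 12 x bump 5\<close>, the derivative in \<open>s\<close> is, after integration by parts, the
  Laplacian integrated against a multiple of \<open>bump 6\<close>.\<close>

lemma bump_mean_mono:
  fixes F :: "'a::euclidean_space \<Rightarrow> real"
  assumes C: "Ck 2 UNIV F" and s: "0 \<le> s1" "s1 \<le> s2"
    and Lap: "\<And>x. x \<in> cball z s2 \<Longrightarrow> 0 \<le> (\<Sum>b\<in>Basis. dder b (dder b F) x)"
  shows "(\<integral>x. F (z + s1 *\<^sub>R x) * bump 5 x \<partial>lborel) \<le> (\<integral>x. F (z + s2 *\<^sub>R x) * bump 5 x \<partial>lborel)"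
proof -
  let ?K = "cball (0::'a) 1" and ?C = "cbox (- One) (One::'a)"
  have d: "F differentiable (at x)" "dder v F differentiable (at x)" and c: "continuous_on UNIV (dder v F)" for x v
    using C Ck_imp_continuous[of 1 UNIV "dder v F"] by (auto simp: numeral_2_eq_2)
  have c0: "continuous_on UNIV F" by (rule Ck_imp_continuous[OF C])
  have cb: "continuous_on S (bump p :: 'a \<Rightarrow> real)" for S p
    unfolding bump_def[abs_def] by (intro continuous_intros)
  have b0: "bump 5 x = 0" "bump 6 x = 0" if "x \<notin> ?K" for x :: 'a
    using that bump_outside[of x 4] bump_outside[of x 5] by auto
  have KC: "?K \<subseteq> ?C"
    by (auto simp: mem_box dest: Basis_le_norm[THEN order_trans] abs_le_D1 abs_le_D2)
      (metis Basis_le_norm abs_le_iff order_trans neg_le_iff_le minus_le_iff)+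
  \<comment> \<open>The box \<open>?C\<close> stands in for the unit ball because differentiation
    under the integral takes place over boxes; \<open>bump 5\<close> vanishes on the
    difference.\<close>
  define G where "G s = integral ?C (\<lambda>x. F (z + s *\<^sub>R x) * bump 5 x)" for s
  have comp: "continuous_on UNIV (\<lambda>x. H (z + s *\<^sub>R x))" if "continuous_on UNIV H" for H :: "'a \<Rightarrow> real" and s
    by (rule continuous_on_compose2[OF that]) (auto intro!: continuous_intros)
  have G_eq: "(\<integral>x. F (z + s *\<^sub>R x) * bump 5 x \<partial>lborel) = G s" for s
  proof -
    have "(\<integral>x. F (z + s *\<^sub>R x) * bump 5 x \<partial>lborel) = (LINT x:UNIV|lborel. F (z + s *\<^sub>R x) * bump 5 x)"
      by (simp add: set_lebesgue_integral_def)
    also have "\<dots> = (LINT x:?K|lborel. F (z + s *\<^sub>R x) * bump 5 x)"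
      by (rule set_integral_restrict) (auto simp: b0 simp del: mem_cball)
    also have "\<dots> = (LINT x:?C|lborel. F (z + s *\<^sub>R x) * bump 5 x)"
      by (rule set_integral_restrict[symmetric, OF _ KC]) (auto simp: b0 simp del: mem_cball)
    also have "\<dots> = G s"
      unfolding G_def
      by (rule set_borel_integral_eq_integral, rule set_integrable_compact[of _ UNIV])
        (auto intro!: continuous_intros comp c0 cb)
    finally show ?thesis .
  qed
  have ex: "dder x F y = (\<Sum>b\<in>Basis. (x \<bullet> b) * dder b F y)" for x y
    using dder_sum_dir[OF d(1), of "\<lambda>b. x \<bullet> b" "\<lambda>b. b" Basis y] by (simp add: euclidean_representation)
  have der: "(G has_real_derivative integral ?C (\<lambda>x. dder x F (z + s *\<^sub>R x) * bump 5 x)) (at s)" for s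
  proof -
    have "((\<lambda>s. integral ?C (\<lambda>x. F (z + s *\<^sub>R x) * bump 5 x)) has_field_derivative
        integral ?C (\<lambda>x. dder x F (z + s *\<^sub>R x) * bump 5 x)) (at s within UNIV)"
    proof (rule leibniz_rule_field_derivative)
      show "((\<lambda>s. F (z + s *\<^sub>R x) * bump 5 x) has_field_derivative dder x F (z + s *\<^sub>R x) * bump 5 x) (at s within UNIV)" for s x
        using DERIV_cmult_right[OF has_real_derivative_dder_line[OF d(1)]] by simp
      show "(\<lambda>x. F (z + s *\<^sub>R x) * bump 5 x) integrable_on ?C" for s
        by (intro integrable_continuous continuous_intros cb continuous_on_subset[OF comp[OF c0]]) auto
      show "continuous_on (UNIV \<times> ?C) (\<lambda>(s, x). dder x F (z + s *\<^sub>R x) * bump 5 x)"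
      proof -
        have "(\<lambda>(s, x). dder x F (z + s *\<^sub>R x) * bump 5 x)
            = (\<lambda>p. (\<Sum>b\<in>Basis. (snd p \<bullet> b) * dder b F (z + fst p *\<^sub>R snd p)) * bump 5 (snd p))"
          by (rule ext) (simp only: split_beta, subst ex, rule refl)
        moreover have "continuous_on (UNIV \<times> ?C) (\<lambda>p. (\<Sum>b\<in>Basis. (snd p \<bullet> b) * dder b F (z + fst p *\<^sub>R snd p)) * bump 5 (snd p))"
          by (intro continuous_intros continuous_on_compose2[OF c] continuous_on_compose2[OF cb[of UNIV]]) auto
        ultimately show ?thesis by simp
      qed
    qed auto
    then show ?thesis unfolding G_def by simp
  qed
  have ex2: "(\<lambda>x. dder x F (z + s *\<^sub>R x) * bump 5 x)
      = (\<lambda>x. (\<Sum>b\<in>Basis. (x \<bullet> b) * dder b F (z + s *\<^sub>R x)) * bump 5 x)" for s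
    by (rule ext) (subst ex, rule refl)
  have nonneg: "0 \<le> integral ?C (\<lambda>x. dder x F (z + s *\<^sub>R x) * bump 5 x)" if "0 \<le> s" "s \<le> s2" for s
  proof -
    have i1: "set_integrable lborel ?K (\<lambda>x. dder b (bump 6) x * dder b F (z + s *\<^sub>R x))" for b
      using dder_bump[of b 4] by (intro set_integrable_compact[of _ UNIV] continuous_intros comp c) (auto intro!: continuous_intros cb)
    have i2: "set_integrable lborel ?K (\<lambda>x. bump 6 x * dder b (dder b F) (z + s *\<^sub>R x))" for b
      by (intro set_integrable_compact[of _ UNIV] continuous_intros comp cb) (use C in \<open>auto simp: numeral_2_eq_2\<close>)
    \<comment> \<open>The factor \<open>s\<close> comes from the chain rule, and there is no
      boundary term because \<open>bump 6\<close> vanishes outside the unit ball.\<close>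
    have ibp: "(LINT x:?K|lborel. dder b (bump 6) x * dder b F (z + s *\<^sub>R x))
        = - s * (LINT x:?K|lborel. bump 6 x * dder b (dder b F) (z + s *\<^sub>R x))" for b
    proof -
      have C1: "Ck 1 UNIV (\<lambda>x. dder b F (z + s *\<^sub>R x))"
        by (rule Ck_affine(1)) (use C in \<open>simp add: numeral_2_eq_2\<close>)
      have C6: "Ck 1 UNIV (bump 6 :: 'a \<Rightarrow> real)" by (rule Ck_bump) simp
      have p: "dder b (\<lambda>x. bump 6 x * dder b F (z + s *\<^sub>R x)) x
          = s * (bump 6 x * dder b (dder b F) (z + s *\<^sub>R x)) + dder b (bump 6) x * dder b F (z + s *\<^sub>R x)" for x
      proof -
        have "dder b (\<lambda>x. dder b F (z + s *\<^sub>R x)) x = s *\<^sub>R dder b (dder b F) (z + s *\<^sub>R x)"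
          by (rule Ck_affine(2)[of 1]) (use C in \<open>auto simp: numeral_2_eq_2\<close>)
        then show ?thesis using C1 C6 by (subst dder_mult) auto
      qed
      have "0 = (LINT x:?K|lborel. dder b (\<lambda>x. bump 6 x * dder b F (z + s *\<^sub>R x)) x)"
        by (rule integral_dder_eq_0[symmetric, of UNIV])
          (use Ck_mult[OF open_UNIV C6 C1] b0(2) in auto)
      also have "\<dots> = (LINT x:?K|lborel. s * (bump 6 x * dder b (dder b F) (z + s *\<^sub>R x)))
          + (LINT x:?K|lborel. dder b (bump 6) x * dder b F (z + s *\<^sub>R x))"
        unfolding p by (intro set_integral_add i1 set_integrable_mult_right i2)
      finally show ?thesis by simp
    qed
    have "integral ?C (\<lambda>x. dder x F (z + s *\<^sub>R x) * bump 5 x) = (LINT x:?C|lborel. dder x F (z + s *\<^sub>R x) * bump 5 x)"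
      unfolding ex2 by (rule set_borel_integral_eq_integral(2)[symmetric], rule set_integrable_compact[of _ UNIV])
        (auto intro!: continuous_intros comp c cb)
    also have "\<dots> = (LINT x:?K|lborel. dder x F (z + s *\<^sub>R x) * bump 5 x)"
      by (rule set_integral_restrict[OF _ KC]) (auto simp: b0 simp del: mem_cball)
    also have "\<dots> = (LINT x:?K|lborel. (\<Sum>b\<in>Basis. (- 1 / 12) * (dder b (bump 6) x * dder b F (z + s *\<^sub>R x))))"
    proof (rule set_lebesgue_integral_cong)
      show "\<forall>x. x \<in> ?K \<longrightarrow> dder x F (z + s *\<^sub>R x) * bump 5 x
          = (\<Sum>b\<in>Basis. (- 1 / 12) * (dder b (bump 6) x * dder b F (z + s *\<^sub>R x)))"
      proof (intro allI impI)
        fix x :: 'a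
        have b6: "dder b (bump 6) x = - 12 * (x \<bullet> b) * bump 5 x" for b
          using dder_bump[of b 4 x] by simp
        have "dder x F (z + s *\<^sub>R x) * bump 5 x = (\<Sum>b\<in>Basis. (x \<bullet> b) * dder b F (z + s *\<^sub>R x)) * bump 5 x"
          by (rule fun_cong[OF ex2])
        also have "\<dots> = (\<Sum>b\<in>Basis. (- 1 / 12) * (dder b (bump 6) x * dder b F (z + s *\<^sub>R x)))"
          unfolding b6 sum_distrib_right by (intro sum.cong refl) (simp add: mult_ac)
        finally show "dder x F (z + s *\<^sub>R x) * bump 5 x
          = (\<Sum>b\<in>Basis. (- 1 / 12) * (dder b (bump 6) x * dder b F (z + s *\<^sub>R x)))" .
      qed
    qed auto
    also have "\<dots> = (\<Sum>b\<in>Basis. (LINT x:?K|lborel. (- 1 / 12) * (dder b (bump 6) x * dder b F (z + s *\<^sub>R x))))"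
      unfolding set_lebesgue_integral_def scaleR_sum_right
      by (rule Bochner_Integration.integral_sum)
        (use set_integrable_mult_right[OF i1, of "- 1 / 12"] in \<open>simp add: set_integrable_def\<close>)
    also have "\<dots> = (\<Sum>b\<in>Basis. s / 12 * (LINT x:?K|lborel. bump 6 x * dder b (dder b F) (z + s *\<^sub>R x)))"
      unfolding set_integral_mult_right ibp by simp
    also have "\<dots> = s / 12 * (\<Sum>b\<in>Basis. (LINT x:?K|lborel. bump 6 x * dder b (dder b F) (z + s *\<^sub>R x)))"
      by (simp add: sum_distrib_left)
    also have "(\<Sum>b\<in>Basis. (LINT x:?K|lborel. bump 6 x * dder b (dder b F) (z + s *\<^sub>R x)))
        = (LINT x:?K|lborel. (\<Sum>b\<in>Basis. bump 6 x * dder b (dder b F) (z + s *\<^sub>R x)))"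
      unfolding set_lebesgue_integral_def scaleR_sum_right
      by (rule Bochner_Integration.integral_sum[symmetric]) (use i2 in \<open>simp add: set_integrable_def\<close>)
    finally have eq: "integral ?C (\<lambda>x. dder x F (z + s *\<^sub>R x) * bump 5 x)
        = s / 12 * (LINT x:?K|lborel. (\<Sum>b\<in>Basis. bump 6 x * dder b (dder b F) (z + s *\<^sub>R x)))" .
    have "0 \<le> (LINT x:?K|lborel. (\<Sum>b\<in>Basis. bump 6 x * dder b (dder b F) (z + s *\<^sub>R x)))"
      unfolding set_lebesgue_integral_def
    proof (rule Bochner_Integration.integral_nonneg)
      fix x :: 'a
      show "0 \<le> indicator ?K x *\<^sub>R (\<Sum>b\<in>Basis. bump 6 x * dder b (dder b F) (z + s *\<^sub>R x))"
      proof (cases "x \<in> ?K")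
        case True
        then have "s * norm x \<le> s2 * 1" using that by (intro mult_mono) auto
        then have "z + s *\<^sub>R x \<in> cball z s2" using that by (simp add: dist_norm)
        then show ?thesis using Lap True by (simp add: sum_distrib_left[symmetric])
      qed simp
    qed
    then show ?thesis unfolding eq using that by simp
  qed
  have "G s1 \<le> G s2"
  proof (rule DERIV_nonneg_imp_nondecreasing[OF s(2)])
    fix t assume "s1 \<le> t" "t \<le> s2"
    then show "\<exists>y. (G has_real_derivative y) (at t) \<and> 0 \<le> y"
      using der[of t] nonneg[of t] s by (intro exI conjI) auto
  qed
  then show ?thesis by (simp add: G_eq)
qed

lemma super_on_imp_psh_real:
  fixes f :: "complex^'n \<Rightarrow> real"
  assumes S: "super_on V (\<lambda>z. ennreal (M - f z))" and M: "0 \<le> M" "\<And>z. z \<in> V \<Longrightarrow> f z \<le> M"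
    and c: "continuous_on V f"
  shows "psh_on V (\<lambda>z. ereal (f z))"
  unfolding psh_on_def
proof (intro conjI allI impI ballI)
  show oV: "open V" using S by (simp add: super_on_def)
  show us: "usc_on V (\<lambda>z. ereal (f z))"
    unfolding usc_on_def
  proof (intro ballI allI impI)
    fix x and k :: ereal assume x: "x \<in> V" "ereal (f x) < k"
    have "((\<lambda>y. ereal (f y)) \<longlongrightarrow> ereal (f x)) (at x within V)"
      using c x by (auto simp: continuous_on_def intro!: tendsto_intros)
    then show "\<forall>\<^sub>F y in at x within V. ereal (f y) < k" using x(2) by (rule order_tendstoD)
  qed
  fix a b assume ab: "\<forall>\<zeta>. cmod \<zeta> \<le> 1 \<longrightarrow> a + \<zeta> *s b \<in> V"
  have circ: "a + cis t *s b \<in> V" for t using ab by simp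
  have a: "a \<in> V" using ab[rule_format, of 0] by simp
  have "(\<lambda>t. ereal (f (a + cis t *s b))) \<in> borel_measurable borel"
    by (rule usc_comp_measurable[OF us oV _ circ]) (intro continuous_intros)
  from circle_mean_ge_iff[OF this, of M "ereal (f a)"]
  show "ereal (f a) \<le> circle_mean (\<lambda>t. ereal (f (a + cis t *s b)))"
    using S ab M circ a unfolding super_on_def by simp
next
  fix C assume "C \<in> components V"
  then show "\<exists>x\<in>C. ereal (f x) \<noteq> - \<infinity>" using in_components_nonempty by fastforce
qed auto

section \<open>Mollification of bounded plurisubharmonic functions\<close>

definition bump_mass :: "'a::euclidean_space itself \<Rightarrow> real" where
  "bump_mass _ = (\<integral>x. bump 5 (x::'a) \<partial>lborel)"

lemma continuous_on_bump: "continuous_on S (bump p)"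
  unfolding bump_def[abs_def] by (intro continuous_intros)

lemma measurable_bump [measurable]: "bump p \<in> borel_measurable borel"
  by (intro borel_measurable_continuous_onI continuous_on_bump)

lemma bump5_outside: "norm x > 1 \<Longrightarrow> bump 5 x = 0"
  using bump_outside[of x 4] by simp

lemma integrable_bump: "integrable lborel (bump 5 :: 'a::euclidean_space \<Rightarrow> real)"
proof -
  have "integrable lborel (\<lambda>x::'a. indicator (cball 0 1) x *\<^sub>R bump 5 x)"
    by (rule borel_integrable_compact) (auto intro: continuous_on_bump)
  moreover have "(\<lambda>x::'a. indicator (cball 0 1) x *\<^sub>R bump 5 x) = bump 5"
    by (auto simp: fun_eq_iff indicator_def not_le intro: bump5_outside)
  ultimately show ?thesis by simp
qed

lemma bump_mass_pos: "0 < bump_mass TYPE('a::euclidean_space)"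
proof -
  let ?C = "cball (0::'a) (1/2)"
  have "0 < measure lborel ?C"
    by (simp add: measure_def emeasure_cball unit_ball_vol_pos)
  then have "0 < (3/4) ^ 5 * measure lborel ?C" by simp
  also have "\<dots> = (\<integral>x. (3/4) ^ 5 * indicator ?C x \<partial>lborel)" by simp
  also have "\<dots> \<le> bump_mass TYPE('a)"
    unfolding bump_mass_def
  proof (rule integral_mono)
    have "emeasure lborel ?C < \<infinity>" by (rule emeasure_lborel_cball_finite)
    then show "integrable lborel (\<lambda>x. (3/4) ^ 5 * indicator ?C x :: real)" by simp
    show "integrable lborel (bump 5 :: 'a \<Rightarrow> real)" by (rule integrable_bump)
    fix x :: 'a
    show "(3/4) ^ 5 * indicator ?C x \<le> bump 5 x"
    proof (cases "x \<in> ?C")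
      case True
      then have "norm x ^ 2 \<le> (1/2) ^ 2" by (intro power_mono) auto
      then have "3/4 \<le> 1 - x \<bullet> x" by (simp add: dot_square_norm power2_eq_square)
      then have "(3/4) ^ 5 \<le> bump 5 x" unfolding bump_def pospow_def by (intro power_mono) auto
      moreover have "(3/4) ^ 5 * indicator ?C x = ((3/4) ^ 5 :: real)" using True by simp
      ultimately show ?thesis by (simp only:)
    qed simp
  qed
  finally show ?thesis .
qed

text \<open>Scaling the argument of \<open>f\<close> instead of the kernel keeps one fixed weight
  for all radii, which suits limits and monotonicity in \<open>e\<close>; \<open>Ck_moll\<close>
  rewrites it as a convolution to obtain smoothness.\<close>

definition moll :: "('a::euclidean_space \<Rightarrow> real) \<Rightarrow> real \<Rightarrow> 'a \<Rightarrow> real" where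
  "moll f e z = (\<integral>x. f (z + e *\<^sub>R x) * bump 5 x \<partial>lborel) / bump_mass TYPE('a)"

lemma integral_lborel_affine:
  fixes F :: "'a::euclidean_space \<Rightarrow> real"
  assumes [measurable]: "F \<in> borel_measurable borel" and e: "e > 0"
  shows "integral\<^sup>L lborel F = e ^ DIM('a) * (\<integral>x. F (z + e *\<^sub>R x) \<partial>lborel)"
proof -
  have "integral\<^sup>L lborel F = integral\<^sup>L (density (distr lborel borel (\<lambda>x. z + e *\<^sub>R x)) (\<lambda>_. ennreal (\<bar>e\<bar> ^ DIM('a)))) F"
    using lborel_affine[of e z] e by simp
  also have "\<dots> = (\<integral>x. \<bar>e\<bar> ^ DIM('a) *\<^sub>R F x \<partial>distr lborel borel (\<lambda>x. z + e *\<^sub>R x))"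
    by (rule integral_density) auto
  also have "\<dots> = (\<integral>x. \<bar>e\<bar> ^ DIM('a) *\<^sub>R F (z + e *\<^sub>R x) \<partial>lborel)"
    by (rule integral_distr) auto
  finally show ?thesis using e by simp
qed

lemma compact_in_open_margin:
  fixes K :: "'a::heine_borel set"
  assumes "compact K" "open W" "K \<subseteq> W"
  obtains r where "r > 0" "\<And>x y. x \<in> K \<Longrightarrow> dist x y < r \<Longrightarrow> y \<in> W"
proof -
  obtain r where "r > 0" "(\<Union>x\<in>K. ball x r) \<subseteq> W"
    using compact_subset_open_imp_ball_epsilon_subset[OF assms] by blast
  then show thesis using that[of r] by (auto simp: subset_iff)
qed

text \<open>Pairing the two real basis vectors of each coordinate turns the real Laplacian into a
  sum of Levi forms.\<close>

lemma Basis_complex_vec_sum: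
  "(\<Sum>b\<in>(Basis :: (complex^'n) set). F b) = (\<Sum>j\<in>UNIV. F (axis j 1) + F (axis j \<i>))"
proof -
  have "(\<Sum>b\<in>(Basis :: (complex^'n) set). F b) = (\<Sum>j\<in>UNIV. \<Sum>u\<in>{1, \<i>}. F (axis j u))"
  proof -
    have inj: "inj_on (\<lambda>(j, u). axis j u :: complex^'n) (UNIV \<times> {1, \<i>})"
      by (auto simp: inj_on_def axis_eq_axis)
    have "(Basis :: (complex^'n) set) = (\<lambda>(j, u). axis j u) ` (UNIV \<times> {1, \<i>})"
      by (auto simp: Basis_vec_def Basis_complex_def)
    then have "(\<Sum>b\<in>(Basis :: (complex^'n) set). F b) = sum F ((\<lambda>(j, u). axis j u) ` (UNIV \<times> {1, \<i>}))"
      by (simp only:)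
    then show ?thesis unfolding sum.reindex[OF inj] sum.cartesian_product by (simp add: o_def split_beta)
  qed
  also have "\<dots> = (\<Sum>j\<in>UNIV. F (axis j 1) + F (axis j \<i>))" by (simp add: complex_eq_iff)
  finally show ?thesis .
qed

text \<open>\<open>f\<close> is extended by zero so that its mollification is defined everywhere;
  conclusions from plurisubharmonicity are drawn only where the averaging ball lies in
  \<open>\<Omega>\<close>.\<close>

locale bounded_psh =
  fixes \<Omega> :: "(complex^'n::finite) set" and f :: "complex^'n \<Rightarrow> real" and B :: real
  assumes opn: "open \<Omega>" and bdd: "bounded \<Omega>" and psh: "psh_on \<Omega> (\<lambda>z. ereal (f z))"
    and bnd: "\<And>z. \<bar>f z\<bar> \<le> B" and zero: "\<And>z. z \<notin> \<Omega> \<Longrightarrow> f z = 0"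
begin

lemma B_nonneg: "0 \<le> B"
  using bnd[of 0] by simp

abbreviation h :: "complex^'n \<Rightarrow> ennreal" where "h z \<equiv> ennreal (B - f z)"

lemma super_h: "super_on \<Omega> h"
proof -
  have "super_on \<Omega> (\<lambda>z. e2ennreal (ereal B - ereal (f z)))"
    by (rule psh_imp_super_on[OF psh opn subset_refl B_nonneg]) (use bnd in \<open>auto simp: abs_le_iff\<close>)
  then show ?thesis by simp
qed

lemma f_measurable [measurable]: "f \<in> borel_measurable borel"
proof -
  have [measurable]: "(\<lambda>x. if x \<in> \<Omega> then h x else 0) \<in> borel_measurable borel"
    by (rule super_on_measurable[OF super_h])
  have [measurable]: "\<Omega> \<in> sets borel" using opn by simp
  have "f = (\<lambda>x. if x \<in> \<Omega> then B - enn2real (if x \<in> \<Omega> then h x else 0) else 0)"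
    using zero bnd by (auto simp: fun_eq_iff abs_le_iff)
  moreover have "(\<lambda>x. if x \<in> \<Omega> then B - enn2real (if x \<in> \<Omega> then h x else 0) else 0) \<in> borel_measurable borel"
    by measurable
  ultimately show ?thesis by simp
qed

lemma f_integrable: "integrable lborel f"
proof (rule Bochner_Integration.integrable_bound[of _ "\<lambda>x. B * indicator \<Omega> x"])
  have "emeasure lborel \<Omega> < \<infinity>" by (rule emeasure_bounded_finite[OF bdd])
  then show "integrable lborel (\<lambda>x. B * indicator \<Omega> x :: real)" using opn by simp
  show "AE x in lborel. norm (f x) \<le> norm (B * indicator \<Omega> x :: real)"
    using bnd zero B_nonneg by (auto simp: indicator_def)
qed simp

lemma integrable_f_bump: "integrable lborel (\<lambda>x. f (z + e *\<^sub>R x) * bump 5 x)"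
proof (rule Bochner_Integration.integrable_bound[of _ "\<lambda>x. B * bump 5 (x::complex^'n)"])
  show "integrable lborel (\<lambda>x. B * bump 5 (x::complex^'n))" by (simp add: integrable_bump)
  show "AE x in lborel. norm (f (z + e *\<^sub>R x) * bump 5 x) \<le> norm (B * bump 5 x)"
    using bnd B_nonneg by (auto simp: abs_mult intro!: mult_right_mono)
qed simp

lemma moll_bound: "\<bar>moll f e z\<bar> \<le> B"
proof -
  have "\<bar>\<integral>x. f (z + e *\<^sub>R x) * bump 5 x \<partial>lborel\<bar> \<le> (\<integral>x. B * bump 5 (x::complex^'n) \<partial>lborel)"
    using bnd B_nonneg
    by (intro integral_abs_bound_integral integrable_f_bump) (auto simp: integrable_bump abs_mult intro!: mult_right_mono)
  also have "\<dots> = B * bump_mass TYPE(complex^'n)" by (simp add: bump_mass_def)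
  finally show ?thesis using bump_mass_pos[where 'a = "complex^'n"] by (simp add: moll_def field_simps)
qed

lemma Ck_moll:
  assumes e: "e > 0"
  shows "Ck 3 UNIV (moll f e)"
proof -
  \<comment> \<open>The substitution y = z + e x turns \<open>moll f e\<close> into a convolution
    with this kernel; the power of \<open>e\<close> in the divisor is the Jacobian.\<close>
  define k where "k x = pospow 5 (1 - (1 / e\<^sup>2) * (x \<bullet> x)) / (bump_mass TYPE(complex^'n) * e ^ DIM(complex^'n))" for x :: "complex^'n"
  have "Ck 3 UNIV k"
    unfolding k_def[abs_def]
    by (rule Ck_bounded_linear[OF open_UNIV bounded_linear_divide]) (rule Ck_pospow_kernel, simp)
  moreover have "k x = 0" if "norm x > e" for x
  proof -
    have "(norm x)\<^sup>2 > e\<^sup>2" using that e by (intro power_strict_mono) auto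
    then have "(1 / e\<^sup>2) * (x \<bullet> x) > 1" using e by (simp add: dot_square_norm)
    then show ?thesis by (simp add: k_def pospow_def)
  qed
  ultimately have "Ck 3 UNIV (\<lambda>z. \<integral>y. f y * k (y - z) \<partial>lborel)"
    by (intro Ck_conv[OF f_integrable, of 3 k e])
  moreover have "(\<integral>y. f y * k (y - z) \<partial>lborel) = moll f e z" for z
  proof -
    have [measurable]: "k \<in> borel_measurable borel"
      unfolding k_def[abs_def] by (intro borel_measurable_continuous_onI continuous_intros) (use e bump_mass_pos[where 'a = "complex^'n"] in auto)
    have 1: "(\<integral>y. f y * k (y - z) \<partial>lborel) = e ^ DIM(complex^'n) * (\<integral>x. f (z + e *\<^sub>R x) * k (z + e *\<^sub>R x - z) \<partial>lborel)"
      by (rule integral_lborel_affine[OF _ e]) measurable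
    have "(\<lambda>x. k (z + e *\<^sub>R x - z)) = (\<lambda>x. bump 5 x / (bump_mass TYPE(complex^'n) * e ^ DIM(complex^'n)))"
      using e by (simp add: k_def bump_def power2_eq_square fun_eq_iff)
    then have 2: "(\<integral>x. f (z + e *\<^sub>R x) * k (z + e *\<^sub>R x - z) \<partial>lborel)
        = (\<integral>x. f (z + e *\<^sub>R x) * bump 5 x / (bump_mass TYPE(complex^'n) * e ^ DIM(complex^'n)) \<partial>lborel)"
      by (simp add: fun_eq_iff)
    show ?thesis unfolding 1 2 using e by (simp add: moll_def)
  qed
  ultimately show ?thesis by (simp add: fun_eq_iff[of "moll f e", symmetric])
qed

definition kn :: "complex^'n \<Rightarrow> ennreal" where
  "kn x = ennreal (bump 5 x / bump_mass TYPE(complex^'n))"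

lemma kn_measurable [measurable]: "kn \<in> borel_measurable borel"
  unfolding kn_def[abs_def] by measurable

lemma kn_outside: "kn x \<noteq> 0 \<Longrightarrow> norm x \<le> 1"
  using bump5_outside[of x] by (cases "norm x \<le> 1") (auto simp: kn_def)

lemma kn_rotate: "kn (cis t *s x) = kn x"
  by (simp add: kn_def bump_def dot_square_norm norm_cis_smult)

lemma nn_integral_kn: "(\<integral>\<^sup>+x. kn x \<partial>lborel) = 1"
proof -
  have "(\<integral>\<^sup>+x. kn x \<partial>lborel) = ennreal (\<integral>x. bump 5 (x::complex^'n) / bump_mass TYPE(complex^'n) \<partial>lborel)"
    unfolding kn_def using bump_mass_pos[where 'a = "complex^'n"]
    by (intro nn_integral_eq_integral) (auto simp: integrable_bump)
  also have "(\<integral>x. bump 5 (x::complex^'n) / bump_mass TYPE(complex^'n) \<partial>lborel) = 1"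
    using bump_mass_pos[where 'a = "complex^'n"] by (simp add: bump_mass_def)
  finally show ?thesis by simp
qed

text \<open>Subtracting from the bound \<open>B\<close> moves the mollification into nonnegative
  integrals, where the order of integration can be exchanged and \<open>super_on_mean\<close>
  applies with the rotation invariant weight \<open>kn\<close>.\<close>

lemma ennreal_moll: "ennreal (B - moll f e z) = (\<integral>\<^sup>+x. kn x * h (z + e *\<^sub>R x) \<partial>lborel)"
proof -
  have J: "0 < bump_mass TYPE(complex^'n)" by (rule bump_mass_pos)
  have B1: "integrable lborel (\<lambda>x::complex^'n. B * bump 5 x / bump_mass TYPE(complex^'n))" by (simp add: integrable_bump)
  have f1: "integrable lborel (\<lambda>x. f (z + e *\<^sub>R x) * bump 5 x / bump_mass TYPE(complex^'n))" using integrable_f_bump by simp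
  have "B - moll f e z = (\<integral>x. B * bump 5 (x::complex^'n) / bump_mass TYPE(complex^'n) \<partial>lborel) - (\<integral>x. f (z + e *\<^sub>R x) * bump 5 x / bump_mass TYPE(complex^'n) \<partial>lborel)"
    using J by (simp add: moll_def bump_mass_def)
  also have "\<dots> = (\<integral>x. B * bump 5 x / bump_mass TYPE(complex^'n) - f (z + e *\<^sub>R x) * bump 5 x / bump_mass TYPE(complex^'n) \<partial>lborel)"
    by (rule Bochner_Integration.integral_diff[OF B1 f1, symmetric])
  also have "ennreal \<dots> = (\<integral>\<^sup>+x. ennreal (B * bump 5 x / bump_mass TYPE(complex^'n) - f (z + e *\<^sub>R x) * bump 5 x / bump_mass TYPE(complex^'n)) \<partial>lborel)"
  proof (rule nn_integral_eq_integral[symmetric])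
    show "integrable lborel (\<lambda>x. B * bump 5 x / bump_mass TYPE(complex^'n) - f (z + e *\<^sub>R x) * bump 5 x / bump_mass TYPE(complex^'n))" using B1 f1 by simp
    have "f y * bump 5 x \<le> B * bump 5 x" for x y :: "complex^'n"
      using bnd[of y] by (intro mult_right_mono) auto
    then show "AE x in lborel. 0 \<le> B * bump 5 x / bump_mass TYPE(complex^'n) - f (z + e *\<^sub>R x) * bump 5 x / bump_mass TYPE(complex^'n)"
      using J by (auto simp: diff_divide_distrib[symmetric])
  qed
  also have "\<dots> = (\<integral>\<^sup>+x. kn x * h (z + e *\<^sub>R x) \<partial>lborel)"
  proof (rule nn_integral_cong)
    fix x :: "complex^'n"
    have "B * bump 5 x / bump_mass TYPE(complex^'n) - f (z + e *\<^sub>R x) * bump 5 x / bump_mass TYPE(complex^'n) = bump 5 x / bump_mass TYPE(complex^'n) * (B - f (z + e *\<^sub>R x))"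
      using J by (simp add: field_simps)
    moreover have "0 \<le> B - f (z + e *\<^sub>R x)" using bnd[of "z + e *\<^sub>R x"] by simp
    ultimately show "ennreal (B * bump 5 x / bump_mass TYPE(complex^'n) - f (z + e *\<^sub>R x) * bump 5 x / bump_mass TYPE(complex^'n)) = kn x * h (z + e *\<^sub>R x)"
      using J by (simp only: kn_def) (subst ennreal_mult[symmetric], auto)
  qed
  finally show ?thesis .
qed

text \<open>\<open>B - moll f e\<close> is a weighted average of translates of \<open>h\<close> by
  \<open>e\<close> times vectors of norm at most 1. Each translate satisfies the circle inequality
  because the translated disc stays in \<open>\<Omega>\<close>.\<close>

lemma super_moll:
  assumes V: "open V" "\<And>z. z \<in> V \<Longrightarrow> cball z e \<subseteq> \<Omega>" and e: "e > 0"
  shows "super_on V (\<lambda>z. ennreal (B - moll f e z))"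
  unfolding super_on_def
proof (intro conjI allI impI V(1))
  fix c :: ennreal
  have cont: "continuous_on UNIV (\<lambda>z. ennreal (B - moll f e z))"
    by (intro continuous_intros continuous_on_ennreal Ck_imp_continuous[OF Ck_moll[OF e]])
  have "{x\<in>V. c < ennreal (B - moll f e x)} = V \<inter> (\<lambda>z. ennreal (B - moll f e z)) -` {c<..}" by auto
  then show "open {x\<in>V. c < ennreal (B - moll f e x)}"
    using V(1) open_vimage[OF _ cont, of "{c<..}"] by (simp add: open_Int)
next
  fix a b assume ab: "\<forall>\<zeta>. cmod \<zeta> \<le> 1 \<longrightarrow> a + \<zeta> *s b \<in> V"
  have "(\<integral>\<^sup>+t. ennreal (B - moll f e (a + cis t *s b)) * indicator {0..2*pi} t \<partial>lborel)
     = (\<integral>\<^sup>+t. (\<integral>\<^sup>+x. kn x * h (a + cis t *s b + e *\<^sub>R x) * indicator {0..2*pi} t \<partial>lborel) \<partial>lborel)"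
    unfolding ennreal_moll by (subst nn_integral_multc) auto
  also have "\<dots> = (\<integral>\<^sup>+x. (\<integral>\<^sup>+t. kn x * h (a + cis t *s b + e *\<^sub>R x) * indicator {0..2*pi} t \<partial>lborel) \<partial>lborel)"
    by (rule lborel_pair.Fubini') measurable
  also have "\<dots> \<le> (\<integral>\<^sup>+x. ennreal (2*pi) * (kn x * h (a + e *\<^sub>R x)) \<partial>lborel)"
  proof (rule nn_integral_mono)
    fix x :: "complex^'n"
    show "(\<integral>\<^sup>+t. kn x * h (a + cis t *s b + e *\<^sub>R x) * indicator {0..2*pi} t \<partial>lborel)
        \<le> ennreal (2*pi) * (kn x * h (a + e *\<^sub>R x))"
    proof (cases "kn x = 0")
      case False
      have in\<Omega>: "(a + e *\<^sub>R x) + \<zeta> *s b \<in> \<Omega>" if "cmod \<zeta> \<le> 1" for \<zeta>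
      proof -
        have "(a + e *\<^sub>R x) + \<zeta> *s b \<in> cball (a + \<zeta> *s b) e"
          using kn_outside[OF False] e by (simp add: dist_norm mult_left_le)
        then show ?thesis using V(2) ab that by blast
      qed
      have "(\<integral>\<^sup>+t. kn x * h (a + cis t *s b + e *\<^sub>R x) * indicator {0..2*pi} t \<partial>lborel)
          = (\<integral>\<^sup>+t. kn x * (h ((a + e *\<^sub>R x) + cis t *s b) * indicator {0..2*pi} t) \<partial>lborel)"
        by (intro nn_integral_cong) (simp add: mult.assoc add_ac)
      also have "\<dots> = kn x * (\<integral>\<^sup>+t. h ((a + e *\<^sub>R x) + cis t *s b) * indicator {0..2*pi} t \<partial>lborel)"
        by (rule nn_integral_cmult) measurable
      also have "\<dots> \<le> kn x * (ennreal (2*pi) * h (a + e *\<^sub>R x))"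
        using super_h in\<Omega> unfolding super_on_def by (intro mult_left_mono) auto
      finally show ?thesis by (simp add: mult_ac)
    qed simp
  qed
  also have "\<dots> = ennreal (2*pi) * ennreal (B - moll f e a)"
    unfolding ennreal_moll by (rule nn_integral_cmult) measurable
  finally show "(\<integral>\<^sup>+t. ennreal (B - moll f e (a + cis t *s b)) * indicator {0..2*pi} t \<partial>lborel)
      \<le> ennreal (2*pi) * ennreal (B - moll f e a)" .
qed

lemma moll_ge:
  assumes e: "e > 0" and z: "cball z e \<subseteq> \<Omega>"
  shows "f z \<le> moll f e z"
proof -
  have "(\<integral>\<^sup>+x. kn x * h (z + e *\<^sub>R x) \<partial>lborel) \<le> h z * (\<integral>\<^sup>+x. kn x \<partial>lborel)"
  proof (rule super_on_mean[OF super_h kn_measurable kn_rotate])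
    show "cball z (e * norm x) \<subseteq> \<Omega>" if "kn x \<noteq> 0" for x
      using kn_outside[OF that] e by (intro order_trans[OF _ z] subset_cball) (simp add: mult_left_le)
  qed (use e in simp)
  then have "ennreal (B - moll f e z) \<le> ennreal (B - f z)" by (simp add: ennreal_moll nn_integral_kn)
  then show ?thesis using bnd[of z] by (subst (asm) ennreal_le_iff) auto
qed

text \<open>The lower bound is \<open>moll_ge\<close>; the upper bound is upper semicontinuity,
  since for small radii the average sees only values below \<open>b\<close>.\<close>

lemma moll_tendsto:
  assumes z: "z \<in> \<Omega>" and E: "E \<longlonglongrightarrow> 0" "\<And>n. E n > 0"
  shows "(\<lambda>n. moll f (E n) z) \<longlonglongrightarrow> f z"
proof (rule order_tendstoI)
  obtain r where r: "r > 0" "cball z r \<subseteq> \<Omega>" using opn z open_contains_cball by blast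
  have evr: "\<forall>\<^sub>F n in sequentially. E n < d" if "d > 0" for d using E(1) that by (rule order_tendstoD)
  fix a assume a: "a < f z"
  show "\<forall>\<^sub>F n in sequentially. a < moll f (E n) z"
    using evr[OF r(1)]
  proof eventually_elim
    case (elim n)
    have "cball z (E n) \<subseteq> \<Omega>" using elim r(2) by (meson less_imp_le order_trans subset_cball)
    then show ?case using moll_ge[OF E(2)[of n]] a by force
  qed
next
  have evr: "\<forall>\<^sub>F n in sequentially. E n < d" if "d > 0" for d using E(1) that by (rule order_tendstoD)
  fix a assume a: "f z < a"
  define b where "b = (f z + a) / 2"
  have b: "f z < b" "b < a" using a by (auto simp: b_def)
  have "open {x\<in>\<Omega>. ereal (f x) < ereal b}"
    by (rule usc_on_open[OF _ opn]) (use psh in \<open>simp add: psh_on_def\<close>)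
  then obtain d where d: "d > 0" "ball z d \<subseteq> {x\<in>\<Omega>. ereal (f x) < ereal b}"
    using z b open_contains_ball[of "{x\<in>\<Omega>. ereal (f x) < ereal b}"] by auto
  show "\<forall>\<^sub>F n in sequentially. moll f (E n) z < a"
    using evr[OF d(1)]
  proof eventually_elim
    case (elim n)
    have J: "0 < bump_mass TYPE(complex^'n)" by (rule bump_mass_pos)
    have "(\<integral>x. f (z + E n *\<^sub>R x) * bump 5 x \<partial>lborel) \<le> (\<integral>x. b * bump 5 (x::complex^'n) \<partial>lborel)"
    proof (rule integral_mono[OF integrable_f_bump])
      fix x :: "complex^'n"
      show "f (z + E n *\<^sub>R x) * bump 5 x \<le> b * bump 5 x"
      proof (cases "norm x \<le> 1")
        case True
        then have "E n * norm x < d" using elim E(2)[of n] mult_left_le[of "norm x" "E n"] by linarith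
        then have "z + E n *\<^sub>R x \<in> ball z d" using E(2)[of n] by (simp add: dist_norm)
        then show ?thesis using d(2) by (intro mult_right_mono) auto
      next
        case False
        then show ?thesis using bump5_outside[of x] by simp
      qed
    qed (simp add: integrable_bump)
    also have "\<dots> = b * bump_mass TYPE(complex^'n)" by (simp add: bump_mass_def)
    finally have "moll f (E n) z \<le> b" using J by (simp add: moll_def field_simps)
    then show ?case using b by simp
  qed
qed

lemma levi_moll:
  assumes V: "open V" "\<And>z. z \<in> V \<Longrightarrow> cball z e \<subseteq> \<Omega>" and e: "e > 0" and z: "z \<in> V"
  shows "0 \<le> dder b (dder b (moll f e)) z + dder (\<i> *s b) (dder (\<i> *s b) (moll f e)) z"
proof (rule levi_nonneg[OF V(1) z _ super_moll[OF V e]])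
  show "Ck 2 V (moll f e)"
    by (rule Ck_subset[OF Ck_mono[OF Ck_moll[OF e], of 2]]) auto
  show "moll f e z \<le> B" for z using moll_bound[of e z] by simp
qed

text \<open>\<open>bump_mean_mono\<close> asks for second derivatives, so it is applied to the
  mollifications \<open>moll f (\<delta> n)\<close>; dominated convergence then carries the
  inequality over to \<open>f\<close>.\<close>

lemma moll_mono:
  assumes e: "0 < e1" "e1 \<le> e2" and z: "cball z e2 \<subseteq> \<Omega>"
  shows "moll f e1 z \<le> moll f e2 z"
proof -
  obtain r where r: "r > 0" "\<And>x y. x \<in> cball z e2 \<Longrightarrow> dist x y < r \<Longrightarrow> y \<in> \<Omega>"
    using compact_in_open_margin[OF compact_cball opn z] by blast
  \<comment> \<open>\<open>V\<close> uses half of the margin \<open>r\<close>; the other half leaves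
    room for the radii \<open>\<delta> n\<close>.\<close>
  define V where "V = (\<Union>x\<in>cball z e2. ball x (r / 2))"
  define \<delta> where "\<delta> n = r / 4 * (1 / real (Suc n))" for n
  have \<delta>: "\<delta> n > 0" "\<delta> n < r / 2" for n
  proof -
    have "r / 4 * (1 / real (Suc n)) \<le> r / 4" using r(1) by (intro mult_left_le) auto
    also have "r / 4 < r / 2" using r(1) by simp
    finally show "\<delta> n < r / 2" unfolding \<delta>_def .
    show "\<delta> n > 0" using r(1) by (auto simp: \<delta>_def)
  qed
  have \<delta>0: "\<delta> \<longlonglongrightarrow> 0"
  proof -
    have "(\<lambda>n. r / 4 * (1 / real (Suc n))) \<longlonglongrightarrow> r / 4 * 0"
      by (intro tendsto_intros LIMSEQ_Suc lim_1_over_n)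
    then show ?thesis by (simp add: \<delta>_def[abs_def])
  qed
  have oV: "open V" by (auto simp: V_def)
  have VO: "cball y (\<delta> n) \<subseteq> \<Omega>" if y: "y \<in> V" for y n
  proof
    fix w assume w: "w \<in> cball y (\<delta> n)"
    obtain x where x: "x \<in> cball z e2" "dist x y < r / 2" using y by (auto simp: V_def)
    have "dist x w \<le> dist x y + dist y w" by (rule dist_triangle)
    then have "dist x w < r" using x w \<delta>(2)[of n] by simp
    then show "w \<in> \<Omega>" using r(2) x by blast
  qed
  have sub: "cball z e2 \<subseteq> V" using r(1) by (force simp: V_def)
  have Lap: "0 \<le> (\<Sum>b\<in>Basis. dder b (dder b (moll f (\<delta> n))) x)" if "x \<in> cball z e2" for x n
  proof -
    have ax: "\<i> *s axis j 1 = axis j \<i>" for j :: 'n by (simp add: vec_eq_iff axis_def)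
    have "0 \<le> dder (axis j 1) (dder (axis j 1) (moll f (\<delta> n))) x + dder (axis j \<i>) (dder (axis j \<i>) (moll f (\<delta> n))) x" for j
      using levi_moll[where z = x and b = "axis j 1", OF oV VO[where n = n] \<delta>(1)[of n]] sub that by (auto simp: ax)
    then show ?thesis unfolding Basis_complex_vec_sum by (intro sum_nonneg)
  qed
  have m: "(\<integral>x. moll f (\<delta> n) (z + e1 *\<^sub>R x) * bump 5 x \<partial>lborel) \<le> (\<integral>x. moll f (\<delta> n) (z + e2 *\<^sub>R x) * bump 5 x \<partial>lborel)" for n
    by (rule bump_mean_mono[OF Ck_mono[OF Ck_moll[OF \<delta>(1)]] _ e(2) Lap]) (use e in auto)
  have lim: "(\<lambda>n. \<integral>x. moll f (\<delta> n) (z + s *\<^sub>R x) * bump 5 x \<partial>lborel) \<longlonglongrightarrow> (\<integral>x. f (z + s *\<^sub>R x) * bump 5 x \<partial>lborel)"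
    if s: "0 < s" "s \<le> e2" for s
  proof (rule integral_dominated_convergence[where w = "\<lambda>x. B * bump 5 x"])
    show "(\<lambda>x. moll f (\<delta> n) (z + s *\<^sub>R x) * bump 5 x) \<in> borel_measurable lborel" for n
    proof -
      have [measurable]: "moll f (\<delta> n) \<in> borel_measurable borel"
        by (rule borel_measurable_continuous_onI[OF Ck_imp_continuous[OF Ck_moll[OF \<delta>(1)]]])
      show ?thesis by measurable
    qed
    show "integrable lborel (\<lambda>x::complex^'n. B * bump 5 x)" by (simp add: integrable_bump)
    show "AE x in lborel. (\<lambda>n. moll f (\<delta> n) (z + s *\<^sub>R x) * bump 5 x) \<longlonglongrightarrow> f (z + s *\<^sub>R x) * bump 5 x"
    proof (rule AE_I2)
      fix x :: "complex^'n"
      show "(\<lambda>n. moll f (\<delta> n) (z + s *\<^sub>R x) * bump 5 x) \<longlonglongrightarrow> f (z + s *\<^sub>R x) * bump 5 x"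
      proof (cases "norm x \<le> 1")
        case True
        then have "s * norm x \<le> e2 * 1" using s by (intro mult_mono) auto
        then have "z + s *\<^sub>R x \<in> \<Omega>" using z s by (auto simp: dist_norm intro!: subsetD[OF z])
        then show ?thesis by (intro tendsto_intros moll_tendsto \<delta>0 \<delta>(1))
      next
        case False
        then show ?thesis using bump5_outside[of x] by simp
      qed
    qed
    show "AE x in lborel. norm (moll f (\<delta> n) (z + s *\<^sub>R x) * bump 5 x) \<le> B * bump 5 x" for n
      using moll_bound by (auto simp: abs_mult intro!: mult_right_mono)
  qed simp
  have "(\<integral>x. f (z + e1 *\<^sub>R x) * bump 5 x \<partial>lborel) \<le> (\<integral>x. f (z + e2 *\<^sub>R x) * bump 5 x \<partial>lborel)"
    by (rule LIMSEQ_le[OF lim lim]) (use e m in auto)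
  then show ?thesis using bump_mass_pos[where 'a = "complex^'n"] by (simp add: moll_def divide_right_mono)
qed

text \<open>\<open>U\<close> keeps a fixed distance from the complement of \<open>\<Omega>\<close>,
  so one sequence of radii works at all its points, and shrinking radii make the mollifications
  decrease.\<close>

lemma regularization:
  assumes K: "compact K" "K \<subseteq> \<Omega>"
  obtains U \<psi> where "open U" "K \<subseteq> U" "compact (closure U)" "closure U \<subseteq> \<Omega>"
    "\<And>j::nat. Ck 3 UNIV (\<psi> j)" "\<And>j. psh_on U (\<lambda>z. ereal (\<psi> j z))"
    "\<And>j z. z \<in> U \<Longrightarrow> psd (chess (cr (\<psi> j)) z)"
    "\<And>j z. z \<in> U \<Longrightarrow> \<psi> (Suc j) z \<le> \<psi> j z" "\<And>z. z \<in> U \<Longrightarrow> (\<lambda>j. \<psi> j z) \<longlonglongrightarrow> f z"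
    "\<And>j z. \<bar>\<psi> j z\<bar> \<le> B" "\<And>j z. z \<in> U \<Longrightarrow> f z \<le> \<psi> j z"
proof -
  obtain r where r: "r > 0" "\<And>x y. x \<in> K \<Longrightarrow> dist x y < r \<Longrightarrow> y \<in> \<Omega>"
    using compact_in_open_margin[OF K(1) opn K(2)] by blast
  define U where "U = (\<Union>x\<in>K. ball x (r / 2))"
  define E where "E n = r / 4 * (1 / real (Suc n))" for n
  have E: "E n > 0" "E n < r / 2" "E (Suc n) \<le> E n" for n
  proof -
    have "r / 4 * (1 / real (Suc n)) \<le> r / 4" using r(1) by (intro mult_left_le) auto
    also have "r / 4 < r / 2" using r(1) by simp
    finally show "E n < r / 2" unfolding E_def .
    show "E n > 0" using r(1) by (auto simp: E_def)
    show "E (Suc n) \<le> E n" unfolding E_def using r(1) by (intro mult_left_mono divide_left_mono) auto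
  qed
  have E0: "E \<longlonglongrightarrow> 0"
  proof -
    have "(\<lambda>n. r / 4 * (1 / real (Suc n))) \<longlonglongrightarrow> r / 4 * 0"
      by (intro tendsto_intros LIMSEQ_Suc lim_1_over_n)
    then show ?thesis by (simp add: E_def[abs_def])
  qed
  have oU: "open U" by (auto simp: U_def)
  have UO: "cball y (E n) \<subseteq> \<Omega>" if y: "y \<in> U" for y n
  proof
    fix w assume w: "w \<in> cball y (E n)"
    obtain x where x: "x \<in> K" "dist x y < r / 2" using y by (auto simp: U_def)
    have "dist x w \<le> dist x y + dist y w" by (rule dist_triangle)
    then have "dist x w < r" using x w E(2)[of n] by simp
    then show "w \<in> \<Omega>" using r(2) x by blast
  qed
  have clU: "closure U \<subseteq> \<Omega>"
  proof
    fix y assume "y \<in> closure U"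
    then obtain w where w: "w \<in> U" "dist w y < r / 2"
      using r(1) closure_approachable[of y U] by (metis half_gt_zero)
    obtain x where x: "x \<in> K" "dist x w < r / 2" using w by (auto simp: U_def)
    have "dist x y \<le> dist x w + dist w y" by (rule dist_triangle)
    then have "dist x y < r" using x w by simp
    then show "y \<in> \<Omega>" using r(2) x by blast
  qed
  have in\<Omega>: "z \<in> \<Omega>" if "z \<in> U" for z using that clU closure_subset by blast
  show thesis
  proof (rule that[of U "\<lambda>n. moll f (E n)"])
    show "K \<subseteq> U" using r(1) by (force simp: U_def)
    show "compact (closure U)"
      using clU bdd by (simp add: compact_eq_bounded_closed bounded_subset)
    show "psh_on U (\<lambda>z. ereal (moll f (E j) z))" for j
      by (rule super_on_imp_psh_real[OF super_moll[OF oU UO E(1)] B_nonneg])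
        (use moll_bound Ck_imp_continuous[OF Ck_moll[OF E(1)]] in \<open>auto simp: abs_le_iff intro: continuous_on_subset\<close>)
    show "psd (chess (cr (moll f (E j))) z)" if "z \<in> U" for j z
      by (rule psd_chess[OF oU that]) (use levi_moll[OF oU UO E(1) that] Ck_subset[OF Ck_mono[OF Ck_moll[OF E(1)], of 2]] in auto)
    show "moll f (E (Suc j)) z \<le> moll f (E j) z" if "z \<in> U" for j z
      by (rule moll_mono[OF E(1) E(3) UO[OF that]])
    show "(\<lambda>j. moll f (E j) z) \<longlonglongrightarrow> f z" if "z \<in> U" for z
      by (rule moll_tendsto[OF in\<Omega>[OF that] E0 E(1)])
    show "f z \<le> moll f (E j) z" if "z \<in> U" for j z by (rule moll_ge[OF E(1) UO[OF that]])
  qed (use oU clU Ck_moll[OF E(1)] moll_bound in auto)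
qed

end

section \<open>A lower bound for the Monge--Ampere mass\<close>

definition grad_bl :: "('a::euclidean_space \<Rightarrow> real) \<Rightarrow> 'a \<Rightarrow> 'a \<Rightarrow>\<^sub>L real" where
  "grad_bl f z = (\<Sum>b\<in>Basis. dder b f z *\<^sub>R blinfun_inner_left b)"

definition hess_bl :: "('a::euclidean_space \<Rightarrow> real) \<Rightarrow> 'a \<Rightarrow> 'a \<Rightarrow>\<^sub>L 'a \<Rightarrow>\<^sub>L real" where
  "hess_bl f z = (\<Sum>b\<in>Basis. blinfun_scaleR_left (blinfun_inner_left b) o\<^sub>L grad_bl (dder b f) z)"

lemma dder_Basis_expand:
  fixes f :: "'a::euclidean_space \<Rightarrow> real"
  assumes "f differentiable (at z)"
  shows "dder h f z = (\<Sum>b\<in>Basis. dder b f z * (h \<bullet> b))"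
  using dder_sum_dir[OF assms, of "\<lambda>b. h \<bullet> b" "\<lambda>b. b" Basis] by (simp add: euclidean_representation mult.commute)

lemma grad_bl_apply: "f differentiable (at z) \<Longrightarrow> blinfun_apply (grad_bl f z) h = dder h f z"
  by (subst dder_Basis_expand) (auto simp: grad_bl_def blinfun.sum_left blinfun.scaleR_left)

lemma has_derivative_grad_bl:
  assumes "f differentiable (at z)"
  shows "(f has_derivative blinfun_apply (grad_bl f z)) (at z)"
proof -
  have "blinfun_apply (grad_bl f z) = (\<lambda>v. dder v f z)" by (rule ext) (rule grad_bl_apply[OF assms])
  then show ?thesis using has_derivative_dder[OF assms] by simp
qed

lemma hess_bl_apply:
  assumes "Ck 2 UNIV f"
  shows "blinfun_apply (blinfun_apply (hess_bl f z) h) k = dder h (dder k f) z"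
proof -
  have d: "f differentiable (at x)" "dder v f differentiable (at x)" for x v
    using assms by (auto simp: numeral_2_eq_2)
  have "dder h (dder k f) z = dder k (dder h f) z"
    by (rule dder_commute_real[OF open_UNIV UNIV_I assms])
  also have "\<dots> = (\<Sum>b\<in>Basis. dder b (dder h f) z * (k \<bullet> b))" by (rule dder_Basis_expand[OF d(2)])
  also have "\<dots> = (\<Sum>b\<in>Basis. dder h (dder b f) z * (k \<bullet> b))"
    by (intro sum.cong refl arg_cong2[where f = "(*)"] dder_commute_real[OF open_UNIV UNIV_I assms])
  finally show ?thesis
    unfolding hess_bl_def by (simp add: blinfun.sum_left blinfun.scaleR_left grad_bl_apply[OF d(2)])
qed

lemma has_derivative_hess_bl:
  fixes f :: "'a::euclidean_space \<Rightarrow> real"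
  assumes "Ck 2 UNIV f"
  shows "(grad_bl f has_derivative blinfun_apply (hess_bl f z)) (at z)"
proof -
  have d: "dder v f differentiable (at x)" for x v
    using assms by (auto simp: numeral_2_eq_2)
  have "((\<lambda>z. \<Sum>b\<in>Basis. dder b f z *\<^sub>R blinfun_inner_left b) has_derivative
     (\<lambda>h. \<Sum>b\<in>Basis. blinfun_apply (grad_bl (dder b f) z) h *\<^sub>R blinfun_inner_left (b::'a))) (at z)"
    by (intro has_derivative_sum has_derivative_scaleR_left has_derivative_grad_bl d)
  moreover have "(\<lambda>h. \<Sum>b\<in>Basis. blinfun_apply (grad_bl (dder b f) z) h *\<^sub>R blinfun_inner_left (b::'a))
      = blinfun_apply (hess_bl f z)"
    by (simp add: fun_eq_iff hess_bl_def blinfun.sum_left)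
  ultimately show ?thesis by (simp add: grad_bl_def[abs_def])
qed

lemma continuous_on_hess_bl:
  assumes "Ck 2 UNIV f"
  shows "continuous_on UNIV (hess_bl f)"
proof -
  have "continuous_on UNIV (dder v (dder w f))" for v w using assms by (auto simp: numeral_2_eq_2)
  then show ?thesis
    unfolding hess_bl_def[abs_def] grad_bl_def[abs_def] by (intro continuous_intros)
qed

lemma ma_density_hess_bl:
  fixes f :: "complex^'n::finite \<Rightarrow> real"
  assumes "Ck 2 UNIV f"
  shows "ma_density (hess_bl f z) = mad f z"
proof -
  have "cplx_hess (hess_bl f z) = chess (cr f) z"
    unfolding vec_eq_iff chess_entry[OF open_UNIV UNIV_I assms]
    by (simp add: cplx_hess_def hess_bl_apply[OF assms] field_simps)
  then show ?thesis by (simp add: ma_density_def mad_def)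
qed

section \<open>Sums of functions of the squared moduli of coordinates\<close>

lemma coord_square_Ck: "Ck n UNIV (\<lambda>z::complex^'n. (cmod (z $ i - p $ i))\<^sup>2)"
proof -
  have "Ck n UNIV (\<lambda>z::complex^'n. (z $ i - p $ i) \<bullet> (z $ i - p $ i))"
    by (intro Ck_bilinear[OF _ bounded_bilinear_inner] Ck_diff Ck_const Ck_linear bounded_linear_vec_nth open_UNIV)
  then show ?thesis by (simp add: dot_square_norm)
qed

lemma dz_coord_square:
  fixes p z :: "complex^'n"
  shows "dzb k (cr (\<lambda>z. (cmod (z $ i - p $ i))\<^sup>2)) z = (if k = i then z $ i - p $ i else 0)"
    and "dz k (cr (\<lambda>z. (cmod (z $ i - p $ i))\<^sup>2)) z = (if k = i then cnj (z $ i - p $ i) else 0)"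
proof -
  have d: "((\<lambda>z::complex^'n. (cmod (z $ i - p $ i))\<^sup>2) has_derivative (\<lambda>v. 2 * ((z $ i - p $ i) \<bullet> (v $ i)))) (at z)"
    unfolding dot_square_norm[symmetric]
    by (auto intro!: derivative_eq_intros bounded_linear.has_derivative[OF bounded_linear_vec_nth] simp: inner_commute)
  then have df: "(\<lambda>z::complex^'n. (cmod (z $ i - p $ i))\<^sup>2) differentiable (at z)" unfolding differentiable_def by blast
  have dd: "dder v (cr (\<lambda>z::complex^'n. (cmod (z $ i - p $ i))\<^sup>2)) z = of_real (2 * ((z $ i - p $ i) \<bullet> (v $ i)))" for v
    unfolding dder_of_real[OF df] dder_eqI[OF d] ..
  show "dzb k (cr (\<lambda>z. (cmod (z $ i - p $ i))\<^sup>2)) z = (if k = i then z $ i - p $ i else 0)"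
    unfolding dzb_def dd by (auto simp: axis_def inner_complex_def complex_eq_iff)
  show "dz k (cr (\<lambda>z. (cmod (z $ i - p $ i))\<^sup>2)) z = (if k = i then cnj (z $ i - p $ i) else 0)"
    unfolding dz_def dd by (auto simp: axis_def inner_complex_def complex_eq_iff)
qed

lemma dz_coord: "dz k (\<lambda>z::complex^'n. z $ i - p $ i) z = (if k = i then 1 else 0)"
proof -
  have d: "((\<lambda>z::complex^'n. z $ i - p $ i) has_derivative (\<lambda>v. v $ i)) (at z)"
    by (auto intro!: derivative_eq_intros bounded_linear.has_derivative[OF bounded_linear_vec_nth])
  show ?thesis unfolding dz_def dder_eqI[OF d] by (auto simp: axis_def)
qed

text \<open>For a function D(x) of x = |\<zeta>|^2 the mixed Wirtinger derivative is D' + x D''.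
  Hence the Hessian of such a sum is diagonal, and \<open>pos\<close> is its semidefiniteness. The
  margin \<open>\<eta>\<close> makes the derivatives two-sided at x = 0, also for a regularised
  logarithm.\<close>

locale coord_sum =
  fixes D :: "'n::finite \<Rightarrow> nat \<Rightarrow> real \<Rightarrow> real" and \<eta> :: real and p :: "complex^'n" and c :: real
  assumes \<eta>: "0 < \<eta>"
    and der: "\<And>i m x. m < 3 \<Longrightarrow> - \<eta> < x \<Longrightarrow> (D i m has_real_derivative D i (Suc m) x) (at x)"
    and cont: "\<And>i. continuous_on {- \<eta><..} (D i 3)"
    and pos: "\<And>i x. 0 \<le> x \<Longrightarrow> 0 \<le> D i 1 x + x * D i 2 x"
begin

abbreviation s :: "'n \<Rightarrow> complex^'n \<Rightarrow> real" where "s i z \<equiv> (cmod (z $ i - p $ i))\<^sup>2"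

definition w :: "complex^'n \<Rightarrow> real" where
  "w z = (\<Sum>i\<in>UNIV. D i 0 (s i z)) + c"

lemma s_gt: "- \<eta> < s i z"
  using \<eta> by (meson less_le_trans neg_less_0_iff_less zero_le_power2)

lemma Ck_D: "Ck 3 UNIV (\<lambda>z. D i 0 (s i z))"
  by (rule Ck_real_comp[where D = "D i" and S = "{- \<eta><..}"])
    (use der cont s_gt coord_square_Ck in auto)

lemma Ck_w: "Ck 3 UNIV w"
  unfolding w_def[abs_def] by (intro Ck_add Ck_sum Ck_D Ck_const open_UNIV)

lemma s_diff: "s i differentiable (at z)"
  using coord_square_Ck[of 1 i p] by simp

lemma D_diff: "m < 3 \<Longrightarrow> (\<lambda>z. D i m (s i z)) differentiable (at z)"
  using differentiable_chain_at[OF s_diff[where i = i and z = z], of "D i m"] der[of m "s i z" i] s_gt[where i = i and z = z]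
  by (auto simp: o_def real_differentiable_def)

lemma crD_diff: "m < 3 \<Longrightarrow> cr (\<lambda>z. D i m (s i z)) differentiable (at z)"
  by (rule differentiable_cr[OF D_diff])

lemma dzb_w: "dzb k (cr w) z = of_real (D k 1 (s k z)) * (z $ k - p $ k)"
proof -
  have dw: "dzb k (cr (\<lambda>z. D i 0 (s i z))) z = of_real (D i 1 (s i z)) * (if k = i then z $ i - p $ i else 0)" for i
  proof -
    have "dzb k (cr (\<lambda>z. D i 0 (s i z))) z = of_real (D i (Suc 0) (s i z)) * dzb k (cr (s i)) z"
      by (rule dz_real_comp(2)[where h = "D i 0" and g = "s i", OF der s_diff]) (use s_gt in auto)
    then show ?thesis unfolding dz_coord_square(1) by simp
  qed
  have sum_diff: "(\<lambda>z. \<Sum>i\<in>UNIV. cr (\<lambda>z. D i 0 (s i z)) z) differentiable (at z)"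
    by (intro differentiable_sum ballI crD_diff) auto
  have "dzb k (cr w) z = dzb k (\<lambda>z. (\<Sum>i\<in>UNIV. cr (\<lambda>z. D i 0 (s i z)) z) + of_real c) z"
    by (simp add: w_def[abs_def])
  also have "\<dots> = dzb k (\<lambda>z. \<Sum>i\<in>UNIV. cr (\<lambda>z. D i 0 (s i z)) z) z + dzb k (\<lambda>_. of_real c) z"
    by (rule dzb_add[OF sum_diff]) simp
  also have "dzb k (\<lambda>_::complex^'n. complex_of_real c) z = 0" by (simp add: dzb_def)
  also have "dzb k (\<lambda>z. \<Sum>i\<in>UNIV. cr (\<lambda>z. D i 0 (s i z)) z) z = (\<Sum>i\<in>UNIV. dzb k (cr (\<lambda>z. D i 0 (s i z))) z)"
    unfolding dzb_def
    by (subst (1 2) dder_sum) (auto intro!: crD_diff simp: sum_distrib_left sum.distrib sum_divide_distrib add_divide_distrib)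
  finally show ?thesis unfolding dw by (simp add: if_distrib[where f = "(*) _"] cong: if_cong)
qed

lemma chess_w: "chess (cr w) z $ j $ k = (if j = k then of_real (D j 1 (s j z) + s j z * D j 2 (s j z)) else 0)"
proof -
  have eq: "dzb k (cr w) = (\<lambda>z. cr (\<lambda>z. D k 1 (s k z)) z * (z $ k - p $ k))"
    by (rule ext) (rule dzb_w)
  have "dz j (dzb k (cr w)) z = of_real (D k 1 (s k z)) * dz j (\<lambda>z. z $ k - p $ k) z + dz j (cr (\<lambda>z. D k 1 (s k z))) z * (z $ k - p $ k)"
    unfolding eq
    by (intro dz_mult crD_diff differentiable_diff differentiable_const
        bounded_linear_imp_differentiable[OF bounded_linear_vec_nth]) simp
  also have "dz j (cr (\<lambda>z. D k 1 (s k z))) z = of_real (D k 2 (s k z)) * (if j = k then cnj (z $ k - p $ k) else 0)"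
  proof -
    have "dz j (cr (\<lambda>z. D k 1 (s k z))) z = of_real (D k (Suc 1) (s k z)) * dz j (cr (s k)) z"
      by (rule dz_real_comp(1)[where h = "D k 1" and g = "s k", OF der s_diff]) (use s_gt in auto)
    then show ?thesis unfolding dz_coord_square(2) by (simp add: numeral_2_eq_2)
  qed
  finally have *: "dz j (dzb k (cr w)) z = of_real (D k 1 (s k z)) * (if j = k then 1 else 0)
      + of_real (D k 2 (s k z)) * (if j = k then cnj (z $ k - p $ k) else 0) * (z $ k - p $ k)"
    unfolding dz_coord .
  show ?thesis
  proof (cases "j = k")
    case True
    then have "chess (cr w) z $ j $ k = of_real (D k 1 (s k z)) + of_real (D k 2 (s k z)) * cnj (z $ k - p $ k) * (z $ k - p $ k)"
      using * by (simp add: row_hess_def)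
    also have "\<dots> = of_real (D k 1 (s k z) + s k z * D k 2 (s k z))"
      by (simp only: of_real_add of_real_mult complex_norm_square mult_ac)
    finally show ?thesis using True by simp
  next
    case False
    then show ?thesis using * by (simp add: row_hess_def)
  qed
qed

lemma psd_w: "psd (chess (cr w) z)"
proof -
  have "herm_form (chess (cr w) z) x = (\<Sum>j\<in>UNIV. of_real (D j 1 (s j z) + s j z * D j 2 (s j z)) * of_real ((cmod (x $ j))\<^sup>2))" for x
    unfolding herm_form_def
  proof (rule sum.cong[OF refl])
    fix j
    have "(\<Sum>k\<in>UNIV. x $ j * chess (cr w) z $ j $ k * cnj (x $ k))
        = (\<Sum>k\<in>UNIV. if j = k then of_real (D j 1 (s j z) + s j z * D j 2 (s j z)) * of_real ((cmod (x $ j))\<^sup>2) else 0)"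
      by (rule sum.cong[OF refl]) (auto simp: chess_w complex_norm_square[of "x $ j"] simp del: of_real_add of_real_mult of_real_power)
    then show "(\<Sum>k\<in>UNIV. x $ j * chess (cr w) z $ j $ k * cnj (x $ k))
        = of_real (D j 1 (s j z) + s j z * D j 2 (s j z)) * of_real ((cmod (x $ j))\<^sup>2)"
      by simp
  qed
  moreover have "0 \<le> Re (\<Sum>j\<in>UNIV. of_real (D j 1 (s j z) + s j z * D j 2 (s j z)) * of_real ((cmod (x $ j))\<^sup>2))" for x
    unfolding Re_sum of_real_mult[symmetric] Re_complex_of_real using pos by (intro sum_nonneg mult_nonneg_nonneg) auto
  ultimately show ?thesis unfolding psd_def by (simp add: chess_w)
qed

lemma mad_w: "mad w z = (\<Prod>j\<in>UNIV. D j 1 (s j z) + s j z * D j 2 (s j z))"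
proof -
  have "det (chess (cr w) z) = (\<Prod>j\<in>UNIV. chess (cr w) z $ j $ j)"
    by (rule det_diagonal) (simp add: chess_w)
  also have "\<dots> = of_real (\<Prod>j\<in>UNIV. D j 1 (s j z) + s j z * D j 2 (s j z))" by (simp only: chess_w of_real_prod if_True refl)
  finally show ?thesis unfolding mad_def by (simp only: Re_complex_of_real)
qed

end

lemma norm_vec_square: "(norm (x :: complex^'n))\<^sup>2 = (\<Sum>i\<in>UNIV. (cmod (x $ i))\<^sup>2)"
  by (simp add: norm_vec_def L2_set_def sum_nonneg)

text \<open>Chern--Levine--Nirenberg type bound, obtained by comparing with a multiple of the squared distance.\<close>

lemma ball_mass_bound:
  fixes p :: "complex^'n::finite"
  assumes \<rho>: "0 < \<rho>" and B: "0 \<le> B"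
  obtains C where "\<And>\<psi>. Ck 3 UNIV \<psi> \<Longrightarrow> (\<And>z. z \<in> ball p (2 * \<rho>) \<Longrightarrow> psd (chess (cr \<psi>) z)) \<Longrightarrow>
     (\<And>z. \<bar>\<psi> z\<bar> \<le> B) \<Longrightarrow> (LINT z:cball p (\<rho> / 2)|lborel. mad \<psi> z) \<le> C"
proof -
  \<comment> \<open>Chosen so that A \<rho>^2 = 4 (B + 3) / 3: then \<open>w\<close> is at most -(B
    + 3) on the ball of radius \<rho> / 2 and at least \<open>B\<close> beyond radius 3 \<rho> /
    2.\<close>
  define A where "A = 4 * (B + 3) / (3 * \<rho>\<^sup>2)"
  have A: "0 \<le> A" using B \<rho> by (simp add: A_def)
  define D where "D i m x = (if m = 0 then A * x else if m = 1 then A else 0)" for i :: 'n and m :: nat and x :: real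
  interpret coord_sum D 1 p "- (A * \<rho>\<^sup>2)"
  proof
    fix i :: 'n and m :: nat and x :: real assume "m < 3"
    show "(D i m has_real_derivative D i (Suc m) x) (at x)"
      unfolding D_def by (cases "m = 0") (auto intro!: derivative_eq_intros)
  qed (auto simp: D_def A continuous_on_const)
  have w_eq: "w z = A * ((dist z p)\<^sup>2 - \<rho>\<^sup>2)" for z
    unfolding w_def D_def dist_norm norm_vec_square by (simp add: sum_distrib_left algebra_simps)
  have A\<rho>: "A * \<rho>\<^sup>2 = 4 * (B + 3) / 3" using \<rho> by (simp add: A_def)
  show thesis
  proof (rule that[of "LINT z:cball p (3 * \<rho> / 2)|lborel. mad w z"])
    fix \<psi> :: "complex^'n \<Rightarrow> real"
    assume C: "Ck 3 UNIV \<psi>" and P: "\<And>z. z \<in> ball p (2 * \<rho>) \<Longrightarrow> psd (chess (cr \<psi>) z)" and bd: "\<And>z. \<bar>\<psi> z\<bar> \<le> B"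
    show "(LINT z:cball p (\<rho> / 2)|lborel. mad \<psi> z) \<le> (LINT z:cball p (3 * \<rho> / 2)|lborel. mad w z)"
    proof (rule smooth_comparison[of "ball p (2 * \<rho>)"])
      show "\<psi> z \<le> w z" if "z \<in> ball p (2 * \<rho>) - cball p (3 * \<rho> / 2)" for z
      proof -
        have "3 * \<rho> / 2 < dist z p" using that by (simp add: dist_commute)
        then have "(3 * \<rho> / 2)\<^sup>2 \<le> (dist z p)\<^sup>2" using \<rho> by (intro power_mono) auto
        then have "5/4 * \<rho>\<^sup>2 \<le> (dist z p)\<^sup>2 - \<rho>\<^sup>2" by (simp add: power2_eq_square)
        then have "A * (5/4 * \<rho>\<^sup>2) \<le> w z" unfolding w_eq using A by (rule mult_left_mono)
        moreover have "B \<le> 5/4 * (4 * (B + 3) / 3)" using B by simp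
        moreover have "5/4 * (4 * (B + 3) / 3) = A * (5/4 * \<rho>\<^sup>2)" unfolding A\<rho>[symmetric] by simp
        moreover have "\<psi> z \<le> B" using bd[of z] by (simp add: abs_le_iff)
        ultimately show ?thesis by (metis order_trans)
      qed
      show "w z + 3 \<le> \<psi> z" if "z \<in> cball p (\<rho> / 2)" for z
      proof -
        have "dist z p \<le> \<rho> / 2" using that by (simp add: dist_commute)
        then have "(dist z p)\<^sup>2 \<le> (\<rho> / 2)\<^sup>2" by (intro power_mono) auto
        then have "(dist z p)\<^sup>2 - \<rho>\<^sup>2 \<le> - 3/4 * \<rho>\<^sup>2" by (simp add: power2_eq_square)
        then have "w z \<le> A * (- 3/4 * \<rho>\<^sup>2)" unfolding w_eq using A by (rule mult_left_mono)
        also have "A * (- 3/4 * \<rho>\<^sup>2) = - 3/4 * (A * \<rho>\<^sup>2)" by simp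
        also have "\<dots> = - (B + 3)" unfolding A\<rho> by (simp add: field_simps)
        finally have "w z \<le> - (B + 3)" .
        moreover have "- B \<le> \<psi> z" using bd[of z] by (simp add: abs_le_iff)
        ultimately show ?thesis by linarith
      qed
      show "cball p (\<rho> / 2) \<subseteq> ball p (2 * \<rho>)" "cball p (3 * \<rho> / 2) \<subseteq> ball p (2 * \<rho>)" using \<rho> by auto
      show "Ck 3 (ball p (2 * \<rho>)) w" "Ck 3 (ball p (2 * \<rho>)) \<psi>" using Ck_subset Ck_w C by blast+
    qed (use P psd_w in auto)
  qed
qed

text \<open>A Dini argument: with \<open>W j\<close> the set where the j-th member of a decreasing
  sequence lies below a given function, pointwise convergence becomes an inequality on all of
  \<open>T\<close> from some index on.\<close>

lemma compact_increasing_cover: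
  fixes W :: "nat \<Rightarrow> 'a::topological_space set"
  assumes T: "compact T" and W: "\<And>j. open (W j)" "T \<subseteq> (\<Union>j. W j)"
    and inc: "\<And>j z. z \<in> T \<Longrightarrow> z \<in> W j \<Longrightarrow> z \<in> W (Suc j)"
  obtains n where "\<And>j z. n \<le> j \<Longrightarrow> z \<in> T \<Longrightarrow> z \<in> W j"
proof -
  obtain F where F: "finite F" "T \<subseteq> (\<Union>j\<in>F. W j)"
    using compactE_image[OF T, of UNIV W] W by auto
  have mono: "z \<in> W j" if "z \<in> T" "z \<in> W i" "i \<le> j" for z i j
    using that(3,2) by (induction rule: dec_induct) (use inc that(1) in auto)
  show thesis
  proof (rule that[of "Max (insert 0 F)"])
    fix j z assume j: "Max (insert 0 F) \<le> j" and z: "z \<in> T"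
    obtain i where i: "i \<in> F" "z \<in> W i" using F z by blast
    then have "i \<le> j" using F(1) j by (meson Max_ge finite_insert insertI2 order_trans)
    then show "z \<in> W j" using mono z i by blast
  qed
qed

text \<open>Any one admissible sequence bounds the supremum \<open>ma_mass\<close> from below. For
  the regularisations of \<open>f\<close>, \<open>smooth_comparison\<close> bounds the masses from
  below and \<open>ball_mass_bound\<close> from above, so a subsequence has the limit that the
  definition demands.\<close>

lemma (in bounded_psh) ma_mass_ge:
  assumes \<phi>: "\<And>z. z \<in> \<Omega> \<Longrightarrow> \<phi> z = ereal (f z)"
    and w: "Ck 3 UNIV w" "\<And>z. psd (chess (cr w) z)"
    and K: "compact K" "K \<subseteq> \<Omega>" "\<And>z. z \<in> \<Omega> - K \<Longrightarrow> w z \<le> f z"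
    and T: "compact T" "T \<subseteq> \<Omega>" "T \<noteq> {}" "\<And>z. z \<in> T \<Longrightarrow> f z + 3 < w z"
  shows "ereal (LINT z:T|lborel. mad w z) \<le> ma_mass \<Omega> \<phi>"
proof -
  define L where "L = K \<union> T"
  have L: "compact L" "L \<subseteq> \<Omega>" "L \<noteq> {}" using K T by (auto simp: L_def)
  obtain U \<psi> where U: "open U" "L \<subseteq> U" "compact (closure U)" "closure U \<subseteq> \<Omega>"
    and \<psi>: "\<And>j::nat. Ck 3 UNIV (\<psi> j)" "\<And>j. psh_on U (\<lambda>z. ereal (\<psi> j z))"
    "\<And>j z. z \<in> U \<Longrightarrow> psd (chess (cr (\<psi> j)) z)"
    "\<And>j z. z \<in> U \<Longrightarrow> \<psi> (Suc j) z \<le> \<psi> j z" "\<And>z. z \<in> U \<Longrightarrow> (\<lambda>j. \<psi> j z) \<longlonglongrightarrow> f z"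
    "\<And>j z. \<bar>\<psi> j z\<bar> \<le> B" "\<And>j z. z \<in> U \<Longrightarrow> f z \<le> \<psi> j z"
    using regularization[OF L(1,2)] by blast
  have U\<Omega>: "U \<subseteq> \<Omega>" using U closure_subset by blast
  obtain r where r: "r > 0" "\<And>x y. x \<in> L \<Longrightarrow> dist x y < r \<Longrightarrow> y \<in> U"
    using compact_in_open_margin[OF L(1) U(1,2)] by blast
  define S where "S = {z. infdist z L \<le> r / 2}"
  have SU: "S \<subseteq> U"
  proof
    fix z assume "z \<in> S"
    then have "infdist z L \<le> r / 2" by (simp add: S_def)
    moreover obtain x where "x \<in> L" "infdist z L = dist z x"
      using infdist_attains_inf[OF compact_imp_closed[OF L(1)] L(3)] by blast
    ultimately show "z \<in> U" using r by (intro r(2)[of x z]) (auto simp: dist_commute)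
  qed
  have cS: "compact S"
  proof -
    have "closed S" unfolding S_def by (intro closed_Collect_le continuous_intros)
    then show ?thesis using SU U\<Omega> bdd by (meson bounded_subset compact_eq_bounded_closed)
  qed
  \<comment> \<open>A continuous cutoff, 1 on \<open>L\<close> and 0 off the compact neighbourhood
    \<open>S\<close>; it replaces the indicator because \<open>ma_mass\<close> tests with continuous
    functions.\<close>
  define h where "h z = max 0 (1 - infdist z L / (r / 2))" for z
  have hcont: "continuous_on A h" for A unfolding h_def[abs_def] using r(1) by (intro continuous_intros) auto
  have h01: "0 \<le> h z" "h z \<le> 1" for z using r(1) by (auto simp: h_def infdist_nonneg)
  have h1: "h z = 1" if "z \<in> L" for z using that by (simp add: h_def)
  have h0: "h z = 0" if "z \<notin> S" for z using that r(1) by (auto simp: h_def S_def field_simps max_def)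
  have supp: "closure {z. h z \<noteq> 0} \<subseteq> S"
    by (rule closure_minimal) (use h0 cS compact_imp_closed in auto)
  have csupp: "compact (closure {z. h z \<noteq> 0})"
    using supp cS by (metis closed_closure compact_Int_closed inf.absorb2 inf_commute)
  have madpos: "0 \<le> mad (\<psi> j) z" if "z \<in> U" for j z
    unfolding mad_def by (rule psd_det_nonneg[OF \<psi>(3)[OF that]])
  have madcont: "continuous_on A (mad (\<psi> j))" for A j
    using continuous_on_mad[OF open_UNIV \<psi>(1)] continuous_on_subset by blast
  define I where "I j = (LINT z:U|lborel. h z * mad (\<psi> j) z)" for j
  have I_S: "I j = (LINT z:S|lborel. h z * mad (\<psi> j) z)" for j
    unfolding I_def by (rule set_integral_restrict[OF _ SU]) (simp add: h0)
  have intS: "set_integrable lborel S (\<lambda>z. h z * mad (\<psi> j) z)" "set_integrable lborel S (mad (\<psi> j))" for j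
    by (rule set_integrable_compact[OF cS SU], intro continuous_intros hcont madcont)+
  \<comment> \<open>The strict inequality on the compact set \<open>T\<close> passes from
    \<open>f\<close> to all late members of the decreasing sequence.\<close>
  obtain n0 where n0: "\<And>j z. n0 \<le> j \<Longrightarrow> z \<in> T \<Longrightarrow> \<psi> j z + 3 < w z"
  proof -
    have "\<exists>n. \<forall>j z. n \<le> j \<longrightarrow> z \<in> T \<longrightarrow> z \<in> {z. \<psi> j z + 3 < w z}"
    proof (rule compact_increasing_cover[OF T(1), of "\<lambda>j. {z. \<psi> j z + 3 < w z}"])
      show "open {z. \<psi> j z + 3 < w z}" for j
        by (intro open_Collect_less continuous_intros Ck_imp_continuous[OF \<psi>(1)] Ck_imp_continuous[OF w(1)])
      show "T \<subseteq> (\<Union>j. {z. \<psi> j z + 3 < w z})"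
      proof
        fix z assume z: "z \<in> T"
        then have "z \<in> U" using U(2) by (auto simp: L_def)
        from \<psi>(5)[OF this] have "\<forall>\<^sub>F j in sequentially. \<psi> j z < w z - 3"
          by (rule order_tendstoD) (use T(4)[OF z] in simp)
        then obtain j where "\<psi> j z < w z - 3" using eventually_sequentially by auto
        then have "\<psi> j z + 3 < w z" by simp
        then show "z \<in> (\<Union>j. {z. \<psi> j z + 3 < w z})" by blast
      qed
      show "z \<in> {z. \<psi> (Suc j) z + 3 < w z}" if "z \<in> T" "z \<in> {z. \<psi> j z + 3 < w z}" for j z
        using that \<psi>(4)[of z j] U(2) by (auto simp: L_def)
    qed blast
    then show thesis using that by blast
  qed
  have lower: "(LINT z:T|lborel. mad w z) \<le> I j" if "n0 \<le> j" for j
  proof -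
    have "(LINT z:T|lborel. mad w z) \<le> (LINT z:K|lborel. mad (\<psi> j) z)"
    proof (rule smooth_comparison[OF U(1) K(1) _ T(1)])
      show "Ck 3 U (\<psi> j)" "Ck 3 U w" using Ck_subset \<psi>(1) w(1) by blast+
      show "w z \<le> \<psi> j z" if "z \<in> U - K" for z
        using K(3)[of z] \<psi>(7)[of z j] that U\<Omega> by force
    qed (use U(2) n0[OF that] w(2) \<psi>(3) in \<open>auto simp: L_def less_imp_le\<close>)
    also have "\<dots> \<le> (LINT z:S|lborel. h z * mad (\<psi> j) z)"
      unfolding set_lebesgue_integral_def
    proof (rule integral_mono)
      have KS: "K \<subseteq> S" using r(1) by (auto simp: S_def L_def)
      show "integrable lborel (\<lambda>x. indicat_real K x *\<^sub>R mad (\<psi> j) x)"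
        using set_integrable_compact[OF K(1), of UNIV "mad (\<psi> j)"] madcont by (simp add: set_integrable_def)
      show "integrable lborel (\<lambda>x. indicat_real S x *\<^sub>R (h x * mad (\<psi> j) x))"
        using intS(1) by (simp add: set_integrable_def)
      fix z
      show "indicat_real K z *\<^sub>R mad (\<psi> j) z \<le> indicat_real S z *\<^sub>R (h z * mad (\<psi> j) z)"
        using KS SU h1[of z] h01 madpos[of z j] by (auto simp: indicator_def L_def)
    qed
    finally show ?thesis by (simp add: I_S)
  qed
  obtain \<rho> where \<rho>: "\<rho> > 0" "\<And>x y. x \<in> S \<Longrightarrow> dist x y < 2 * \<rho> \<Longrightarrow> y \<in> U"
  proof -
    obtain r where "r > 0" "\<And>x y. x \<in> S \<Longrightarrow> dist x y < r \<Longrightarrow> y \<in> U"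
      using compact_in_open_margin[OF cS U(1) SU] by blast
    then show thesis using that[of "r / 2"] by simp
  qed
  have "\<exists>C. \<forall>j. (LINT z:cball p (\<rho> / 2)|lborel. mad (\<psi> j) z) \<le> C" if p: "p \<in> S" for p
  proof -
    obtain C where C: "\<And>\<psi>. Ck 3 UNIV \<psi> \<Longrightarrow> (\<And>z. z \<in> ball p (2 * \<rho>) \<Longrightarrow> psd (chess (cr \<psi>) z)) \<Longrightarrow>
      (\<And>z. \<bar>\<psi> z\<bar> \<le> B) \<Longrightarrow> (LINT z:cball p (\<rho> / 2)|lborel. mad \<psi> z) \<le> C"
      using ball_mass_bound[OF \<rho>(1) B_nonneg] by blast
    have "(LINT z:cball p (\<rho> / 2)|lborel. mad (\<psi> j) z) \<le> C" for j
      by (rule C[OF \<psi>(1) \<psi>(3) \<psi>(6)]) (use \<rho>(2)[OF p] in auto)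
    then show ?thesis by blast
  qed
  then obtain C where C: "\<And>p j. p \<in> S \<Longrightarrow> (LINT z:cball p (\<rho> / 2)|lborel. mad (\<psi> j) z) \<le> C p" by metis
  \<comment> \<open>Finitely many balls with a uniform mass bound cover the neighbourhood
    \<open>S\<close>, so the sum of their bounds dominates every \<open>I j\<close>.\<close>
  obtain F where F: "finite F" "F \<subseteq> S" "S \<subseteq> (\<Union>p\<in>F. ball p (\<rho> / 2))"
  proof -
    have sub: "S \<subseteq> (\<Union>p\<in>S. ball p (\<rho> / 2))" using \<rho>(1) by force
    show thesis
      by (rule compactE_image[OF cS _ sub]) (simp, rule that)
  qed
  have upper: "I j \<le> (\<Sum>p\<in>F. C p)" for j
  proof -
    have intp: "integrable lborel (\<lambda>z. indicat_real (cball p (\<rho> / 2)) z *\<^sub>R mad (\<psi> j) z)" for p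
      using set_integrable_compact[OF compact_cball, of p "\<rho> / 2" UNIV "mad (\<psi> j)"] madcont by (simp add: set_integrable_def)
    have "I j \<le> (\<integral>z. (\<Sum>p\<in>F. indicat_real (cball p (\<rho> / 2)) z *\<^sub>R mad (\<psi> j) z) \<partial>lborel)"
      unfolding I_S set_lebesgue_integral_def
    proof (rule integral_mono)
      show "integrable lborel (\<lambda>x. indicat_real S x *\<^sub>R (h x * mad (\<psi> j) x))"
        using intS(1) by (simp add: set_integrable_def)
      show "integrable lborel (\<lambda>z. \<Sum>p\<in>F. indicat_real (cball p (\<rho> / 2)) z *\<^sub>R mad (\<psi> j) z)"
        using intp by simp
      fix z
      have nn: "0 \<le> indicat_real (cball p (\<rho> / 2)) z *\<^sub>R mad (\<psi> j) z" if "p \<in> F" for p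
      proof (cases "z \<in> cball p (\<rho> / 2)")
        case True
        then have "z \<in> U" using \<rho> that F(2) by (intro \<rho>(2)[of p z]) auto
        then show ?thesis using madpos by simp
      qed simp
      show "indicat_real S z *\<^sub>R (h z * mad (\<psi> j) z) \<le> (\<Sum>p\<in>F. indicat_real (cball p (\<rho> / 2)) z *\<^sub>R mad (\<psi> j) z)"
      proof (cases "z \<in> S")
        case True
        then obtain p where p: "p \<in> F" "z \<in> ball p (\<rho> / 2)" using F(3) by blast
        have "h z * mad (\<psi> j) z \<le> mad (\<psi> j) z"
          using h01[of z] madpos[of z j] True SU by (intro mult_left_le_one_le) auto
        also have "\<dots> = indicat_real (cball p (\<rho> / 2)) z *\<^sub>R mad (\<psi> j) z" using p by simp
        also have "\<dots> \<le> (\<Sum>p\<in>F. indicat_real (cball p (\<rho> / 2)) z *\<^sub>R mad (\<psi> j) z)"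
          by (rule member_le_sum[OF p(1)]) (use nn F in auto)
        finally show ?thesis using True by simp
      next
        case False
        then show ?thesis using nn by (simp add: sum_nonneg)
      qed
    qed
    also have "\<dots> = (\<Sum>p\<in>F. LINT z:cball p (\<rho> / 2)|lborel. mad (\<psi> j) z)"
      unfolding set_lebesgue_integral_def by (rule Bochner_Integration.integral_sum) (rule intp)
    also have "\<dots> \<le> (\<Sum>p\<in>F. C p)" using C F(2) by (intro sum_mono) auto
    finally show ?thesis .
  qed
  have bI: "bounded (range (\<lambda>j. I (j + n0)))"
    unfolding bounded_iff
  proof (intro exI ballI)
    fix x assume "x \<in> range (\<lambda>j. I (j + n0))"
    then obtain j where j: "x = I (j + n0)" by blast
    show "norm x \<le> max \<bar>LINT z:T|lborel. mad w z\<bar> \<bar>\<Sum>p\<in>F. C p\<bar>"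
      using lower[of "j + n0"] upper[of "j + n0"] unfolding j real_norm_def by linarith
  qed
  \<comment> \<open>Bounded integrals need not converge, so the witness for \<open>ma_mass\<close>
    is a subsequence, started at \<open>n0\<close> where the lower bound holds.\<close>
  obtain l q where q: "strict_mono q" "((\<lambda>j. I (j + n0)) \<circ> q) \<longlonglongrightarrow> l"
    using bounded_imp_convergent_subsequence[OF bI] by blast
  define \<psi>' where "\<psi>' j = \<psi> (q j + n0)" for j
  have Il: "(\<lambda>j. I (q j + n0)) \<longlonglongrightarrow> l" using q(2) by (simp add: o_def)
  have "(LINT z:T|lborel. mad w z) \<le> l"
    by (rule LIMSEQ_le_const[OF Il]) (use lower in auto)
  moreover have "ereal l \<le> ma_mass \<Omega> \<phi>"
    unfolding ma_mass_def
  proof (rule Sup_upper, rule CollectI, rule exI[of _ l], intro conjI refl)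
    have C2: "Ck 2 UNIV (\<psi>' j)" for j unfolding \<psi>'_def by (rule Ck_mono[OF \<psi>(1)]) simp
    have dec: "\<psi> j z \<le> \<psi> i z" if "i \<le> j" "z \<in> U" for i j z
      using that(1) by (induction rule: dec_induct) (use \<psi>(4)[OF that(2)] order_trans in blast)+
    have "(\<lambda>j. LINT z:U|lborel. h z * ma_density (hess_bl (\<psi>' j) z)) = (\<lambda>j. I (q j + n0))"
      unfolding ma_density_hess_bl[OF C2] unfolding I_def \<psi>'_def ..
    then have lim: "(\<lambda>j. LINT z:U|lborel. h z * ma_density (hess_bl (\<psi>' j) z)) \<longlonglongrightarrow> l" using Il by simp
    have tend: "(\<lambda>j. ereal (\<psi>' j z)) \<longlonglongrightarrow> \<phi> z" if "z \<in> U" for z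
    proof -
      have "(\<lambda>j. \<psi> (j + n0) z) \<longlonglongrightarrow> f z" using LIMSEQ_ignore_initial_segment[OF \<psi>(5)[OF that]] .
      from LIMSEQ_subseq_LIMSEQ[OF this q(1)] have "(\<lambda>j. \<psi>' j z) \<longlonglongrightarrow> f z" by (simp add: \<psi>'_def o_def)
      then show ?thesis using \<phi>[of z] that U\<Omega> by auto
    qed
    have diff: "(\<psi>' j has_derivative blinfun_apply (grad_bl (\<psi>' j) z)) (at z)" for j z
      by (rule has_derivative_grad_bl) (use C2[of j] in \<open>simp add: numeral_2_eq_2\<close>)
    have mono: "\<psi>' (Suc j) z \<le> \<psi>' j z" if "z \<in> U" for j z
      unfolding \<psi>'_def by (rule dec[OF _ that]) (use q(1) in \<open>simp add: strict_mono_def less_imp_le\<close>)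
    show "\<exists>(h::complex^'n \<Rightarrow> real) U (\<psi>::nat \<Rightarrow> complex^'n \<Rightarrow> real) \<psi>' \<psi>''.
      open U \<and> compact (closure U) \<and> closure U \<subseteq> \<Omega> \<and>
      continuous_on UNIV h \<and> (\<forall>z. 0 \<le> h z \<and> h z \<le> 1) \<and>
      compact (closure {z. h z \<noteq> 0}) \<and> closure {z. h z \<noteq> 0} \<subseteq> U \<and>
      (\<forall>j. psh_on U (\<lambda>z. ereal (\<psi> j z))) \<and>
      (\<forall>j. \<forall>z\<in>U. (\<psi> j has_derivative blinfun_apply (\<psi>' j z)) (at z) \<and>
                  (\<psi>' j has_derivative blinfun_apply (\<psi>'' j z)) (at z)) \<and>
      (\<forall>j. continuous_on U (\<psi>'' j)) \<and>
      (\<forall>j. \<forall>z\<in>U. \<psi> (Suc j) z \<le> \<psi> j z) \<and>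
      (\<forall>z\<in>U. (\<lambda>j. ereal (\<psi> j z)) \<longlonglongrightarrow> \<phi> z) \<and>
      (\<lambda>j. set_lebesgue_integral lborel U (\<lambda>z. h z * ma_density (\<psi>'' j z))) \<longlonglongrightarrow> l"
      apply (rule exI[of _ h], rule exI[of _ U], rule exI[of _ \<psi>'], rule exI[of _ "\<lambda>j. grad_bl (\<psi>' j)"],
          rule exI[of _ "\<lambda>j. hess_bl (\<psi>' j)"])
      using U(1,3,4) hcont h01 csupp supp SU \<psi>(2) diff has_derivative_hess_bl[OF C2]
        continuous_on_subset[OF continuous_on_hess_bl[OF C2]] mono tend lim
      by (auto simp: \<psi>'_def[abs_def])
  qed
  ultimately show ?thesis by (meson ereal_less_eq(3) order_trans)
qed

section \<open>Logarithmic poles along a fibre\<close>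

lemma prod_UNIV_sum:
  "(\<Prod>i\<in>(UNIV :: ('k::finite + 'm::finite) set). F i) = (\<Prod>a\<in>UNIV. F (Inl a)) * (\<Prod>b\<in>UNIV. F (Inr b))"
  unfolding UNIV_Plus_UNIV[symmetric] by (subst prod.Plus) auto

lemma sum_UNIV_sum:
  "(\<Sum>i\<in>(UNIV :: ('k::finite + 'm::finite) set). F i) = (\<Sum>a\<in>UNIV. F (Inl a)) + (\<Sum>b\<in>UNIV. F (Inr b))"
  unfolding UNIV_Plus_UNIV[symmetric] by (subst sum.Plus) auto

lemma psh_on_cong:
  assumes eq: "\<And>z. z \<in> \<Omega> \<Longrightarrow> u z = v z" and u: "psh_on \<Omega> u"
  shows "psh_on \<Omega> v"
proof -
  have "usc_on \<Omega> v"
  proof (rule usc_onI_open)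
    fix c
    have "{x\<in>\<Omega>. v x < c} = {x\<in>\<Omega>. u x < c}" using eq by auto
    then show "open {x\<in>\<Omega>. v x < c}" using usc_on_open[of \<Omega> u] u by (simp add: psh_on_def)
  qed
  moreover have "v a \<le> circle_mean (\<lambda>\<theta>. v (a + cis \<theta> *s b))" if "\<forall>\<zeta>. cmod \<zeta> \<le> 1 \<longrightarrow> a + \<zeta> *s b \<in> \<Omega>" for a b
  proof -
    have "a \<in> \<Omega>" using that[rule_format, of 0] by simp
    moreover have "(\<lambda>\<theta>. v (a + cis \<theta> *s b)) = (\<lambda>\<theta>. u (a + cis \<theta> *s b))" using that eq by simp
    moreover have "u a \<le> circle_mean (\<lambda>\<theta>. u (a + cis \<theta> *s b))" using u that unfolding psh_on_def by blast
    ultimately show ?thesis using eq[of a] by simp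
  qed
  moreover have "\<exists>x\<in>C. v x \<noteq> - \<infinity>" if "C \<in> components \<Omega>" for C
    using u that eq in_components_subset[OF that] unfolding psh_on_def by (metis subsetD)
  ultimately show ?thesis using u eq unfolding psh_on_def by auto
qed

text \<open>A product of squares rather than of discs is a real box, so its measure is a plain
  product of side lengths; \<open>cmod_polybox\<close> pays for this with a factor 2.\<close>

definition polybox :: "complex^'n \<Rightarrow> ('n \<Rightarrow> real) \<Rightarrow> (complex^'n) set" where
  "polybox p t = cbox (p - (\<chi> i. Complex (t i) (t i))) (p + (\<chi> i. Complex (t i) (t i)))"

lemma mem_polybox: "z \<in> polybox p t \<longleftrightarrow> (\<forall>i. \<bar>Re (z $ i - p $ i)\<bar> \<le> t i \<and> \<bar>Im (z $ i - p $ i)\<bar> \<le> t i)"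
  unfolding polybox_def
  by (auto simp: mem_box Basis_vec_def Basis_complex_def inner_axis inner_complex_def abs_le_iff algebra_simps)

lemma cmod_polybox: "z \<in> polybox p t \<Longrightarrow> cmod (z $ i - p $ i) \<le> 2 * t i"
  using cmod_le[of "z $ i - p $ i"] unfolding mem_polybox by (smt (verit))

lemma measure_polybox:
  fixes p :: "complex^'n::finite"
  assumes "\<And>i. 0 \<le> t i"
  shows "measure lborel (polybox p t) = (\<Prod>i\<in>UNIV. (2 * t i)\<^sup>2)"
proof -
  let ?v = "\<chi> i. Complex (t i) (t i) :: complex^'n"
  have inj: "inj_on (\<lambda>(j, u). axis j u :: complex^'n) (UNIV \<times> {1, \<i>})"
    by (auto simp: inj_on_def axis_eq_axis)
  have B: "(Basis :: (complex^'n) set) = (\<lambda>(j, u). axis j u) ` (UNIV \<times> {1, \<i>})"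
    by (auto simp: Basis_vec_def Basis_complex_def)
  have "measure lborel (polybox p t) = (\<Prod>b\<in>Basis. ((p + ?v) - (p - ?v)) \<bullet> b)"
    unfolding polybox_def using assms
    by (subst measure_lborel_cbox_eq) (auto simp: Basis_vec_def Basis_complex_def inner_axis inner_complex_def inner_add_left inner_diff_left)
  also have "\<dots> = (\<Prod>b\<in>Basis. (2 *\<^sub>R ?v) \<bullet> b)" by (simp add: scaleR_2)
  also have "\<dots> = (\<Prod>j\<in>UNIV. \<Prod>u\<in>{1, \<i>}. (2 *\<^sub>R ?v) \<bullet> axis j u)"
    unfolding B prod.reindex[OF inj] prod.cartesian_product by (simp add: o_def split_beta)
  also have "\<dots> = (\<Prod>i\<in>UNIV. (2 * t i)\<^sup>2)"
    by (simp add: inner_axis inner_complex_def complex_eq_iff power2_eq_square)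
  finally show ?thesis .
qed

lemma norm_le_sum_cmod: "norm (x :: complex^'n) \<le> (\<Sum>i\<in>UNIV. cmod (x $ i))"
  unfolding norm_vec_def by (rule L2_set_le_sum) simp

text \<open>Real thresholds between the two values reduce this to the open sublevel sets of
  \<open>f\<close>.\<close>

lemma open_usc_less_continuous:
  assumes "usc_on \<Omega> f" "open \<Omega>" "continuous_on UNIV w"
  shows "open {z\<in>\<Omega>. f z < ereal (w z)}"
proof -
  have "{z\<in>\<Omega>. f z < ereal (w z)} = (\<Union>c. {z\<in>\<Omega>. f z < ereal c} \<inter> {z. c < w z})"
  proof (intro equalityI subsetI)
    fix z assume z: "z \<in> {z\<in>\<Omega>. f z < ereal (w z)}"
    then obtain c where "f z < c" "c < ereal (w z)" using dense by blast
    then show "z \<in> (\<Union>c. {z\<in>\<Omega>. f z < ereal c} \<inter> {z. c < w z})" using z by (cases c) auto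
  next
    fix z assume "z \<in> (\<Union>c. {z\<in>\<Omega>. f z < ereal c} \<inter> {z. c < w z})"
    then obtain c where "z \<in> \<Omega>" "f z < ereal c" "c < w z" by blast
    then show "z \<in> {z\<in>\<Omega>. f z < ereal (w z)}" by (auto intro: less_trans)
  qed
  moreover have "open (\<Union>c. {z\<in>\<Omega>. f z < ereal c} \<inter> {z. c < w z})"
    using usc_on_open[OF assms(1,2)] assms(3) by (intro open_UN ballI open_Int open_Collect_less continuous_intros)
  ultimately show ?thesis by simp
qed

text \<open>For large \<open>N\<close> the comparison function \<open>w\<close> lies above \<open>u\<close> on a box of size \<open>exp (- N)\<close> in the
  last variables, and its Monge--Ampere mass there grows at least linearly in \<open>N\<close>.\<close>

lemma cE_no_uniform_log_pole:
  fixes u :: "complex^('k::finite + 'm::finite) \<Rightarrow> ereal"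
  assumes u: "cE \<Omega> u" and bO: "bounded \<Omega>" and p: "p \<in> \<Omega>" and c: "0 < c" and \<delta>: "0 < \<delta>"
    and ub: "\<And>N z. i0 \<le> N \<Longrightarrow> (\<Sum>a\<in>UNIV. cmod (z $ Inl a - p $ Inl a)) < \<delta> \<Longrightarrow>
        (\<Sum>b\<in>UNIV. cmod (z $ Inr b - p $ Inr b)) \<le> exp (- real N) \<Longrightarrow> u z \<le> ereal (M - c * real N)"
  shows False
proof -
  let ?k = "real CARD('k)" and ?m = "real CARD('m)"
  have km: "1 \<le> ?k" "1 \<le> ?m" by (auto simp: Suc_leI)
  have op: "open \<Omega>" using u by (auto simp: cE_def psh_on_def)
  obtain \<eta> where \<eta>: "0 < \<eta>" "cball p \<eta> \<subseteq> \<Omega>" using op p open_contains_cball by blast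
  have clb: "closure (ball p \<eta>) = cball p \<eta>" using \<eta> by (simp add: closure_ball)
  obtain g where g: "cF \<Omega> g" "\<And>z. z \<in> ball p \<eta> \<Longrightarrow> g z = u z"
    using u \<eta> clb unfolding cE_def by (metis compact_cball open_ball)
  obtain F where F: "\<And>j::nat. cE0 \<Omega> (F j)" "\<And>j z. z \<in> \<Omega> \<Longrightarrow> F (Suc j) z \<le> F j z"
    "\<And>z. z \<in> \<Omega> \<Longrightarrow> (\<lambda>j. F j z) \<longlonglongrightarrow> g z" "(SUP j. ma_mass \<Omega> (F j)) < \<infinity>"
    using g(1) unfolding cF_def by blast
  obtain Mm :: real where Mm: "\<And>j. ma_mass \<Omega> (F j) \<le> ereal Mm"
  proof -
    obtain r :: real where "(SUP j. ma_mass \<Omega> (F j)) \<le> ereal r"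
      using F(4) by (cases "SUP j. ma_mass \<Omega> (F j)") auto
    then show thesis using that SUP_upper by (metis UNIV_I order_trans)
  qed
  obtain R where R: "1 \<le> R" "\<And>z i. z \<in> \<Omega> \<Longrightarrow> cmod (z $ i - p $ i) \<le> R"
  proof -
    obtain R0 where R0: "\<And>z. z \<in> \<Omega> \<Longrightarrow> norm z \<le> R0" using bO bounded_iff by blast
    have "cmod (z $ i - p $ i) \<le> max 1 (2 * R0)" if "z \<in> \<Omega>" for z i
    proof -
      have "cmod (z $ i - p $ i) \<le> norm (z - p)" by (metis Finite_Cartesian_Product.norm_nth_le vector_minus_component)
      also have "\<dots> \<le> 2 * R0" using norm_triangle_ineq4[of z p] R0[OF that] R0[OF p] by simp
      finally show ?thesis by simp
    qed
    then show thesis using that[of "max 1 (2 * R0)"] by simp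
  qed
  \<comment> \<open>Each of the k first coordinates has modulus at most 2 s on the box, so their sum
    is at most a quarter of both tolerances.\<close>
  define s where "s = min \<delta> \<eta> / (8 * ?k)"
  have s: "0 < s" using \<delta> \<eta> km by (simp add: s_def)
  have s2: "?k * (2 * s) < \<delta>" "?k * (2 * s) < \<eta> / 2"
  proof -
    have "?k * (2 * s) = min \<delta> \<eta> / 4" using km by (simp add: s_def)
    then show "?k * (2 * s) < \<delta>" "?k * (2 * s) < \<eta> / 2" using \<delta> \<eta> by auto
  qed
  \<comment> \<open>The two choices give 2 \<kappa> m = c / 2 and \<theta> k R^2 = c / 4. As each
    regularised logarithm is at least -2 N, this keeps \<open>w\<close> above -(3/4) c N - C0, hence
    above M - c N + 3 for large \<open>N\<close>.\<close>
  define \<kappa> where "\<kappa> = c / (4 * ?m)"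
  define \<theta> where "\<theta> = c / (4 * ?k * R\<^sup>2)"
  have \<kappa>\<theta>: "0 < \<kappa>" "0 < \<theta>" using c km R by (auto simp: \<kappa>_def \<theta>_def)
  \<comment> \<open>Bounds the logarithmic terms from above on \<open>\<Omega>\<close> and adds 1,
    so that \<open>w\<close> is at most -1 there; near the boundary the approximants lie above -1
    because they tend to 0.\<close>
  define C0 where "C0 = \<kappa> * ?m * ln (R\<^sup>2 + 1) + 1"
  \<comment> \<open>A lower bound for the contribution of the logarithmic factors on the box:
    density \<kappa> / (4 r^2) times area (r / m)^2 for each square, in which \<open>r\<close>
    cancels.\<close>
  define c2 where "c2 = (\<kappa> / (4 * ?m\<^sup>2)) ^ CARD('m)"
  have c2: "0 < c2" using \<kappa>\<theta> km by (simp add: c2_def)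
  obtain N :: nat where N: "max (max (max (real i0) 1) (max (ln (2 / \<eta>)) (4 * (M + C0 + 3) / c)))
      (max (1 / (4 * \<theta> * s\<^sup>2)) (Mm / (c2 * (4 * \<theta> * s\<^sup>2)))) < real N"
    using reals_Archimedean2 by blast
  have N1: "i0 \<le> N" "1 \<le> real N" using N by auto
  have N2: "exp (- real N) < \<eta> / 2"
  proof -
    have "exp (- real N) < exp (- ln (2 / \<eta>))" using N by simp
    also have "\<dots> = \<eta> / 2" using \<eta> by (simp add: exp_minus)
    finally show ?thesis .
  qed
  have N3: "M - c * real N + 3 < - (3/4 * c * real N) - C0"
  proof -
    have "4 * (M + C0 + 3) / c < real N" using N by simp
    then have "4 * (M + C0 + 3) < c * real N" using c by (simp add: pos_divide_less_eq mult.commute)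
    then show ?thesis by simp
  qed
  have N4: "1 \<le> 4 * \<theta> * s\<^sup>2 * real N" "Mm < c2 * (4 * \<theta> * s\<^sup>2 * real N)"
  proof -
    have q: "0 < 4 * \<theta> * s\<^sup>2" using \<kappa>\<theta> s by simp
    have "1 / (4 * \<theta> * s\<^sup>2) < real N" using N by simp
    then show "1 \<le> 4 * \<theta> * s\<^sup>2 * real N" using q by (simp add: pos_divide_less_eq mult.commute)
    have "Mm / (c2 * (4 * \<theta> * s\<^sup>2)) < real N" using N by simp
    then have "Mm < real N * (c2 * (4 * \<theta> * s\<^sup>2))"
      using mult_pos_pos[OF c2 q] by (simp only: pos_divide_less_eq)
    then show "Mm < c2 * (4 * \<theta> * s\<^sup>2 * real N)" by (simp only: mult_ac)
  qed
  define r where "r = exp (- real N)"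
  have r: "0 < r" "r \<le> 1" by (auto simp: r_def)
  define D where "D i n x = (case i of
      Inl a \<Rightarrow> (if n = 0 then \<theta> * real N * x else if n = 1 then \<theta> * real N else 0)
    | Inr b \<Rightarrow> (if n = 0 then \<kappa> * ln (x + r\<^sup>2) else if n = 1 then \<kappa> / (x + r\<^sup>2)
         else if n = 2 then - \<kappa> / (x + r\<^sup>2)\<^sup>2 else 2 * \<kappa> / (x + r\<^sup>2) ^ 3))"
    for i :: "'k + 'm" and n :: nat and x :: real
  define cc where "cc = - (\<theta> * real N * ?k * R\<^sup>2) - C0"
  have Dpos: "D (Inr b) 1 x + x * D (Inr b) 2 x = \<kappa> * r\<^sup>2 / (x + r\<^sup>2)\<^sup>2" if "0 \<le> x" for b x
  proof -
    have "x + r\<^sup>2 > 0" using that r by (simp add: add_nonneg_pos)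
    then have "\<kappa> / (x + r\<^sup>2) = \<kappa> * (x + r\<^sup>2) / (x + r\<^sup>2)\<^sup>2" by (simp add: power2_eq_square)
    then show ?thesis by (simp add: D_def diff_divide_distrib[symmetric] algebra_simps)
  qed
  have Dl: "D (Inl a) 1 x + x * D (Inl a) 2 x = \<theta> * real N" for a x by (simp add: D_def)
  interpret W: coord_sum D "r\<^sup>2" p cc
  proof
    show "0 < r\<^sup>2" using r by simp
    fix i :: "'k + 'm" and n :: nat and x :: real assume n: "n < 3" and x: "- r\<^sup>2 < x"
    then have x0: "0 < x + r\<^sup>2" by simp
    show "(D i n has_real_derivative D i (Suc n) x) (at x)"
    proof (cases i)
      case (Inl a)
      then show ?thesis unfolding D_def by (cases "n = 0") (auto intro!: derivative_eq_intros)
    next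
      case (Inr b)
      consider "n = 0" | "n = 1" | "n = 2" using n by linarith
      then show ?thesis
      proof cases
        case 1
        then show ?thesis unfolding D_def Inr using x0 by (auto intro!: derivative_eq_intros)
      next
        case 2
        then show ?thesis unfolding D_def Inr using x0
          by (auto intro!: derivative_eq_intros simp: power2_eq_square field_simps)
      next
        case 3
        have "((\<lambda>y. - \<kappa> / y\<^sup>2) has_real_derivative 2 * \<kappa> / y ^ 3) (at y)" if "0 < y" for y
          using that by (auto intro!: derivative_eq_intros simp: power2_eq_square power3_eq_cube field_simps)
        from this[OF x0] have "((\<lambda>x. - \<kappa> / (x + r\<^sup>2)\<^sup>2) has_real_derivative 2 * \<kappa> / (x + r\<^sup>2) ^ 3) (at x)"
          by (simp only: DERIV_shift)
        then show ?thesis unfolding D_def Inr using 3 by simp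
      qed
    qed
  next
    fix i :: "'k + 'm"
    show "continuous_on {- r\<^sup>2<..} (D i 3)"
    proof (cases i)
      case (Inr b)
      have eq: "D i 3 = (\<lambda>x. 2 * \<kappa> / (x + r\<^sup>2) ^ 3)" by (simp add: D_def Inr fun_eq_iff)
      show ?thesis unfolding eq by (intro continuous_intros) (auto simp: less_le)
    qed (simp add: D_def[abs_def])
  next
    fix i :: "'k + 'm" and x :: real assume "0 \<le> x"
    then show "0 \<le> D i 1 x + x * D i 2 x"
      using Dpos[of x] Dl \<kappa>\<theta> by (cases i) auto
  qed
  have w_eq: "W.w z = (\<Sum>a\<in>UNIV. \<theta> * real N * W.s (Inl a) z) + (\<Sum>b\<in>UNIV. \<kappa> * ln (W.s (Inr b) z + r\<^sup>2)) + cc" for z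
    unfolding W.w_def sum_UNIV_sum by (simp add: D_def)
  have w_neg: "W.w z \<le> - 1" if z: "z \<in> \<Omega>" for z
  proof -
    have sR: "W.s i z \<le> R\<^sup>2" for i using R(2)[OF z, of i] by (intro power_mono) auto
    have "(\<Sum>a\<in>UNIV. \<theta> * real N * W.s (Inl a) z) \<le> (\<Sum>a\<in>(UNIV::'k set). \<theta> * real N * R\<^sup>2)"
      using \<kappa>\<theta> sR by (intro sum_mono mult_left_mono) auto
    moreover have "(\<Sum>b\<in>UNIV. \<kappa> * ln (W.s (Inr b) z + r\<^sup>2)) \<le> (\<Sum>b\<in>(UNIV::'m set). \<kappa> * ln (R\<^sup>2 + 1))"
    proof (intro sum_mono mult_left_mono)
      fix b :: 'm
      have "r\<^sup>2 \<le> 1" using r by (simp add: power_le_one)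
      moreover have "0 < W.s (Inr b) z + r\<^sup>2" using r by (simp add: add_nonneg_pos)
      ultimately show "ln (W.s (Inr b) z + r\<^sup>2) \<le> ln (R\<^sup>2 + 1)" using sR[of "Inr b"] by (subst ln_le_cancel_iff) auto
    qed (use \<kappa>\<theta> in auto)
    ultimately show ?thesis unfolding w_eq unfolding cc_def C0_def by (simp add: mult_ac)
  qed
  have w_ge: "- (3/4 * c * real N) - C0 \<le> W.w z" for z
  proof -
    have "0 \<le> (\<Sum>a\<in>UNIV. \<theta> * real N * W.s (Inl a) z)" using \<kappa>\<theta> by (intro sum_nonneg) auto
    moreover have "(\<Sum>b\<in>(UNIV::'m set). \<kappa> * (- 2 * real N)) \<le> (\<Sum>b\<in>UNIV. \<kappa> * ln (W.s (Inr b) z + r\<^sup>2))"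
    proof (intro sum_mono mult_left_mono)
      fix b :: 'm
      have "- 2 * real N = ln (r\<^sup>2)" using r by (simp add: ln_realpow r_def)
      also have "\<dots> \<le> ln (W.s (Inr b) z + r\<^sup>2)" using r by (subst ln_le_cancel_iff) (auto simp: add_nonneg_pos)
      finally show "- 2 * real N \<le> ln (W.s (Inr b) z + r\<^sup>2)" .
    qed (use \<kappa>\<theta> in auto)
    moreover have "(\<Sum>b\<in>(UNIV::'m set). \<kappa> * (- 2 * real N)) = - (c * real N / 2)" using km by (simp add: \<kappa>_def)
    moreover have "\<theta> * real N * ?k * R\<^sup>2 = c * real N / 4" using km R by (simp add: \<theta>_def)
    ultimately show ?thesis unfolding w_eq unfolding cc_def by linarith
  qed
  \<comment> \<open>The last sides shrink with \<open>r = exp (- N)\<close>, so that m coordinates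
    of modulus at most r / m stay within the range of \<open>ub\<close>; the first sides do not
    depend on \<open>N\<close>.\<close>
  define t where "t i = (case i of Inl a \<Rightarrow> s | Inr b \<Rightarrow> r / (2 * ?m))" for i :: "'k + 'm"
  have t0: "0 \<le> t i" for i using s r by (cases i) (auto simp: t_def)
  define T where "T = polybox p t"
  have cT: "compact T" by (simp add: T_def polybox_def)
  have T1: "(\<Sum>a\<in>UNIV. cmod (z $ Inl a - p $ Inl a)) \<le> ?k * (2 * s)" "(\<Sum>b\<in>UNIV. cmod (z $ Inr b - p $ Inr b)) \<le> r"
    if "z \<in> T" for z
  proof -
    have "(\<Sum>a\<in>UNIV. cmod (z $ Inl a - p $ Inl a)) \<le> (\<Sum>a\<in>(UNIV::'k set). 2 * s)"
    proof (rule sum_mono)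
      fix a :: 'k
      show "cmod (z $ Inl a - p $ Inl a) \<le> 2 * s"
        using cmod_polybox[of z p t "Inl a"] that by (simp add: T_def t_def)
    qed
    then show "(\<Sum>a\<in>UNIV. cmod (z $ Inl a - p $ Inl a)) \<le> ?k * (2 * s)" by simp
    have "cmod (z $ Inr b - p $ Inr b) \<le> r / ?m" for b
      using cmod_polybox[of z p t "Inr b"] that by (simp add: T_def t_def)
    then have "(\<Sum>b\<in>UNIV. cmod (z $ Inr b - p $ Inr b)) \<le> (\<Sum>b\<in>(UNIV::'m set). r / ?m)" by (intro sum_mono)
    then show "(\<Sum>b\<in>UNIV. cmod (z $ Inr b - p $ Inr b)) \<le> r" by simp
  qed
  have Tb: "T \<subseteq> ball p \<eta>"
  proof
    fix z assume z: "z \<in> T"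
    have "norm (z - p) \<le> ?k * (2 * s) + r"
      using norm_le_sum_cmod[of "z - p"] T1[OF z] unfolding sum_UNIV_sum by simp
    then show "z \<in> ball p \<eta>" using s2 N2 by (simp add: dist_norm norm_minus_commute r_def)
  qed
  have T\<Omega>: "T \<subseteq> \<Omega>" using Tb \<eta> ball_subset_cball by blast
  have uT: "u z < ereal (W.w z - 3)" if "z \<in> T" for z
  proof -
    have "u z \<le> ereal (M - c * real N)" by (rule ub[OF N1(1)]) (use T1[OF that] s2 in \<open>auto simp: r_def\<close>)
    also have "\<dots> < ereal (W.w z - 3)" using N3 w_ge[of z] by simp
    finally show ?thesis .
  qed
  have Fus: "usc_on \<Omega> (F j)" for j using F(1) by (simp add: cE0_def psh_on_def)
  \<comment> \<open>On the compact \<open>T\<close> the sequence decreases to \<open>g\<close>,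
    which equals \<open>u\<close> there, so a single bounded member of it already lies below
    \<open>w - 3\<close> on all of \<open>T\<close>.\<close>
  obtain j where j: "\<And>z. z \<in> T \<Longrightarrow> F j z < ereal (W.w z - 3)"
  proof -
    have "\<exists>n. \<forall>j z. n \<le> j \<longrightarrow> z \<in> T \<longrightarrow> z \<in> {z\<in>\<Omega>. F j z < ereal (W.w z - 3)}"
    proof (rule compact_increasing_cover[OF cT, of "\<lambda>j. {z\<in>\<Omega>. F j z < ereal (W.w z - 3)}"])
      show "open {z\<in>\<Omega>. F j z < ereal (W.w z - 3)}" for j
        by (intro open_usc_less_continuous Fus op continuous_intros Ck_imp_continuous[OF W.Ck_w])
      show "T \<subseteq> (\<Union>j. {z\<in>\<Omega>. F j z < ereal (W.w z - 3)})"
      proof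
        fix z assume z: "z \<in> T"
        then have "g z < ereal (W.w z - 3)" using g(2) Tb uT by auto
        then have "\<forall>\<^sub>F j in sequentially. F j z < ereal (W.w z - 3)"
          using F(3)[of z] z T\<Omega> by (intro order_tendstoD) auto
        then obtain j where "F j z < ereal (W.w z - 3)" using eventually_sequentially by auto
        then show "z \<in> (\<Union>j. {z\<in>\<Omega>. F j z < ereal (W.w z - 3)})" using z T\<Omega> by blast
      qed
      show "z \<in> {z\<in>\<Omega>. F (Suc j) z < ereal (W.w z - 3)}" if "z \<in> T" "z \<in> {z\<in>\<Omega>. F j z < ereal (W.w z - 3)}" for j z
        using that F(2)[of z j] by (auto intro: le_less_trans)
    qed blast
    then show thesis using that by blast
  qed
  obtain B where B: "\<And>z. z \<in> \<Omega> \<Longrightarrow> \<bar>F j z\<bar> \<le> ereal B" using F(1)[of j] by (auto simp: cE0_def)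
  obtain K where K: "compact K" "K \<subseteq> \<Omega>" "\<And>z. z \<in> \<Omega> - K \<Longrightarrow> \<bar>F j z\<bar> < ereal 1"
    using F(1)[of j] unfolding cE0_def by (metis ereal_less(3) zero_less_one)
  define f where "f z = (if z \<in> \<Omega> then real_of_ereal (F j z) else 0)" for z
  have fF: "F j z = ereal (f z)" if "z \<in> \<Omega>" for z using B[OF that] that by (cases "F j z") (auto simp: f_def)
  interpret bounded_psh \<Omega> f B
  proof
    show "psh_on \<Omega> (\<lambda>z. ereal (f z))"
      by (rule psh_on_cong[of \<Omega> "F j"]) (use fF F(1)[of j] in \<open>auto simp: cE0_def\<close>)
    have "0 \<le> B" using B[OF p] by (cases "F j p") auto
    then show "\<bar>f z\<bar> \<le> B" for z
    proof (cases "z \<in> \<Omega>")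
      case True
      show ?thesis using B[OF True] unfolding fF[OF True] by simp
    qed (simp add: f_def)
  qed (use op bO in \<open>auto simp: f_def\<close>)
  have "ereal (LINT z:T|lborel. mad W.w z) \<le> ma_mass \<Omega> (F j)"
  proof (rule ma_mass_ge[OF fF W.Ck_w W.psd_w K(1,2) _ cT T\<Omega>])
    show "W.w z \<le> f z" if "z \<in> \<Omega> - K" for z
      using K(3)[OF that] w_neg[of z] fF[of z] that by auto
    have "p \<in> T" using t0 by (simp add: T_def mem_polybox)
    then show "T \<noteq> {}" by blast
    show "f z + 3 < W.w z" if "z \<in> T" for z using j[OF that] fF[of z] that T\<Omega> by auto
  qed
  then have up: "(LINT z:T|lborel. mad W.w z) \<le> Mm" using Mm[of j] by (metis ereal_less_eq(3) order_trans)
  \<comment> \<open>Lower bounds for the factors of the density: on \<open>T\<close> the squared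
    modulus x of a last coordinate is at most r^2, so \<kappa> r^2 / (x + r^2)^2 is at least
    \<kappa> / (4 r^2).\<close>
  define q where "q i = (case i of Inl a \<Rightarrow> \<theta> * real N | Inr b \<Rightarrow> \<kappa> / (4 * r\<^sup>2))" for i :: "'k + 'm"
  have q0: "0 \<le> q i" for i using \<kappa>\<theta> by (cases i) (auto simp: q_def)
  have mad_ge: "(\<Prod>i\<in>UNIV. q i) \<le> mad W.w z" if z: "z \<in> T" for z
    unfolding W.mad_w
  proof (rule prod_mono, intro conjI q0)
    fix i :: "'k + 'm"
    show "q i \<le> D i 1 (W.s i z) + W.s i z * D i 2 (W.s i z)"
    proof (cases i)
      case (Inl a)
      then show ?thesis using Dl by (simp add: q_def)
    next
      case (Inr b)
      have "cmod (z $ i - p $ i) \<le> r / ?m" using cmod_polybox[of z p t i] z by (simp add: T_def t_def Inr)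
      also have "\<dots> \<le> r" using km r by (simp add: divide_le_eq mult_le_cancel_left1)
      finally have "W.s i z \<le> r\<^sup>2" by (intro power_mono) auto
      then have "(W.s i z + r\<^sup>2)\<^sup>2 \<le> (2 * r\<^sup>2)\<^sup>2" by (intro power_mono) auto
      moreover have "0 < (W.s i z + r\<^sup>2)\<^sup>2" using r by (simp add: add_nonneg_pos)
      ultimately have "\<kappa> * r\<^sup>2 / (2 * r\<^sup>2)\<^sup>2 \<le> \<kappa> * r\<^sup>2 / (W.s i z + r\<^sup>2)\<^sup>2"
        using \<kappa>\<theta> r by (intro divide_left_mono) auto
      moreover have "\<kappa> * r\<^sup>2 / (2 * r\<^sup>2)\<^sup>2 = q i" using r by (simp add: q_def Inr power2_eq_square)
      ultimately show ?thesis using Dpos[of "W.s i z" b] Inr by simp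
    qed
  qed
  have "(\<Prod>i\<in>UNIV. q i) * (\<Prod>i\<in>UNIV. (2 * t i)\<^sup>2) = (\<Prod>i\<in>UNIV. q i) * measure lborel T"
    unfolding T_def using measure_polybox[of t p] t0 by simp
  also have "\<dots> = (LINT z:T|lborel. (\<Prod>i\<in>UNIV. q i))"
    using cT by (simp add: set_lebesgue_integral_def compact_imp_closed emeasure_compact_finite mult.commute)
  also have "\<dots> \<le> (LINT z:T|lborel. mad W.w z)"
    by (rule set_integral_mono[OF set_integrable_compact[OF cT subset_UNIV continuous_on_const]
          set_integrable_compact[OF cT subset_UNIV continuous_on_mad[OF open_UNIV W.Ck_w]]]) (rule mad_ge)
  finally have low: "(\<Prod>i\<in>UNIV. q i * (2 * t i)\<^sup>2) \<le> Mm" using up by (simp add: prod.distrib)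
  have "(\<Prod>i\<in>UNIV. q i * (2 * t i)\<^sup>2) = (4 * \<theta> * s\<^sup>2 * real N) ^ CARD('k) * c2"
  proof -
    have ql: "q (Inl a) * (2 * t (Inl a))\<^sup>2 = 4 * \<theta> * s\<^sup>2 * real N" for a by (simp add: q_def t_def power2_eq_square)
    have qr: "q (Inr b) * (2 * t (Inr b))\<^sup>2 = \<kappa> / (4 * ?m\<^sup>2)" for b
      using r km by (simp add: q_def t_def power2_eq_square field_simps)
    show ?thesis unfolding prod_UNIV_sum c2_def ql qr by simp
  qed
  \<comment> \<open>There is at least one first variable and the base is at least 1, so the power
    dominates its base, and linear growth in \<open>N\<close> already exceeds the fixed bound
    \<open>Mm\<close>.\<close>
  moreover have "4 * \<theta> * s\<^sup>2 * real N \<le> (4 * \<theta> * s\<^sup>2 * real N) ^ CARD('k)"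
    by (rule self_le_power[OF N4(1)]) simp
  ultimately have "(4 * \<theta> * s\<^sup>2 * real N) * c2 \<le> Mm" using low c2 by (smt (verit) mult_right_mono)
  then show False using N4(2) by (simp add: mult.commute)
qed

section \<open>Slices with positive Lelong number\<close>

lemma vjoin_nth [simp]: "vjoin x y $ Inl a = x $ a" "vjoin x y $ Inr b = y $ b"
  by (simp_all add: vjoin_def)

lemma vjoin_split: "vjoin (\<chi> a. z $ Inl a) (\<chi> b. z $ Inr b) = z"
  by (simp add: vec_eq_iff vjoin_def split: sum.split)

lemma dist_vjoin:
  fixes x x' :: "complex^'k::finite" and y y' :: "complex^'m::finite"
  shows "dist (vjoin x y) (vjoin x' y) = dist x x'" "dist (vjoin x y) (vjoin x y') = dist y y'"
proof -
  have "(dist (vjoin x y) (vjoin x' y))\<^sup>2 = (dist x x')\<^sup>2" "(dist (vjoin x y) (vjoin x y'))\<^sup>2 = (dist y y')\<^sup>2"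
    unfolding dist_norm norm_vec_square sum_UNIV_sum by simp_all
  then show "dist (vjoin x y) (vjoin x' y) = dist x x'" "dist (vjoin x y) (vjoin x y') = dist y y'"
    by (auto simp: power2_eq_iff_nonneg)
qed

lemma vjoin_add_smult:
  "vjoin x y + (\<zeta>::complex) *s vjoin b 0 = vjoin (x + \<zeta> *s b) y" "vjoin x y + \<zeta> *s vjoin 0 d = vjoin x (y + \<zeta> *s d)"
  by (simp_all add: vec_eq_iff vjoin_def split: sum.split)

lemma prod_dom_eq: "prod_dom A B = {z. (\<chi> a. z $ Inl a) \<in> A \<and> (\<chi> b. z $ Inr b) \<in> B}"
proof (intro equalityI subsetI)
  fix z assume "z \<in> prod_dom A B"
  then obtain x y where "x \<in> A" "y \<in> B" "z = vjoin x y" by (auto simp: prod_dom_def)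
  then show "z \<in> {z. (\<chi> a. z $ Inl a) \<in> A \<and> (\<chi> b. z $ Inr b) \<in> B}" by (simp add: vec_lambda_eta)
next
  fix z assume "z \<in> {z. (\<chi> a. z $ Inl a) \<in> A \<and> (\<chi> b. z $ Inr b) \<in> B}"
  then have "vjoin (\<chi> a. z $ Inl a) (\<chi> b. z $ Inr b) \<in> prod_dom A B" unfolding prod_dom_def by blast
  then show "z \<in> prod_dom A B" by (simp add: vjoin_split)
qed

lemma vjoin_in_prod_dom: "vjoin x y \<in> prod_dom A B \<longleftrightarrow> x \<in> A \<and> y \<in> B"
  by (simp add: prod_dom_eq vec_lambda_eta)

lemma open_prod_dom:
  fixes A :: "(complex^'k) set" and B :: "(complex^'m) set"
  assumes "open A" "open B"
  shows "open (prod_dom A B)"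
proof -
  have "open ((\<lambda>z::complex^('k+'m). \<chi> a. z $ Inl a) -` A)" "open ((\<lambda>z::complex^('k+'m). \<chi> b. z $ Inr b) -` B)"
    by (intro open_vimage assms continuous_on_vec_lambda continuous_on_component continuous_on_id)+
  moreover have "prod_dom A B = (\<lambda>z. \<chi> a. z $ Inl a) -` A \<inter> (\<lambda>z. \<chi> b. z $ Inr b) -` B"
    by (auto simp: prod_dom_eq)
  ultimately show ?thesis by (simp add: open_Int)
qed

lemma continuous_on_vjoin:
  fixes f :: "'a::topological_space \<Rightarrow> complex^'k" and g :: "'a \<Rightarrow> complex^'m"
  assumes "continuous_on S f" "continuous_on S g"
  shows "continuous_on S (\<lambda>x. vjoin (f x) (g x))"
  unfolding vjoin_def
proof (rule continuous_on_vec_lambda)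
  fix i :: "'k + 'm"
  show "continuous_on S (\<lambda>x. case i of Inl a \<Rightarrow> f x $ a | Inr b \<Rightarrow> g x $ b)"
    by (cases i) (auto intro!: continuous_intros assms)
qed

lemma bounded_prod_dom:
  fixes A :: "(complex^'k) set" and B :: "(complex^'m) set"
  assumes "bounded A" "bounded B"
  shows "bounded (prod_dom A B)"
proof -
  obtain r s where r: "\<And>x. x \<in> A \<Longrightarrow> norm x \<le> r" and s: "\<And>y. y \<in> B \<Longrightarrow> norm y \<le> s"
    using assms by (auto simp: bounded_iff)
  have "norm (vjoin x y) \<le> r + s" if "x \<in> A" "y \<in> B" for x y
  proof -
    have z: "vjoin 0 0 = (0 :: complex^('k+'m))" by (simp add: vec_eq_iff vjoin_def split: sum.split)
    have "norm (vjoin x y) = dist (vjoin x y) (vjoin 0 0 :: complex^('k+'m))" by (simp add: z)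
    also have "\<dots> \<le> dist (vjoin x y) (vjoin 0 y) + dist (vjoin 0 y) (vjoin 0 0 :: complex^('k+'m))" by (rule dist_triangle)
    also have "\<dots> = norm x + norm y" by (simp add: dist_vjoin)
    finally show ?thesis using r[OF that(1)] s[OF that(2)] by simp
  qed
  then show ?thesis by (auto simp: bounded_iff prod_dom_def)
qed

section \<open>Operations that preserve the super-mean value property\<close>

lemma ennreal_mult_le_iff_inverse:
  fixes c :: real and y k :: ennreal
  assumes "0 < c"
  shows "ennreal c * y \<le> k \<longleftrightarrow> y \<le> ennreal (inverse c) * k"
proof
  have i: "ennreal (inverse c) * ennreal c = 1" "ennreal c * ennreal (inverse c) = 1"
    using assms by (simp_all add: ennreal_mult[symmetric])
  show "y \<le> ennreal (inverse c) * k" if "ennreal c * y \<le> k"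
    using mult_left_mono[OF that, of "ennreal (inverse c)"] i by (simp add: mult.assoc[symmetric])
  show "ennreal c * y \<le> k" if "y \<le> ennreal (inverse c) * k"
    using mult_left_mono[OF that, of "ennreal c"] i by (simp add: mult.assoc[symmetric])
qed

lemma ennreal_inverse_mult_le_iff:
  fixes c :: real and y k :: ennreal
  assumes "0 < c"
  shows "ennreal (inverse c) * y \<le> k \<longleftrightarrow> y \<le> ennreal c * k"
  using ennreal_mult_le_iff_inverse[of "inverse c" y k] assms by simp

lemma super_on_cmult:
  fixes h :: "complex^'n::finite \<Rightarrow> ennreal"
  assumes h: "super_on V h" and c: "0 < c"
  shows "super_on V (\<lambda>z. ennreal c * h z)"
  unfolding super_on_def
proof (intro conjI allI impI)
  show "open V" using h by (simp add: super_on_def)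
  have "{x\<in>V. k < ennreal c * h x} = {x\<in>V. ennreal (inverse c) * k < h x}" for k
    using ennreal_mult_le_iff_inverse[OF c] by (auto simp: not_le[symmetric])
  then show "open {x\<in>V. k < ennreal c * h x}" for k using h by (simp add: super_on_def)
  fix a b assume ab: "\<forall>\<zeta>. cmod \<zeta> \<le> 1 \<longrightarrow> a + \<zeta> *s b \<in> V"
  have m: "(\<lambda>t. h (a + cis t *s b)) \<in> borel_measurable borel"
    by (rule super_on_circle_measurable[OF h]) (use ab in simp)
  have "(\<integral>\<^sup>+t. ennreal c * h (a + cis t *s b) * indicator {0..2*pi} t \<partial>lborel)
      = ennreal c * (\<integral>\<^sup>+t. h (a + cis t *s b) * indicator {0..2*pi} t \<partial>lborel)"
    unfolding mult.assoc by (rule nn_integral_cmult) (use m in simp)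
  also have "\<dots> \<le> ennreal c * (ennreal (2*pi) * h a)"
    using h ab unfolding super_on_def by (intro mult_left_mono) auto
  finally show "(\<integral>\<^sup>+t. ennreal c * h (a + cis t *s b) * indicator {0..2*pi} t \<partial>lborel)
      \<le> ennreal (2*pi) * (ennreal c * h a)" by (simp add: mult_ac)
qed

text \<open>Addition is continuous, so the inequality persists for slightly smaller summands;
  positivity guarantees that there is something below each of them. This gives lower semicontinuity
  of sums.\<close>

lemma ennreal_less_add_split:
  fixes k y z :: ennreal
  assumes "k < y + z" "0 < y" "0 < z"
  obtains a b where "a < y" "b < z" "k \<le> a + b"
proof -
  have "open {p :: ennreal \<times> ennreal. k < fst p + snd p}"
    by (intro open_Collect_less continuous_intros)
  then obtain A B where AB: "open A" "open B" "(y, z) \<in> A \<times> B" "A \<times> B \<subseteq> {p. k < fst p + snd p}"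
    using assms(1) by (auto elim!: open_prod_elim[where x = "(y, z)"])
  obtain a0 where a0: "a0 < y" "{a0<..y} \<subseteq> A" using open_left[of A y 0] AB assms by auto
  obtain b0 where b0: "b0 < z" "{b0<..z} \<subseteq> B" using open_left[of B z 0] AB assms by auto
  obtain a b where "a0 < a" "a < y" "b0 < b" "b < z" using dense a0(1) b0(1) by metis
  moreover then have "(a, b) \<in> A \<times> B" using a0 b0 by auto
  ultimately show thesis using that[of a b] AB(4) by fastforce
qed

lemma open_less_add:
  fixes h1 h2 :: "'a::topological_space \<Rightarrow> ennreal"
  assumes "\<And>c. open {x\<in>V. c < h1 x}" "\<And>c. open {x\<in>V. c < h2 x}"
  shows "open {x\<in>V. c < h1 x + h2 x}"
proof (subst open_subopen, safe)
  fix x assume x: "x \<in> V" "c < h1 x + h2 x"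
  show "\<exists>T. open T \<and> x \<in> T \<and> T \<subseteq> {x\<in>V. c < h1 x + h2 x}"
  proof (cases "h1 x = 0 \<or> h2 x = 0")
    case True
    then show ?thesis
    proof
      assume "h1 x = 0"
      then show ?thesis using x assms(2)[of c]
        by (intro exI[of _ "{x\<in>V. c < h2 x}"]) (auto intro: less_le_trans add_increasing)
    next
      assume "h2 x = 0"
      then show ?thesis using x assms(1)[of c]
        by (intro exI[of _ "{x\<in>V. c < h1 x}"]) (auto intro: less_le_trans add_increasing2)
    qed
  next
    case False
    then obtain a b where ab: "a < h1 x" "b < h2 x" "c \<le> a + b"
      using ennreal_less_add_split[OF x(2)] by (auto simp: zero_less_iff_neq_zero)
    have "c < h1 y + h2 y" if "a < h1 y" "b < h2 y" for y
      using ab(3) add_strict_mono[OF that] by (rule le_less_trans)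
    then show ?thesis using x ab assms
      by (intro exI[of _ "{x\<in>V. a < h1 x} \<inter> {x\<in>V. b < h2 x}"]) auto
  qed
qed

text \<open>The partial sums increase, so a superlevel set of the series is the union of those of
  the partial sums, and the circle integral can be taken term by term.\<close>

lemma super_on_suminf:
  fixes h :: "nat \<Rightarrow> complex^'n::finite \<Rightarrow> ennreal"
  assumes h: "\<And>j. super_on V (h j)"
  shows "super_on V (\<lambda>z. \<Sum>j. h j z)"
  unfolding super_on_def
proof (intro conjI allI impI)
  show oV: "open V" using h[of 0] by (simp add: super_on_def)
  have fin: "open {x\<in>V. c < (\<Sum>j<n. h j x)}" for n c
  proof (induction n arbitrary: c)
    case 0
    then show ?case using oV by simp
  next
    case (Suc n)
    have "open {x\<in>V. c < (\<Sum>j<n. h j x) + h n x}"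
      by (rule open_less_add) (use Suc h in \<open>auto simp: super_on_def\<close>)
    then show ?case by simp
  qed
  have "{x\<in>V. c < (\<Sum>j. h j x)} = (\<Union>n. {x\<in>V. c < (\<Sum>j<n. h j x)})" for c
    by (auto simp: suminf_eq_SUP less_SUP_iff)
  then show "open {x\<in>V. c < (\<Sum>j. h j x)}" for c using fin by (simp add: open_UN)
  fix a b assume ab: "\<forall>\<zeta>. cmod \<zeta> \<le> 1 \<longrightarrow> a + \<zeta> *s b \<in> V"
  have m: "(\<lambda>t. h j (a + cis t *s b)) \<in> borel_measurable borel" for j
    by (rule super_on_circle_measurable[OF h]) (use ab in simp)
  have "(\<integral>\<^sup>+t. (\<Sum>j. h j (a + cis t *s b)) * indicator {0..2*pi} t \<partial>lborel)
      = (\<integral>\<^sup>+t. (\<Sum>j. h j (a + cis t *s b) * indicator {0..2*pi} t) \<partial>lborel)"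
    by (simp add: ennreal_suminf_multc)
  also have "\<dots> = (\<Sum>j. \<integral>\<^sup>+t. h j (a + cis t *s b) * indicator {0..2*pi} t \<partial>lborel)"
    by (rule nn_integral_suminf) (use m in simp)
  also have "\<dots> \<le> (\<Sum>j. ennreal (2*pi) * h j a)"
    using h ab unfolding super_on_def by (intro suminf_le) auto
  finally show "(\<integral>\<^sup>+t. (\<Sum>j. h j (a + cis t *s b)) * indicator {0..2*pi} t \<partial>lborel) \<le> ennreal (2*pi) * (\<Sum>j. h j a)"
    by (simp add: ennreal_suminf_cmult)
qed

text \<open>The infimum lies below each member, so its circle integral lies below 2 \<pi> times each
  value at the centre and hence below 2 \<pi> times their infimum. Lower semicontinuity is where
  compactness of \<open>C\<close> enters, through a tube around the fibre over
  \<open>x\<close>.\<close>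

lemma super_on_INF:
  fixes H :: "complex^('k::finite + 'm::finite) \<Rightarrow> ennreal"
  assumes H: "super_on (prod_dom V W) H" and V: "open V" and C: "compact C" "C \<subseteq> W" "C \<noteq> {}"
  shows "super_on V (\<lambda>x. INF y\<in>C. H (vjoin x y))"
  unfolding super_on_def
proof (intro conjI allI impI V)
  fix c
  show "open {x\<in>V. c < (INF y\<in>C. H (vjoin x y))}"
  proof (subst open_subopen, safe)
    fix x assume x: "x \<in> V" "c < (INF y\<in>C. H (vjoin x y))"
    \<comment> \<open>Values above \<open>c'\<close> have an infimum that is only at least
      \<open>c'\<close>, so the strict bound by \<open>c\<close> needs this intermediate
      level.\<close>
    obtain c' where c': "c < c'" "c' < (INF y\<in>C. H (vjoin x y))" using dense[OF x(2)] by blast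
    let ?O = "{z\<in>prod_dom V W. c' < H z}"
    have "open ?O" using H by (simp add: super_on_def)
    moreover have "compact ((\<lambda>y. vjoin x y) ` C)"
      by (intro compact_continuous_image C continuous_on_vjoin continuous_intros)
    moreover have "(\<lambda>y. vjoin x y) ` C \<subseteq> ?O"
      using c'(2) C x(1) by (auto simp: vjoin_in_prod_dom intro: less_INF_D)
    ultimately obtain r where r: "r > 0" "\<And>z z'. z \<in> (\<lambda>y. vjoin x y) ` C \<Longrightarrow> dist z z' < r \<Longrightarrow> z' \<in> ?O"
      using compact_in_open_margin[of "(\<lambda>y. vjoin x y) ` C" ?O] by blast
    have "ball x r \<subseteq> {x\<in>V. c < (INF y\<in>C. H (vjoin x y))}"
    proof
      fix x' assume x': "x' \<in> ball x r"
      have *: "vjoin x' y \<in> ?O" if "y \<in> C" for y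
        by (rule r(2)[of "vjoin x y"]) (use x' that in \<open>auto simp: dist_vjoin\<close>)
      have "c' \<le> (INF y\<in>C. H (vjoin x' y))" by (rule INF_greatest) (use * in force)
      moreover have "x' \<in> V" using * C(3) by (auto simp: vjoin_in_prod_dom)
      ultimately show "x' \<in> {x\<in>V. c < (INF y\<in>C. H (vjoin x y))}" using c'(1) by (auto intro: less_le_trans)
    qed
    then show "\<exists>T. open T \<and> x \<in> T \<and> T \<subseteq> {x\<in>V. c < (INF y\<in>C. H (vjoin x y))}"
      using r(1) by (intro exI[of _ "ball x r"]) auto
  qed
next
  fix a b assume ab: "\<forall>\<zeta>. cmod \<zeta> \<le> 1 \<longrightarrow> a + \<zeta> *s b \<in> V"
  let ?I = "\<integral>\<^sup>+t. (INF y\<in>C. H (vjoin (a + cis t *s b) y)) * indicator {0..2*pi} t \<partial>lborel"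
  have "?I \<le> ennreal (2*pi) * H (vjoin a y)" if y: "y \<in> C" for y
  proof -
    have "?I \<le> (\<integral>\<^sup>+t. H (vjoin a y + cis t *s vjoin b 0) * indicator {0..2*pi} t \<partial>lborel)"
      unfolding vjoin_add_smult by (intro nn_integral_mono mult_right_mono INF_lower y) auto
    also have "\<dots> \<le> ennreal (2*pi) * H (vjoin a y)"
    proof -
      have "\<forall>\<zeta>. cmod \<zeta> \<le> 1 \<longrightarrow> vjoin a y + \<zeta> *s vjoin b 0 \<in> prod_dom V W"
        using ab y C(2) by (auto simp: vjoin_add_smult vjoin_in_prod_dom)
      then show ?thesis using H unfolding super_on_def by blast
    qed
    finally show ?thesis .
  qed
  then have "ennreal (inverse (2*pi)) * ?I \<le> H (vjoin a y)" if "y \<in> C" for y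
    using that by (subst ennreal_inverse_mult_le_iff) auto
  then have "ennreal (inverse (2*pi)) * ?I \<le> (INF y\<in>C. H (vjoin a y))" by (intro INF_greatest)
  then show "?I \<le> ennreal (2*pi) * (INF y\<in>C. H (vjoin a y))"
    by (subst (asm) ennreal_inverse_mult_le_iff) auto
qed

lemma suminf_eq_top:
  fixes x :: "nat \<Rightarrow> ennreal"
  assumes "0 < e" "\<And>j. n \<le> j \<Longrightarrow> ennreal e \<le> x j"
  shows "(\<Sum>j. x j) = \<infinity>"
proof -
  have "of_nat m * ennreal e \<le> (\<Sum>j. x j)" for m
  proof -
    have "of_nat m * ennreal e = (\<Sum>j\<in>{n..<n + m}. ennreal e)" by simp
    also have "\<dots> \<le> (\<Sum>j\<in>{n..<n + m}. x j)" by (intro sum_mono assms(2)) auto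
    also have "\<dots> \<le> (\<Sum>j. x j)" by (rule sum_le_suminf) auto
    finally show ?thesis .
  qed
  then have "(SUP m. of_nat m * ennreal e) \<le> (\<Sum>j. x j)" by (intro SUP_least)
  moreover have "(SUP m. of_nat m * ennreal e) = top"
    using assms(1) by (simp add: SUP_mult_right_ennreal[symmetric] ennreal_SUP_of_nat_eq_top ennreal_top_mult)
  ultimately show ?thesis by (simp add: top_unique)
qed

lemma usc_bounded_above:
  fixes u :: "complex^'n \<Rightarrow> ereal"
  assumes "usc_on \<Omega> u" "open \<Omega>" "\<And>z. z \<in> \<Omega> \<Longrightarrow> u z \<noteq> \<infinity>" "compact Q" "Q \<subseteq> \<Omega>"
  obtains M :: real where "0 \<le> M" "\<And>z. z \<in> Q \<Longrightarrow> u z \<le> ereal M"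
proof -
  have "\<exists>n. \<forall>j z. n \<le> j \<longrightarrow> z \<in> Q \<longrightarrow> z \<in> {z\<in>\<Omega>. u z < ereal (real j)}"
  proof (rule compact_increasing_cover[OF assms(4), of "\<lambda>j. {z\<in>\<Omega>. u z < ereal (real j)}"])
    show "open {z\<in>\<Omega>. u z < ereal (real j)}" for j by (rule usc_on_open[OF assms(1,2)])
    show "Q \<subseteq> (\<Union>j. {z\<in>\<Omega>. u z < ereal (real j)})"
    proof
      fix z assume z: "z \<in> Q"
      have "\<exists>j::nat. u z < ereal (real j)"
        using assms(3,5) z reals_Archimedean2 by (cases "u z") auto
      then show "z \<in> (\<Union>j. {z\<in>\<Omega>. u z < ereal (real j)})" using z assms(5) by blast
    qed
    show "z \<in> {z\<in>\<Omega>. u z < ereal (real (Suc j))}" if "z \<in> {z\<in>\<Omega>. u z < ereal (real j)}" for j z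
      using that by (auto elim: less_trans)
  qed blast
  then obtain n where n: "\<And>z. z \<in> Q \<Longrightarrow> u z < ereal (real n)" by blast
  show thesis by (rule that[of "real n"]) (use n in \<open>auto intro: less_imp_le\<close>)
qed

text \<open>Supplies the value at the centre \<open>w2\<close>, where the inequality in
  \<open>lelong_set\<close> says nothing.\<close>

lemma super_on_point_ge:
  fixes h :: "complex^'n \<Rightarrow> ennreal"
  assumes h: "super_on V h" and ab: "\<And>\<zeta>. cmod \<zeta> \<le> 1 \<Longrightarrow> a + \<zeta> *s b \<in> V"
    and c: "\<And>t. c \<le> h (a + cis t *s b)"
  shows "c \<le> h a"
proof -
  have "ennreal (2*pi) * c = (\<integral>\<^sup>+t. c * indicator {0..2*pi} t \<partial>lborel)"
    by (subst nn_integral_cmult_indicator) (auto simp: mult.commute)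
  also have "\<dots> \<le> (\<integral>\<^sup>+t. h (a + cis t *s b) * indicator {0..2*pi} t \<partial>lborel)"
    by (intro nn_integral_mono mult_right_mono c) auto
  also have "\<dots> \<le> ennreal (2*pi) * h a" using h ab unfolding super_on_def by blast
  finally have "ennreal (inverse (2*pi)) * (ennreal (2*pi) * c) \<le> h a"
    by (subst ennreal_inverse_mult_le_iff) auto
  moreover have "ennreal (inverse (2*pi)) * (ennreal (2*pi) * c) = c"
    by (simp add: mult.assoc[symmetric] ennreal_mult[symmetric])
  ultimately show ?thesis by simp
qed

text \<open>Either a subsequence is summable at one point, and its sum is the required function, or the
  sequence is bounded below locally uniformly: Fatou's lemma combined with the mean value inequality.\<close>

lemma super_on_sequence_dichotomy:
  fixes h :: "nat \<Rightarrow> complex^'n::finite \<Rightarrow> ennreal"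
  assumes d: "0 < d" and h: "\<And>i. super_on (ball a d) (h i)"
  shows "(\<exists>v. psh_on (ball a d) v \<and>
      (\<forall>z e n. 0 < e \<and> (\<forall>i\<ge>n. ennreal e \<le> h i z) \<longrightarrow> v z = - \<infinity>)) \<or>
    (\<exists>c n. 0 < c \<and> (\<forall>i\<ge>n. \<forall>z\<in>ball a (d / 4). ennreal c \<le> h i z))"
proof (cases "\<exists>x\<in>ball a d. \<forall>e>0. \<forall>n. \<exists>i\<ge>n. h i x < ennreal e")
  case True
  then obtain x where x: "x \<in> ball a d" "\<And>e n. e > 0 \<Longrightarrow> \<exists>i\<ge>n. h i x < ennreal e" by blast
  \<comment> \<open>The chosen terms are dominated at \<open>x\<close> by a geometric series, so
    their sum is finite there.\<close>
  obtain \<sigma> :: "nat \<Rightarrow> nat" where \<sigma>: "strict_mono \<sigma>" "\<And>j. h (\<sigma> j) x < ennreal ((1/2) ^ j)"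
  proof -
    have "\<exists>\<sigma>. \<forall>j. h (\<sigma> j) x < ennreal ((1/2) ^ j) \<and> \<sigma> j < \<sigma> (Suc j)"
    proof (rule dependent_nat_choice)
      show "\<exists>i. h i x < ennreal ((1/2) ^ 0)" using x(2)[of 1 0] by auto
      show "\<exists>i'. h i' x < ennreal ((1/2) ^ Suc j) \<and> i < i'" for i j
        using x(2)[of "(1/2) ^ Suc j" "Suc i"] by (auto simp: Suc_le_eq)
    qed
    then show thesis using that by (auto simp: strict_mono_Suc_iff)
  qed
  let ?S = "\<lambda>z. \<Sum>j. h (\<sigma> j) z"
  have S: "super_on (ball a d) ?S" by (rule super_on_suminf) (rule h)
  have "?S x \<le> (\<Sum>j. ennreal ((1/2) ^ j))" using \<sigma>(2) by (intro suminf_le) (auto intro: less_imp_le)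
  also have "\<dots> = ennreal (\<Sum>j. (1/2) ^ j)" by (rule suminf_ennreal2) (auto intro!: summable_geometric)
  finally have fin: "?S x \<noteq> \<infinity>" using neq_top_trans[of "ennreal (\<Sum>j. (1/2) ^ j)" "?S x"] by simp
  have "psh_on (ball a d) (\<lambda>z. - enn2ereal (?S z))"
    by (rule super_on_imp_psh[OF S connected_ball x(1) fin])
  moreover have "- enn2ereal (?S z) = - \<infinity>" if "0 < e" "\<forall>i\<ge>n. ennreal e \<le> h i z" for z e n
  proof -
    have "ennreal e \<le> h (\<sigma> j) z" if "n \<le> j" for j
      using \<open>\<forall>i\<ge>n. ennreal e \<le> h i z\<close> strict_mono_imp_increasing[OF \<sigma>(1), of j] that order_trans by blast
    then have "?S z = \<infinity>" by (rule suminf_eq_top[OF \<open>0 < e\<close>])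
    then show ?thesis by simp
  qed
  ultimately show ?thesis by blast
next
  case False
  have low: "\<exists>e>0. \<exists>n. \<forall>i\<ge>n. ennreal e \<le> h i x" if "x \<in> ball a d" for x
    using False that by (meson not_le)
  let ?B = "ball a (d / 4)"
  define h0 where "h0 i x = (if x \<in> ball a d then h i x else 0)" for i x
  have [measurable]: "h0 i \<in> borel_measurable borel" for i
    unfolding h0_def[abs_def] by (rule super_on_measurable[OF h])
  have Bm [measurable]: "?B \<in> sets borel" by simp
  define A where "A i = (\<integral>\<^sup>+x. indicator ?B x * h0 i x \<partial>lborel)" for i
  have "(\<integral>\<^sup>+x. liminf (\<lambda>i. indicator ?B x * h0 i x) \<partial>lborel) \<noteq> 0"
  proof
    assume "(\<integral>\<^sup>+x. liminf (\<lambda>i. indicator ?B x * h0 i x) \<partial>lborel) = 0"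
    then have "AE x in lborel. liminf (\<lambda>i. indicator ?B x * h0 i x) = 0"
      by (subst (asm) nn_integral_0_iff_AE) auto
    moreover have "liminf (\<lambda>i. indicator ?B x * h0 i x) \<noteq> 0" if x: "x \<in> ?B" for x
    proof -
      have xd: "x \<in> ball a d" using x d by simp
      obtain e n where e: "0 < e" "\<forall>i\<ge>n. ennreal e \<le> h i x" using low[OF xd] by blast
      have "ennreal e \<le> liminf (\<lambda>i. indicator ?B x * h0 i x)"
        by (rule Liminf_bounded) (use e x xd in \<open>auto simp: h0_def eventually_sequentially\<close>)
      then show ?thesis using e(1) by (auto simp: ennreal_eq_0_iff dest: le_zero_eq[THEN iffD1])
    qed
    ultimately have "AE x in lborel. x \<notin> ?B" by (auto elim: eventually_mono)
    then have "emeasure lborel ?B = 0" using AE_iff_null_sets[of ?B lborel] by (metis Bm null_setsD1 sets_lborel)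
    then have "unit_ball_vol (real DIM(complex^'n)) * (d / 4) ^ DIM(complex^'n) \<le> 0"
      using d by (simp add: emeasure_ball ennreal_eq_0_iff)
    moreover have "0 < unit_ball_vol (real DIM(complex^'n)) * (d / 4) ^ DIM(complex^'n)"
      using d by (intro mult_pos_pos unit_ball_vol_pos zero_less_power) auto
    ultimately show False by linarith
  qed
  then have "0 < (\<integral>\<^sup>+x. liminf (\<lambda>i. indicator ?B x * h0 i x) \<partial>lborel)"
    by (simp only: zero_less_iff_neq_zero not_False_eq_True)
  from dense[OF this] obtain c0 where
    c0: "0 < c0" "c0 < (\<integral>\<^sup>+x. liminf (\<lambda>i. indicator ?B x * h0 i x) \<partial>lborel)" by (elim exE conjE)
  have "(\<integral>\<^sup>+x. liminf (\<lambda>i. indicator ?B x * h0 i x) \<partial>lborel) \<le> liminf A"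
    unfolding A_def by (rule nn_integral_liminf) measurable
  then have "c0 < liminf A" using c0(2) by (rule less_le_trans[rotated])
  from less_LiminfD[OF this] obtain n where n: "\<And>i. i \<ge> n \<Longrightarrow> c0 < A i"
    unfolding eventually_sequentially by (elim exE) blast
  define v where "v = measure lborel (cball (0::complex^'n) (d / 2))"
  have v_e: "emeasure lborel (cball (0::complex^'n) (d / 2)) = ennreal v"
    unfolding v_def using emeasure_lborel_cball_finite[of "0::complex^'n" "d / 2"] by (intro emeasure_eq_ennreal_measure) simp
  have v: "0 < v" unfolding v_def using d by (simp add: measure_def emeasure_cball unit_ball_vol_pos)
  \<comment> \<open>The ball of radius d / 2 about any \<open>z\<close> in \<open>?B\<close>
    contains \<open>?B\<close> and stays inside \<open>ball a d\<close>, so the one integral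
    \<open>A i\<close> bounds \<open>h i\<close> from below at all such \<open>z\<close>.\<close>
  have mean: "A i \<le> h i z * ennreal v" if z: "z \<in> ?B" for z i
  proof -
    let ?\<phi> = "indicator (cball (0::complex^'n) (d / 2)) :: _ \<Rightarrow> ennreal"
    have "A i = (\<integral>\<^sup>+x. indicator ?B (x + z) * h0 i (x + z) \<partial>lborel)"
      unfolding A_def by (rule nn_integral_lborel_translate[symmetric]) measurable
    also have "\<dots> \<le> (\<integral>\<^sup>+x. ?\<phi> x * h i (z + 1 *\<^sub>R x) \<partial>lborel)"
    proof (rule nn_integral_mono)
      fix x :: "complex^'n"
      show "indicator ?B (x + z) * h0 i (x + z) \<le> ?\<phi> x * h i (z + 1 *\<^sub>R x)"
      proof (cases "x + z \<in> ?B")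
        case True
        have "norm x = dist (x + z) z" by (simp add: dist_norm)
        also have "\<dots> \<le> dist (x + z) a + dist a z" by (rule dist_triangle)
        also have "\<dots> \<le> d / 2" using True z by (simp add: dist_commute)
        finally show ?thesis using True d by (simp add: h0_def add.commute)
      qed simp
    qed
    also have "\<dots> \<le> h i z * (\<integral>\<^sup>+x. ?\<phi> x \<partial>lborel)"
    proof (rule super_on_mean[OF h])
      show "?\<phi> (cis t *s x) = ?\<phi> x" for t x by (simp add: indicator_def norm_cis_smult)
      show "cball z (1 * norm x) \<subseteq> ball a d" if "?\<phi> x \<noteq> 0" for x
      proof
        fix y assume "y \<in> cball z (1 * norm x)"
        then have "dist z y \<le> d / 2" using that by (auto simp: indicator_def split: if_splits)
        moreover have "dist a y \<le> dist a z + dist z y" by (rule dist_triangle)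
        ultimately show "y \<in> ball a d" using z d by simp
      qed
    qed (auto intro!: borel_measurable_indicator)
    also have "(\<integral>\<^sup>+x. ?\<phi> x \<partial>lborel) = ennreal v" by (simp add: v_e)
    finally show ?thesis .
  qed
  obtain c1 where c1: "0 < c1" "ennreal c1 \<le> c0"
  proof (cases c0 rule: ennreal_cases)
    case (real r)
    then show ?thesis using that[of r] c0(1) by simp
  qed (use that[of 1] in simp)
  have "ennreal (c1 / v) \<le> h i z" if "i \<ge> n" "z \<in> ?B" for i z
  proof -
    have "ennreal c1 \<le> ennreal v * h i z"
      using c1(2) n[OF that(1)] mean[OF that(2), of i] by (simp add: mult.commute)
    then have "ennreal (inverse v) * ennreal c1 \<le> h i z"
      using v by (subst ennreal_inverse_mult_le_iff) auto
    then show ?thesis using v c1 by (simp add: ennreal_mult[symmetric] divide_inverse mult.commute)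
  qed
  then show ?thesis using c1 v by (intro disjI2 exI[of _ "c1 / v"] exI[of _ n]) auto
qed

text \<open>The first alternative of \<open>super_on_sequence_dichotomy\<close> is the required
  function on a ball about \<open>a\<close>; the second is a uniform logarithmic pole, which
  \<open>cE_no_uniform_log_pole\<close> excludes.\<close>

lemma lelong_sets_locally_polar:
  fixes \<Omega>1 :: "(complex^'k) set" and \<Omega>2 :: "(complex^'m) set"
    and u :: "complex^('k + 'm) \<Rightarrow> ereal" and w2 :: "complex^'m"
  assumes \<Omega>1: "open \<Omega>1" "bounded \<Omega>1" and \<Omega>2: "open \<Omega>2" "bounded \<Omega>2"
    and u: "cE (prod_dom \<Omega>1 \<Omega>2) u" and w2: "w2 \<in> \<Omega>2" and a: "a \<in> \<Omega>1"
  shows "\<exists>V v. open V \<and> a \<in> V \<and> psh_on V v \<and>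
    (\<forall>z\<in>(\<Union>t\<in>{0<..}. lelong_set u \<Omega>1 \<Omega>2 t w2) \<inter> V. v z = - \<infinity>)"
proof -
  let ?\<Omega> = "prod_dom \<Omega>1 \<Omega>2"
  have psh: "psh_on ?\<Omega> u" using u by (simp add: cE_def)
  have op: "open ?\<Omega>" by (rule open_prod_dom[OF \<Omega>1(1) \<Omega>2(1)])
  obtain d1 where d1: "d1 > 0" "cball a d1 \<subseteq> \<Omega>1" using \<Omega>1 a open_contains_cball by blast
  obtain d2 where d2: "d2 > 0" "cball w2 d2 \<subseteq> \<Omega>2" using \<Omega>2 w2 open_contains_cball by blast
  define d where "d = min d1 d2"
  have d: "d > 0" using d1 d2 by (simp add: d_def)
  have sub: "cball a d \<subseteq> \<Omega>1" "cball w2 d \<subseteq> \<Omega>2"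
    using d1 d2 subset_cball[of d d1 a] subset_cball[of d d2 w2] by (auto simp: d_def)
  define Q where "Q = (\<lambda>p. vjoin (fst p) (snd p)) ` (cball a d \<times> cball w2 d)"
  have cQ: "compact Q" unfolding Q_def
    by (intro compact_continuous_image compact_Times compact_cball continuous_on_vjoin continuous_intros)
  have Q\<Omega>: "Q \<subseteq> ?\<Omega>" using sub unfolding Q_def by (auto simp: vjoin_in_prod_dom subset_iff)
  obtain M :: real where M: "0 \<le> M" "\<And>z. z \<in> Q \<Longrightarrow> u z \<le> ereal M"
    using usc_bounded_above[of ?\<Omega> u Q] psh op cQ Q\<Omega> by (auto simp: psh_on_def)
  define V where "V = ball a d"
  define W where "W = ball w2 d"
  have VWQ: "prod_dom V W \<subseteq> Q" by (force simp: prod_dom_def Q_def V_def W_def)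
  define H where "H z = e2ennreal (ereal M - u z)" for z
  have SH: "super_on (prod_dom V W) H"
    unfolding H_def[abs_def]
  proof (rule psh_imp_super_on[OF psh _ _ M(1)])
    show "open (prod_dom V W)" unfolding V_def W_def by (rule open_prod_dom) auto
    show "prod_dom V W \<subseteq> ?\<Omega>" using VWQ Q\<Omega> by blast
    show "u z \<le> ereal M" if "z \<in> prod_dom V W" for z using M(2) VWQ that by blast
  qed
  \<comment> \<open>\<open>i1\<close> makes all radii exp (-(i + i1)) smaller than \<open>d\<close>
    and all divisors i + i1 positive.\<close>
  obtain i1 :: nat where i1: "max 1 (ln (1 / d)) < real i1" using reals_Archimedean2 by blast
  have r_lt: "exp (- real (i + i1)) < d" for i
  proof -
    have "exp (- real (i + i1)) < exp (- ln (1 / d))" using i1 by simp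
    also have "\<dots> = d" using d by (simp add: exp_minus)
    finally show ?thesis .
  qed
  define C where "C i = cball w2 (exp (- real (i + i1)))" for i
  have C: "compact (C i)" "C i \<subseteq> W" "C i \<noteq> {}" for i using r_lt[of i] by (auto simp: C_def W_def)
  define g where "g i x = (INF y\<in>C i. H (vjoin x y))" for i x
  \<comment> \<open>Dividing by i + i1, minus the logarithm of the radius, turns a logarithmic pole
    into a lower bound independent of \<open>i\<close>.\<close>
  define h where "h i x = ennreal (inverse (real (i + i1))) * g i x" for i x
  have Sh: "super_on V (h i)" for i
    unfolding h_def g_def V_def
    by (intro super_on_cmult super_on_INF[OF SH[unfolded V_def] open_ball C]) (use i1 in auto)
  have hg: "ennreal c \<le> h i x \<longleftrightarrow> ennreal (c * real (i + i1)) \<le> g i x" if "0 \<le> c" for c i x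
  proof -
    have p: "0 < real (i + i1)" using i1 by simp
    have "ennreal (c * real (i + i1)) \<le> g i x \<longleftrightarrow> ennreal (real (i + i1)) * ennreal c \<le> g i x"
      by (simp only: ennreal_mult[OF that of_nat_0_le_iff] mult.commute)
    also have "\<dots> \<longleftrightarrow> ennreal c \<le> ennreal (inverse (real (i + i1))) * g i x"
      by (rule ennreal_mult_le_iff_inverse[OF p])
    finally show ?thesis by (simp add: h_def)
  qed
  have uH: "ennreal c \<le> H z \<longleftrightarrow> u z \<le> ereal (M - c)" if "0 \<le> c" "u z \<le> ereal M" for c z
  proof -
    have "ennreal c \<le> H z \<longleftrightarrow> ereal c \<le> ereal M - u z"
      unfolding H_def using that by (cases "u z") (auto simp: ennreal_le_iff2)
    also have "\<dots> \<longleftrightarrow> u z \<le> ereal (M - c)" by (cases "u z") auto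
    finally show ?thesis .
  qed
  have on_E: "\<exists>e n. 0 < e \<and> (\<forall>i\<ge>n. ennreal e \<le> h i z)" if z: "z \<in> V" "z \<in> lelong_set u \<Omega>1 \<Omega>2 t w2" and t: "0 < t" for z t
  proof -
    obtain K :: real where K: "\<And>y. y \<in> \<Omega>2 - {w2} \<Longrightarrow> u (vjoin z y) \<le> ereal (t * ln (norm (y - w2)) + K)"
      using z(2) by (auto simp: lelong_set_def)
    \<comment> \<open>From this index on, half of the slope \<open>t\<close> absorbs the constants
      \<open>K\<close> and \<open>M\<close>, which leaves the bound t / 2.\<close>
    obtain n :: nat where n: "2 * (K - M) / t < real n" using reals_Archimedean2 by blast
    have "ennreal (t / 2) \<le> h i z" if i: "n \<le> i" for i
    proof -
      let ?r = "exp (- real (i + i1))"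
      have "2 * (K - M) / t < real (i + i1)" using n i by linarith
      then have KM: "K - M < t / 2 * real (i + i1)" using t by (simp add: field_simps)
      have away: "ennreal (t / 2 * real (i + i1)) \<le> H (vjoin z y)" if y: "y \<in> C i" "y \<noteq> w2" for y
      proof -
        have yW: "y \<in> W" "y \<in> \<Omega>2" using y(1) C(2)[of i] sub ball_subset_cball[of w2 d] unfolding W_def by blast+
        have "ln (norm (y - w2)) \<le> ln ?r" using y by (subst ln_le_cancel_iff) (auto simp: C_def dist_norm norm_minus_commute)
        then have "t * ln (norm (y - w2)) \<le> t * (- real (i + i1))" using t by (intro mult_left_mono) auto
        moreover have "t * (- real (i + i1)) = - (t / 2 * real (i + i1)) - t / 2 * real (i + i1)"
          by (simp add: field_simps)
        ultimately have "t * ln (norm (y - w2)) + K \<le> M - t / 2 * real (i + i1)" using KM by linarith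
        then have "u (vjoin z y) \<le> ereal (M - t / 2 * real (i + i1))"
          using K[of y] yW y(2) order_trans by (metis Diff_iff ereal_less_eq(3) singletonD)
        moreover have "u (vjoin z y) \<le> ereal M" using M(2) VWQ z(1) yW by (meson subsetD vjoin_in_prod_dom)
        ultimately show ?thesis using uH t by simp
      qed
      have "ennreal (t / 2 * real (i + i1)) \<le> H (vjoin z y)" if y: "y \<in> C i" for y
      proof (cases "y = w2")
        case True
        \<comment> \<open>\<open>lelong_set\<close> leaves out the point \<open>w2\<close>, so the
          bound there is taken from a circle around it in the last variables.\<close>
        define b :: "complex^'m" where "b = ?r *\<^sub>R axis undefined 1"
        have "norm (axis undefined 1 :: complex^'m) = 1"
          by (rule norm_Basis) (auto simp: Basis_vec_def Basis_complex_def)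
        then have nb: "norm b = ?r" by (simp add: b_def)
        have in_C: "w2 + \<zeta> *s b \<in> C i" if "cmod \<zeta> \<le> 1" for \<zeta>
        proof -
          have "norm (\<zeta> *s b) = cmod \<zeta> * norm b"
            by (simp add: norm_vec_def L2_set_def norm_mult power_mult_distrib sum_distrib_left[symmetric] real_sqrt_mult)
          then show ?thesis using that by (simp add: C_def dist_norm nb mult_left_le_one_le)
        qed
        have "ennreal (t / 2 * real (i + i1)) \<le> H (vjoin z w2)"
        proof (rule super_on_point_ge[OF SH, of "vjoin z w2" "vjoin 0 b"])
          show "vjoin z w2 + \<zeta> *s vjoin 0 b \<in> prod_dom V W" if "cmod \<zeta> \<le> 1" for \<zeta>
            using in_C[OF that] C(2)[of i] z(1) by (auto simp: vjoin_add_smult vjoin_in_prod_dom)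
          show "ennreal (t / 2 * real (i + i1)) \<le> H (vjoin z w2 + cis s *s vjoin 0 b)" for s
            unfolding vjoin_add_smult
          proof (rule away)
            show "w2 + cis s *s b \<in> C i" by (rule in_C) simp
            have "norm (cis s *s b) \<noteq> 0" by (simp add: norm_cis_smult nb)
            then show "w2 + cis s *s b \<noteq> w2" by auto
          qed
        qed
        then show ?thesis using True by simp
      qed (rule away[OF y])
      then have "ennreal (t / 2 * real (i + i1)) \<le> g i z" unfolding g_def by (intro INF_greatest)
      then show ?thesis using hg[of "t / 2" i z] t by simp
    qed
    then show ?thesis using t by (intro exI[of _ "t / 2"] exI[of _ n]) auto
  qed
  have "(\<exists>v. psh_on V v \<and> (\<forall>z e n. 0 < e \<and> (\<forall>i\<ge>n. ennreal e \<le> h i z) \<longrightarrow> v z = - \<infinity>)) \<or>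
    (\<exists>c n. 0 < c \<and> (\<forall>i\<ge>n. \<forall>z\<in>ball a (d / 4). ennreal c \<le> h i z))"
    unfolding V_def by (rule super_on_sequence_dichotomy[OF d]) (use Sh in \<open>simp add: V_def\<close>)
  then show ?thesis
  proof (elim disjE exE conjE)
    fix v assume v: "psh_on V v" "\<forall>z e n. 0 < e \<and> (\<forall>i\<ge>n. ennreal e \<le> h i z) \<longrightarrow> v z = - \<infinity>"
    have "v z = - \<infinity>" if z: "z \<in> (\<Union>t\<in>{0<..}. lelong_set u \<Omega>1 \<Omega>2 t w2) \<inter> V" for z
    proof -
      obtain t where "0 < t" "z \<in> lelong_set u \<Omega>1 \<Omega>2 t w2" "z \<in> V" using z by auto
      then obtain e n where "0 < e" "\<forall>i\<ge>n. ennreal e \<le> h i z" using on_E by meson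
      then show ?thesis using v(2) by meson
    qed
    moreover have "open V" "a \<in> V" using d by (auto simp: V_def)
    ultimately show ?thesis using v(1) by (intro exI[of _ V] exI[of _ v]) simp
  next
    fix c n assume c: "0 < c" and hc: "\<forall>i\<ge>n. \<forall>z\<in>ball a (d / 4). ennreal c \<le> h i z"
    have False
    proof (rule cE_no_uniform_log_pole[OF u bounded_prod_dom[OF \<Omega>1(2) \<Omega>2(2)], of "vjoin a w2" c "d / 4" "n + i1" M])
      show "vjoin a w2 \<in> ?\<Omega>" using a w2 by (simp add: vjoin_in_prod_dom)
      show "0 < c" "0 < d / 4" using c d by auto
      fix N and z :: "complex^('k + 'm)"
      assume N: "n + i1 \<le> N" and z1: "(\<Sum>b\<in>UNIV. cmod (z $ Inl b - vjoin a w2 $ Inl b)) < d / 4"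
        and z2: "(\<Sum>b\<in>UNIV. cmod (z $ Inr b - vjoin a w2 $ Inr b)) \<le> exp (- real N)"
      define x where "x = (\<chi> a. z $ Inl a)"
      define y where "y = (\<chi> b. z $ Inr b)"
      have zxy: "z = vjoin x y" by (simp add: x_def y_def vjoin_split)
      \<comment> \<open>The exponents in \<open>C\<close> are shifted by \<open>i1\<close>; the
        threshold n + i1 for \<open>N\<close> keeps \<open>i\<close> at or beyond
        \<open>n\<close>.\<close>
      define i where "i = N - i1"
      have i: "i + i1 = N" "n \<le> i" using N by (auto simp: i_def)
      have "norm (x - a) < d / 4" using norm_le_sum_cmod[of "x - a"] z1 by (simp add: x_def)
      then have x: "x \<in> ball a (d / 4)" "x \<in> V" using d by (auto simp: dist_norm norm_minus_commute V_def)
      have "norm (y - w2) \<le> exp (- real N)" using norm_le_sum_cmod[of "y - w2"] z2 by (simp add: y_def)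
      then have y: "y \<in> C i" by (simp add: C_def i dist_norm norm_minus_commute)
      have "ennreal (c * real (i + i1)) \<le> g i x" using hc i(2) x(1) hg[of c i x] c by simp
      also have "\<dots> \<le> H (vjoin x y)" unfolding g_def by (rule INF_lower[OF y])
      finally have "ennreal (c * real (i + i1)) \<le> H z" by (simp add: zxy)
      moreover have "u z \<le> ereal M" using M(2) VWQ x y C(2)[of i] unfolding zxy by (meson subsetD vjoin_in_prod_dom)
      ultimately show "u z \<le> ereal (M - c * real N)" using uH[of "c * real N" z] c by (simp add: i)
    qed
    then show ?thesis ..
  qed
qed

theorem theorem4p9:
  fixes \<Omega>1 :: "(complex^'k) set" and \<Omega>2 :: "(complex^'m) set"
    and u :: "complex^('k + 'm) \<Rightarrow> ereal" and w2 :: "complex^'m"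
  assumes "hyperconvex \<Omega>1" and "hyperconvex \<Omega>2"
    and "cE (prod_dom \<Omega>1 \<Omega>2) u"
    and "w2 \<in> \<Omega>2"
  shows "pluripolar_in \<Omega>1 (\<Union>t\<in>{0<..}. lelong_set u \<Omega>1 \<Omega>2 t w2)"
  unfolding pluripolar_in_def
proof (intro conjI ballI)
  show sub: "(\<Union>t\<in>{0<..}. lelong_set u \<Omega>1 \<Omega>2 t w2) \<subseteq> \<Omega>1" by (auto simp: lelong_set_def)
  fix a assume "a \<in> (\<Union>t\<in>{0<..}. lelong_set u \<Omega>1 \<Omega>2 t w2)"
  then have "a \<in> \<Omega>1" using sub by blast
  then show "\<exists>V v. open V \<and> a \<in> V \<and> psh_on V v \<and>
      (\<forall>z\<in>(\<Union>t\<in>{0<..}. lelong_set u \<Omega>1 \<Omega>2 t w2) \<inter> V. v z = - \<infinity>)"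
    using assms by (intro lelong_sets_locally_polar) (auto simp: hyperconvex_def)
qed

end
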